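(* Let $V_+,V_-\in\mathbb{C}$ and let $\mathcal{L}$ be the operator on $L^2(\mathbb{R})$ with $\mathrm{Dom}(\mathcal{L})=H^2(\mathbb{R})$, $\mathcal{L}u=-u''+Vu$, where $V(x)=V_+$ for $x\ge0$ and $V(x)=V_-$ for $x<0$. Then the following holds. (1) If $\mathrm{Im}\,V_+=\mathrm{Im}\,V_-$, then for every $\varepsilon>0$ the $\varepsilon$-pseudospectrum of $\mathcal{L}$ is $$\sigma_\varepsilon(\mathcal{L})=\{z\in\mathbb{C}:\mathrm{dist}(z,\sigma(\mathcal{L}))<\varepsilon\}.$$ (2) If $\mathrm{Im}\,V_+\ne\mathrm{Im}\,V_-$, then for every $\varepsilon'\in(0,1)$ there exists $M>0$ such that, for every $\varepsilon>0$, the set $\sigma_\varepsilon(\mathcal{L})$ contains $$\{z\in\mathbb{C}:\mathrm{dist}(z,\sigma(\mathcal{L}))<\varepsilon\}$$ and also contains the set of all $z\in\mathbb{C}$ such that $\mathrm{Re}\,z>M$, $\mathrm{Im}\,z\in|(\mathrm{Im}\,V_+,\mathrm{Im}\,V_-)|$ and $$\mathrm{Re}\,z>\frac{1}{\varepsilon(1-\varepsilon')}\,\frac{|V_+-V_-|\,|\mathrm{Im}\,V_+-\mathrm{Im}\,z|\,|\mathrm{Im}\,V_--\mathrm{Im}\,z|}{2|\mathrm{Im}\,V_+-\mathrm{Im}\,V_-|}.$$ As a consequence, the pseudospectrum of $\mathcal{L}$ is trivial if and only if $\mathrm{Im}\,V_+=\mathrm{Im}\,V_-$.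
   Context: For $\varepsilon>0$ the $\varepsilon$-pseudospectrum of a closed operator $S$ is $\sigma_\varepsilon(S)=\sigma(S)\cup\{z\in\mathbb{C}\setminus\sigma(S):\|(S-z)^{-1}\|>\varepsilon^{-1}\}$. The pseudospectrum of $S$ is called trivial if there exists $C>0$ such that for all $\varepsilon>0$, $\sigma_\varepsilon(S)\subset\{z\in\mathbb{C}:\mathrm{dist}(z,\sigma(S))<C\varepsilon\}$. For real $a\ne b$, $|(a,b)|$ denotes the open interval with endpoints $a$ and $b$. *)

theory Defs
  imports "HOL-Analysis.Analysis"
begin

subsection \<open>Unbounded operators, spectrum and pseudospectrum\<close>

class complex_normed_vector = real_normed_vector +
  fixes scaleC :: "complex \<Rightarrow> 'a \<Rightarrow> 'a" (infixr "*\<^sub>C" 75)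
  assumes scaleC_add_right: "a *\<^sub>C (x + y) = a *\<^sub>C x + a *\<^sub>C y"
    and scaleC_add_left: "(a + b) *\<^sub>C x = a *\<^sub>C x + b *\<^sub>C x"
    and scaleC_scaleC: "a *\<^sub>C b *\<^sub>C x = (a * b) *\<^sub>C x"
    and scaleC_of_real: "complex_of_real r *\<^sub>C x = r *\<^sub>R x"
    and norm_scaleC: "norm (a *\<^sub>C x) = cmod a * norm x"

text \<open>An operator is a pair of its domain and its action; values of the action off the domain
  are irrelevant.\<close>

type_synonym 'a operator = "'a set \<times> ('a \<Rightarrow> 'a)"

definition resolvent :: "'a::complex_normed_vector operator \<Rightarrow> complex \<Rightarrow> 'a \<Rightarrow> 'a" where
  "resolvent S z = inv_into (fst S) (\<lambda>u. snd S u - z *\<^sub>C u)"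

definition resolvent_set :: "'a::complex_normed_vector operator \<Rightarrow> complex set" where
  "resolvent_set S =
     {z. bij_betw (\<lambda>u. snd S u - z *\<^sub>C u) (fst S) UNIV \<and> bounded_linear (resolvent S z)}"

definition spectrum :: "'a::complex_normed_vector operator \<Rightarrow> complex set" where
  "spectrum S = - resolvent_set S"

definition pseudospectrum :: "real \<Rightarrow> 'a::complex_normed_vector operator \<Rightarrow> complex set" where
  "pseudospectrum \<epsilon> S =
     spectrum S \<union> {z. z \<notin> spectrum S \<and> onorm (resolvent S z) > inverse \<epsilon>}"

text \<open>The set of points at distance less than \<open>r\<close> from \<open>A\<close>. The guard is there because the library
  sets \<open>infdist z {} = 0\<close>, whereas the distance to the empty set should be infinite.\<close>

definition open_nbhd :: "complex set \<Rightarrow> real \<Rightarrow> complex set" where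
  "open_nbhd A r = {z. A \<noteq> {} \<and> infdist z A < r}"

definition trivial_pseudospectrum :: "'a::complex_normed_vector operator \<Rightarrow> bool" where
  "trivial_pseudospectrum S \<longleftrightarrow>
     (\<exists>C>0. \<forall>\<epsilon>>0. pseudospectrum \<epsilon> S \<subseteq> open_nbhd (spectrum S) (C * \<epsilon>))"


subsection \<open>The space of square-integrable functions on the real line\<close>

definition square_integrable :: "(real \<Rightarrow> complex) \<Rightarrow> bool" where
  "square_integrable f \<longleftrightarrow>
     f \<in> borel_measurable lborel \<and> integrable lborel (\<lambda>x. (cmod (f x))\<^sup>2)"

definition l2_rel :: "(real \<Rightarrow> complex) \<Rightarrow> (real \<Rightarrow> complex) \<Rightarrow> bool" where
  "l2_rel f g \<longleftrightarrow>
     square_integrable f \<and> square_integrable g \<and> (AE x in lborel. f x = g x)"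

lemma square_integrable_zero: "square_integrable (\<lambda>x. 0)"
  by (simp add: square_integrable_def)

lemma part_equivp_l2_rel: "part_equivp l2_rel"
proof (rule part_equivpI)
  show "\<exists>f. l2_rel f f"
    using square_integrable_zero by (auto simp: l2_rel_def)
  show "symp l2_rel"
    by (auto simp: symp_def l2_rel_def elim: AE_mp)
  show "transp l2_rel"
    unfolding transp_def l2_rel_def by (auto elim!: AE_mp)
qed

quotient_type l2 = "real \<Rightarrow> complex" / partial: l2_rel
  by (rule part_equivp_l2_rel)

lemma square_integrable_mult_bounded:
  assumes "square_integrable f" and [measurable]: "h \<in> borel_measurable lborel"
    and b: "\<And>x. cmod (h x) \<le> B"
  shows "square_integrable (\<lambda>x. h x * f x)"
proof -
  have [measurable]: "f \<in> borel_measurable lborel"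
    and i: "integrable lborel (\<lambda>x. B\<^sup>2 * (cmod (f x))\<^sup>2)"
    using assms(1) by (auto simp: square_integrable_def)
  have "integrable lborel (\<lambda>x. (cmod (h x * f x))\<^sup>2)"
  proof (rule Bochner_Integration.integrable_bound[OF i])
    show "AE x in lborel. norm ((cmod (h x * f x))\<^sup>2) \<le> norm (B\<^sup>2 * (cmod (f x))\<^sup>2)"
      using b by (auto simp: norm_mult power_mult_distrib intro!: AE_I2 mult_right_mono power_mono)
  qed measurable
  then show ?thesis
    by (simp add: square_integrable_def)
qed

lemma square_integrable_scale: "square_integrable f \<Longrightarrow> square_integrable (\<lambda>x. c * f x)"
  by (rule square_integrable_mult_bounded[where B = "cmod c"]) auto

lemma square_integrable_add:
  assumes "square_integrable f" "square_integrable g"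
  shows "square_integrable (\<lambda>x. f x + g x)"
proof -
  have [measurable]: "f \<in> borel_measurable lborel" "g \<in> borel_measurable lborel"
    and i: "integrable lborel (\<lambda>x. 2 * (cmod (f x))\<^sup>2 + 2 * (cmod (g x))\<^sup>2)"
    using assms by (auto simp: square_integrable_def)
  have *: "(cmod (a + b))\<^sup>2 \<le> 2 * (cmod a)\<^sup>2 + 2 * (cmod b)\<^sup>2" for a b :: complex
  proof -
    have "(cmod (a + b))\<^sup>2 \<le> (cmod a + cmod b)\<^sup>2"
      by (intro power_mono norm_triangle_ineq) auto
    also have "\<dots> \<le> 2 * (cmod a)\<^sup>2 + 2 * (cmod b)\<^sup>2"
      using sum_squares_bound[of "cmod a" "cmod b"] by (simp add: power2_sum)
    finally show ?thesis .
  qed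
  have "integrable lborel (\<lambda>x. (cmod (f x + g x))\<^sup>2)"
  proof (rule Bochner_Integration.integrable_bound[OF i])
    show "AE x in lborel. norm ((cmod (f x + g x))\<^sup>2) \<le>
        norm (2 * (cmod (f x))\<^sup>2 + 2 * (cmod (g x))\<^sup>2)"
      using * by (intro AE_I2) auto
  qed measurable
  then show ?thesis
    by (simp add: square_integrable_def)
qed

lemma square_integrable_uminus: "square_integrable f \<Longrightarrow> square_integrable (\<lambda>x. - f x)"
  by (simp add: square_integrable_def)

lemma square_integrable_diff:
  "square_integrable f \<Longrightarrow> square_integrable g \<Longrightarrow> square_integrable (\<lambda>x. f x - g x)"
  using square_integrable_add[OF _ square_integrable_uminus] by fastforce

lemma integrable_inner_l2:
  assumes "square_integrable f" "square_integrable g"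
  shows "integrable lborel (\<lambda>x. inner (f x) (g x))"
proof -
  have [measurable]: "f \<in> borel_measurable lborel" "g \<in> borel_measurable lborel"
    and i: "integrable lborel (\<lambda>x. (cmod (f x))\<^sup>2 + (cmod (g x))\<^sup>2)"
    using assms by (auto simp: square_integrable_def)
  have *: "\<bar>inner a b\<bar> \<le> (cmod a)\<^sup>2 + (cmod b)\<^sup>2" for a b :: complex
  proof -
    have "\<bar>inner a b\<bar> \<le> cmod a * cmod b"
      by (rule Cauchy_Schwarz_ineq2)
    also have "\<dots> \<le> (cmod a)\<^sup>2 + (cmod b)\<^sup>2"
      using sum_squares_bound[of "cmod a" "cmod b"] mult_nonneg_nonneg[of "cmod a" "cmod b"] 
      by (simp add: field_simps del: mult_nonneg_nonneg)
    finally show ?thesis .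
  qed
  show ?thesis
  proof (rule Bochner_Integration.integrable_bound[OF i])
    show "AE x in lborel. norm (inner (f x) (g x)) \<le> norm ((cmod (f x))\<^sup>2 + (cmod (g x))\<^sup>2)"
      using * by (intro AE_I2) auto
  qed measurable
qed

instantiation l2 :: real_vector
begin

lift_definition zero_l2 :: l2 is "\<lambda>x. 0"
  by (simp add: l2_rel_def square_integrable_zero)

lift_definition plus_l2 :: "l2 \<Rightarrow> l2 \<Rightarrow> l2" is "\<lambda>f g x. f x + g x"
  unfolding l2_rel_def by (auto intro: square_integrable_add elim!: AE_mp)

lift_definition uminus_l2 :: "l2 \<Rightarrow> l2" is "\<lambda>f x. - f x"
  unfolding l2_rel_def by (auto intro: square_integrable_uminus elim!: AE_mp)

lift_definition minus_l2 :: "l2 \<Rightarrow> l2 \<Rightarrow> l2" is "\<lambda>f g x. f x - g x"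
  unfolding l2_rel_def by (auto intro: square_integrable_diff elim!: AE_mp)

lift_definition scaleR_l2 :: "real \<Rightarrow> l2 \<Rightarrow> l2" is "\<lambda>r f x. complex_of_real r * f x"
  unfolding l2_rel_def by (auto intro: square_integrable_scale elim!: AE_mp)

instance
proof
  fix f g h :: l2 and r s :: real
  show "f + g + h = f + (g + h)"
    by transfer (auto simp: l2_rel_def algebra_simps intro: square_integrable_add)
  show "f + g = g + f"
    by transfer (auto simp: l2_rel_def algebra_simps intro: square_integrable_add)
  show "0 + f = f"
    by transfer (auto simp: l2_rel_def)
  show "- f + f = 0"
    by transfer (auto simp: l2_rel_def square_integrable_zero)
  show "f - g = f + - g"
    by transfer (auto simp: l2_rel_def intro: square_integrable_diff)
  show "r *\<^sub>R (f + g) = r *\<^sub>R f + r *\<^sub>R g"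
    by transfer (auto simp: l2_rel_def ring_distribs
        intro!: square_integrable_add square_integrable_scale)
  show "(r + s) *\<^sub>R f = r *\<^sub>R f + s *\<^sub>R f"
    by transfer (auto simp: l2_rel_def ring_distribs
        intro!: square_integrable_add square_integrable_scale)
  show "r *\<^sub>R s *\<^sub>R f = (r * s) *\<^sub>R f"
    by transfer (auto simp: l2_rel_def mult.assoc intro!: square_integrable_scale)
  show "1 *\<^sub>R f = f"
    by transfer (auto simp: l2_rel_def)
qed

end

instantiation l2 :: real_inner
begin

text \<open>On \<open>complex\<close>, \<open>inner a b\<close> is the real part of \<open>a * cnj b\<close>, so this is the real part of the usual
  complex inner product and induces the usual norm.\<close>

lift_definition inner_l2 :: "l2 \<Rightarrow> l2 \<Rightarrow> real" is "\<lambda>f g. LINT x|lborel. inner (f x) (g x)"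
proof -
  fix f f' g g' :: "real \<Rightarrow> complex"
  assume a: "l2_rel f f'" "l2_rel g g'"
  then have [measurable]: "f \<in> borel_measurable lborel" "f' \<in> borel_measurable lborel"
      "g \<in> borel_measurable lborel" "g' \<in> borel_measurable lborel"
    by (auto simp: l2_rel_def square_integrable_def)
  show "(LINT x|lborel. inner (f x) (g x)) = (LINT x|lborel. inner (f' x) (g' x))"
  proof (rule integral_cong_AE)
    show "AE x in lborel. inner (f x) (g x) = inner (f' x) (g' x)"
      using a unfolding l2_rel_def by (auto elim!: AE_mp)
  qed measurable
qed

definition norm_l2 :: "l2 \<Rightarrow> real" where
  "norm_l2 f = sqrt (inner f f)"

definition dist_l2 :: "l2 \<Rightarrow> l2 \<Rightarrow> real" where
  "dist_l2 f g = norm (f - g)"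

definition sgn_l2 :: "l2 \<Rightarrow> l2" where
  "sgn_l2 f = f /\<^sub>R norm f"

definition uniformity_l2 :: "(l2 \<times> l2) filter" where
  "uniformity_l2 = (INF e\<in>{0<..}. principal {(f, g). dist f g < e})"

definition open_l2 :: "l2 set \<Rightarrow> bool" where
  "open_l2 U \<longleftrightarrow> (\<forall>f\<in>U. \<forall>\<^sub>F (f', g) in uniformity. f' = f \<longrightarrow> g \<in> U)"

instance
proof
  fix f g h :: l2 and r :: real and U :: "l2 set"
  show "dist f g = norm (f - g)"
    by (rule dist_l2_def)
  show "sgn f = f /\<^sub>R norm f"
    by (rule sgn_l2_def)
  show "uniformity = (INF e\<in>{0<..}. principal {(f :: l2, g). dist f g < e})"
    by (rule uniformity_l2_def)
  show "open U \<longleftrightarrow> (\<forall>f\<in>U. \<forall>\<^sub>F (f', g) in uniformity. f' = f \<longrightarrow> g \<in> U)"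
    by (rule open_l2_def)
  show "inner f g = inner g f"
    by transfer (simp add: inner_commute)
  show "inner (f + g) h = inner f h + inner g h"
    by transfer (auto simp: l2_rel_def inner_add_left integrable_inner_l2)
  show "inner (r *\<^sub>R f) g = r * inner f g"
  proof transfer
    fix r :: real and f g :: "real \<Rightarrow> complex"
    have "inner (complex_of_real r * f x) (g x) = r * inner (f x) (g x)" for x
      by (simp add: inner_complex_def distrib_left mult.assoc)
    then show "(LINT x|lborel. inner (complex_of_real r * f x) (g x)) =
        r * (LINT x|lborel. inner (f x) (g x))"
      by simp
  qed
  show "0 \<le> inner f f"
    by transfer simp
  show "inner f f = 0 \<longleftrightarrow> f = 0"
  proof transfer
    fix f assume "l2_rel f f"
    then have f: "square_integrable f"
      by (simp add: l2_rel_def)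
    have "(LINT x|lborel. inner (f x) (f x)) = 0 \<longleftrightarrow> (AE x in lborel. inner (f x) (f x) = 0)"
      by (rule integral_nonneg_eq_0_iff_AE) (auto intro: integrable_inner_l2 f)
    then show "(LINT x|lborel. inner (f x) (f x)) = 0 \<longleftrightarrow> l2_rel f (\<lambda>x. 0)"
      using f by (simp add: l2_rel_def square_integrable_zero)
  qed
  show "norm f = sqrt (inner f f)"
    by (rule norm_l2_def)
qed

end

instantiation l2 :: complex_normed_vector
begin

lift_definition scaleC_l2 :: "complex \<Rightarrow> l2 \<Rightarrow> l2" is "\<lambda>c f x. c * f x"
  unfolding l2_rel_def by (auto intro: square_integrable_scale elim!: AE_mp)

instance
proof
  fix f g :: l2 and a b :: complex and r :: real
  show "a *\<^sub>C (f + g) = a *\<^sub>C f + a *\<^sub>C g"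
    by transfer (auto simp: l2_rel_def ring_distribs
        intro!: square_integrable_add square_integrable_scale)
  show "(a + b) *\<^sub>C f = a *\<^sub>C f + b *\<^sub>C f"
    by transfer (auto simp: l2_rel_def ring_distribs
        intro!: square_integrable_add square_integrable_scale)
  show "a *\<^sub>C b *\<^sub>C f = (a * b) *\<^sub>C f"
    by transfer (auto simp: l2_rel_def mult.assoc intro!: square_integrable_scale)
  show "complex_of_real r *\<^sub>C f = r *\<^sub>R f"
    by transfer (auto simp: l2_rel_def intro!: square_integrable_scale)
  have "inner (a *\<^sub>C f) (a *\<^sub>C f) = (cmod a)\<^sup>2 * inner f f"
    by transfer (simp add: dot_square_norm norm_mult power_mult_distrib)
  then show "norm (a *\<^sub>C f) = cmod a * norm f"
    by (simp add: norm_l2_def real_sqrt_mult)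
qed

end


subsection \<open>Weak derivatives and Sobolev spaces\<close>

definition test_function :: "(real \<Rightarrow> real) \<Rightarrow> bool" where
  "test_function \<phi> \<longleftrightarrow>
     (\<forall>k. (deriv ^^ k) \<phi> differentiable_on UNIV) \<and> compact (closure {x. \<phi> x \<noteq> 0})"

lemma measurable_test_function_deriv:
  assumes "test_function \<phi>"
  shows "(deriv ^^ k) \<phi> \<in> borel_measurable lborel"
  using assms borel_measurable_continuous_onI[OF differentiable_imp_continuous_on]
  by (auto simp: test_function_def)

text \<open>Real test functions suffice: the defining identity is linear in \<open>\<phi>\<close> over the complex numbers.\<close>

lift_definition has_weak_deriv :: "nat \<Rightarrow> l2 \<Rightarrow> l2 \<Rightarrow> bool" is
  "\<lambda>k u v. \<forall>\<phi>. test_function \<phi> \<longrightarrow>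
     (LINT x|lborel. u x * complex_of_real ((deriv ^^ k) \<phi> x)) =
     (- 1) ^ k * (LINT x|lborel. v x * complex_of_real (\<phi> x))"
proof -
  fix k and u u' v v' :: "real \<Rightarrow> complex"
  assume a: "l2_rel u u'" "l2_rel v v'"
  have *: "(LINT x|lborel. w x * complex_of_real ((deriv ^^ j) \<phi> x)) =
      (LINT x|lborel. w' x * complex_of_real ((deriv ^^ j) \<phi> x))"
    if "l2_rel w w'" "test_function \<phi>" for w w' j \<phi>
  proof (rule integral_cong_AE)
    have [measurable]: "w \<in> borel_measurable lborel" "w' \<in> borel_measurable lborel"
        "(deriv ^^ j) \<phi> \<in> borel_measurable lborel"
      using that measurable_test_function_deriv by (auto simp: l2_rel_def square_integrable_def)
    show "(\<lambda>x. w x * complex_of_real ((deriv ^^ j) \<phi> x)) \<in> borel_measurable lborel"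
      "(\<lambda>x. w' x * complex_of_real ((deriv ^^ j) \<phi> x)) \<in> borel_measurable lborel"
      by measurable
    show "AE x in lborel. w x * complex_of_real ((deriv ^^ j) \<phi> x) =
        w' x * complex_of_real ((deriv ^^ j) \<phi> x)"
      using that unfolding l2_rel_def by (auto elim!: AE_mp)
  qed
  show "(\<forall>\<phi>. test_function \<phi> \<longrightarrow>
      (LINT x|lborel. u x * complex_of_real ((deriv ^^ k) \<phi> x)) =
      (- 1) ^ k * (LINT x|lborel. v x * complex_of_real (\<phi> x))) =
    (\<forall>\<phi>. test_function \<phi> \<longrightarrow>
      (LINT x|lborel. u' x * complex_of_real ((deriv ^^ k) \<phi> x)) =
      (- 1) ^ k * (LINT x|lborel. v' x * complex_of_real (\<phi> x)))"
    using *[OF a(1), where j = k] *[OF a(2), where j = 0] by simp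
qed

definition sobolev :: "nat \<Rightarrow> l2 set" where
  "sobolev m = {u. \<forall>k\<le>m. \<exists>v. has_weak_deriv k u v}"

text \<open>Weak derivatives are unique by the fundamental lemma of the calculus of variations, so the
  description is well defined on \<open>sobolev k\<close>.\<close>

definition weak_deriv :: "nat \<Rightarrow> l2 \<Rightarrow> l2" where
  "weak_deriv k u = (THE v. has_weak_deriv k u v)"


subsection \<open>The operator\<close>

definition step_potential :: "complex \<Rightarrow> complex \<Rightarrow> real \<Rightarrow> complex" where
  "step_potential Vp Vm x = (if x \<ge> 0 then Vp else Vm)"

lift_definition mult_step_potential :: "complex \<Rightarrow> complex \<Rightarrow> l2 \<Rightarrow> l2" is
  "\<lambda>Vp Vm f x. step_potential Vp Vm x * f x"
proof -
  fix Vp Vm and f g :: "real \<Rightarrow> complex"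
  assume "l2_rel f g"
  moreover have [measurable]: "step_potential Vp Vm \<in> borel_measurable lborel"
    unfolding step_potential_def by measurable
  have "square_integrable (\<lambda>x. step_potential Vp Vm x * h x)" if "square_integrable h" for h
    using that
    by (rule square_integrable_mult_bounded[where B = "max (cmod Vp) (cmod Vm)"])
      (auto simp: step_potential_def)
  ultimately show "l2_rel (\<lambda>x. step_potential Vp Vm x * f x) (\<lambda>x. step_potential Vp Vm x * g x)"
    unfolding l2_rel_def by (auto elim!: AE_mp)
qed

definition schroedinger_step :: "complex \<Rightarrow> complex \<Rightarrow> l2 operator" where
  "schroedinger_step Vp Vm = (sobolev 2, \<lambda>u. - weak_deriv 2 u + mult_step_potential Vp Vm u)"

end

theory Submission
  imports Defs "HOL-Computational_Algebra.Polynomial"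
begin

text \<open>The spectrum of \<open>L\<close> is the union of the two half-lines \<open>V + [0, \<infinity>)\<close>, for \<open>V = Vp\<close> and \<open>V = Vm\<close>
(\<open>spectrum_schroedinger_step\<close>). A point of such a half-line is an approximate eigenvalue: a weakly
damped plane wave on one side of the origin, continued by a short profile on the other side, is
almost an eigenvector. Testing the resolvent on these waves gives
\<open>\<parallel>(L - z)\<^sup>-\<^sup>1\<parallel> \<ge> 1 / dist(z, \<sigma>(L))\<close> (\<open>onorm_resolvent_ge_inverse_distance\<close>), so the pseudospectrum
always contains the neighbourhood of the spectrum. Off the half-lines, \<open>V - z\<close> has a square root
with positive real part for either value of the potential; the resolvent is then constructed by
solving the two constant-coefficient equations and matching the solutions at the origin with
decaying exponentials (\<open>schroedinger_solution_exists\<close>). Injectivity comes for free from solvability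
and the bilinear symmetry of the operator.

If the imaginary parts of \<open>Vp\<close> and \<open>Vm\<close> agree, the spectrum is one half-line, and it contains the
numerical range. The numerical range estimate (\<open>numerical_range_bound\<close>) then yields the opposite
inequality \<open>\<parallel>(L - z)\<^sup>-\<^sup>1\<parallel> \<le> 1 / dist(z, \<sigma>(L))\<close>, and the pseudospectrum is exactly the neighbourhood.

If they differ, take \<open>z\<close> in the strip between the half-lines and let \<open>kp\<close> and \<open>km\<close> be the roots with
positive real part of \<open>Vp - z\<close> and \<open>Vm - z\<close>. Their imaginary parts have opposite signs, so
\<open>kp + km = (Vp - Vm) / (kp - km)\<close> is of order \<open>1 / sqrt (Re z)\<close>, and \<open>1 / (kp + km)\<close> is the factor
in front of the rank-one part of the resolvent kernel, built on the exponential \<open>\<phi>\<close> that decays with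
rates \<open>kp\<close> and \<open>km\<close>. Its squared norm is of order \<open>sqrt (Re z)\<close>. Evaluating the resolvent on \<open>cnj \<phi>\<close>
(\<open>onorm_resolvent_ge_rank_one\<close>) shows that its norm grows linearly in \<open>Re z\<close>, with an explicit
constant and an error that is controlled uniformly over the strip (\<open>strip_resolvent_lower_bound\<close>).
Along the middle of the strip the distance to the spectrum stays fixed, so the pseudospectrum is not
trivial.

Underneath lies a description of the Sobolev space by functions: an element of it has a
representative \<open>U\<close> that is absolutely continuous together with its derivative
(\<open>sobolev_imp_h2_representative\<close>). This rests on the fundamental lemma of the calculus of
variations, for which enough test functions are built from \<open>exp (- 1 / x)\<close>. Integration by parts
between square-integrable functions is an instance of the fact that an integrable, locally
absolutely continuous function with integrable derivative has a derivative of integral zero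
(\<open>integral_ac_deriv_eq_0\<close>).\<close>

section \<open>Locally absolutely continuous functions\<close>

text \<open>The function \<open>F\<close> is locally absolutely continuous and \<open>f\<close> is its derivative almost everywhere. The
condition is expressed through increments because this is the form in which weak derivatives produce
such functions and in which integration by parts consumes them.\<close>

definition ac_deriv :: "(real \<Rightarrow> complex) \<Rightarrow> (real \<Rightarrow> complex) \<Rightarrow> bool" where
  "ac_deriv F f \<longleftrightarrow> f \<in> borel_measurable borel \<and>
     (\<forall>a b. a \<le> b \<longrightarrow> set_integrable lborel {a..b} f \<and> F b - F a = (LINT x:{a..b}|lborel. f x))"

lemma ac_deriv_measurable: "ac_deriv F f \<Longrightarrow> f \<in> borel_measurable borel"
  by (simp add: ac_deriv_def)

lemma ac_deriv_set_integrable: "ac_deriv F f \<Longrightarrow> set_integrable lborel {a..b} f"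
  by (cases "a \<le> b") (auto simp: ac_deriv_def set_integrable_def)

lemma ac_deriv_has_integral:
  assumes "ac_deriv F f" "a \<le> b"
  shows "(f has_integral (F b - F a)) {a..b}"
  using assms set_borel_integral_eq_integral[OF ac_deriv_set_integrable[OF assms(1)], of a b]
  by (metis ac_deriv_def integrable_integral)

lemma ac_derivI:
  assumes "f \<in> borel_measurable borel" "\<And>a b. a \<le> b \<Longrightarrow> set_integrable lborel {a..b} f"
    "\<And>a b. a \<le> b \<Longrightarrow> (f has_integral (F b - F a)) {a..b}"
  shows "ac_deriv F f"
  unfolding ac_deriv_def
  using assms set_borel_integral_eq_integral(2)[OF assms(2)] by (metis integral_unique)

lemma ac_deriv_add:
  assumes "ac_deriv F f" "ac_deriv G g"
  shows "ac_deriv (\<lambda>x. F x + G x) (\<lambda>x. f x + g x)"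
  using assms unfolding ac_deriv_def
  by (auto simp: set_integral_add algebra_simps)

lemma ac_deriv_cmult:
  assumes "ac_deriv F f"
  shows "ac_deriv (\<lambda>x. c * F x) (\<lambda>x. c * f x)"
  using assms unfolding ac_deriv_def
  by (auto simp: right_diff_distrib[symmetric])

lemma ac_deriv_diff:
  assumes "ac_deriv F f" "ac_deriv G g"
  shows "ac_deriv (\<lambda>x. F x - G x) (\<lambda>x. f x - g x)"
  using ac_deriv_add[OF assms(1) ac_deriv_cmult[OF assms(2), of "-1"]] by simp

lemma ac_deriv_cnj:
  assumes "ac_deriv F f"
  shows "ac_deriv (\<lambda>x. cnj (F x)) (\<lambda>x. cnj (f x))"
proof -
  have m[measurable]: "f \<in> borel_measurable borel" using assms by (simp add: ac_deriv_def)
  have "set_integrable lborel {a..b} (\<lambda>x. cnj (f x))" for a b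
    using ac_deriv_set_integrable[OF assms, of a b] unfolding set_integrable_def
    by (subst (asm) complex_integrable_cnj[symmetric]) simp
  moreover have "cnj (F b) - cnj (F a) = (LINT x:{a..b}|lborel. cnj (f x))" if "a \<le> b" for a b
  proof -
    have "cnj (F b) - cnj (F a) = cnj (LINT x:{a..b}|lborel. f x)"
      using assms that unfolding ac_deriv_def by (auto simp flip: complex_cnj_diff)
    also have "\<dots> = (LINT x:{a..b}|lborel. cnj (f x))"
      unfolding set_lebesgue_integral_def
      using Bochner_Integration.integral_cnj[of lborel "\<lambda>x. indicator {a..b} x *\<^sub>R f x"] by simp
    finally show ?thesis .
  qed
  moreover have "(\<lambda>x. cnj (f x)) \<in> borel_measurable borel"
    by (intro borel_measurable_continuous_on[OF _ m] continuous_intros)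
  ultimately show ?thesis unfolding ac_deriv_def by blast
qed

lemma ac_deriv_cong_AE:
  assumes "ac_deriv F f" "AE x in lborel. f x = g x" and g: "g \<in> borel_measurable borel"
  shows "ac_deriv F g"
proof -
  have f: "f \<in> borel_measurable borel" using assms by (simp add: ac_deriv_def)
  have ae: "AE x\<in>{a..b} in lborel. f x = g x" for a b
    using assms(2) by eventually_elim simp
  have "set_integrable lborel {a..b} f \<longleftrightarrow> set_integrable lborel {a..b} g" for a b
    by (rule set_integrable_cong_AE[OF _ _ ae]) (simp_all add: f g)
  moreover have "(LINT x:{a..b}|lborel. f x) = (LINT x:{a..b}|lborel. g x)" for a b
    by (rule set_lebesgue_integral_cong_AE[OF _ _ _ ae]) (simp_all add: f g)
  ultimately show ?thesis using assms(1,3) unfolding ac_deriv_def by metis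
qed

lemma ac_deriv_continuous:
  assumes "ac_deriv F f"
  shows "continuous_on UNIV F"
proof -
  have "isCont F x" for x
  proof -
    have h: "F y = F (x - 1) + integral {x-1..y} f" if "y \<in> {x-1..x+1}" for y
      using integral_unique[OF ac_deriv_has_integral[OF assms, of "x - 1" y]] that by simp
    have "f integrable_on {x-1..x+1}"
      using ac_deriv_has_integral[OF assms, of "x-1" "x+1"] by auto
    then have "continuous_on {x-1..x+1} (\<lambda>y. F (x - 1) + integral {x-1..y} f)"
      by (intro continuous_intros indefinite_integral_continuous_1)
    then have "continuous_on {x-1..x+1} F"
      by (rule continuous_on_eq) (rule h[symmetric])
    moreover have "x \<in> interior {x-1..x+1}" by simp
    ultimately show ?thesis
      by (rule continuous_on_interior)
  qed
  then show ?thesis by (simp add: continuous_on_eq_continuous_at)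
qed

lemma ac_deriv_measurable_primitive: "ac_deriv F f \<Longrightarrow> F \<in> borel_measurable borel"
  using ac_deriv_continuous borel_measurable_continuous_onI by blast

lemma ac_deriv_C1:
  assumes "\<And>x. (F has_vector_derivative f x) (at x)" "continuous_on UNIV f"
  shows "ac_deriv F f"
proof (rule ac_derivI)
  show "f \<in> borel_measurable borel" using assms(2) by (rule borel_measurable_continuous_onI)
  fix a b :: real assume ab: "a \<le> b"
  show "set_integrable lborel {a..b} f"
    by (rule borel_integrable_atLeastAtMost') (use assms(2) continuous_on_subset in blast)
  show "(f has_integral (F b - F a)) {a..b}"
    by (rule fundamental_theorem_of_calculus[OF ab]) (use assms(1) has_vector_derivative_at_within in blast)
qed

lemma ac_deriv_exp: "ac_deriv (\<lambda>x. exp (c * complex_of_real x)) (\<lambda>x. c * exp (c * complex_of_real x))"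
proof (rule ac_deriv_C1)
  show "((\<lambda>x. exp (c * complex_of_real x)) has_vector_derivative c * exp (c * complex_of_real x)) (at x)" for x
  proof -
    have "((\<lambda>z. exp (c * z)) has_field_derivative c * exp (c * complex_of_real x)) (at (complex_of_real x))"
      by (auto intro!: derivative_eq_intros)
    then show ?thesis
      using has_vector_derivative_real_field by blast
  qed
qed (intro continuous_intros)

text \<open>A corner at the origin costs nothing: an increment across \<open>0\<close> splits into one on each side, and the
values there agree. The potential jumps at \<open>0\<close>, so every state built by hand is glued this way.\<close>

lemma ac_deriv_glue:
  assumes F: "ac_deriv F f" and G: "ac_deriv G g" and eq: "F 0 = G 0"
  shows "ac_deriv (\<lambda>x. if x \<ge> 0 then F x else G x) (\<lambda>x. if x \<ge> 0 then f x else g x)"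
proof -
  define H where "H = (\<lambda>x. if x \<ge> 0 then F x else G x)"
  define h where "h = (\<lambda>x. if x \<ge> 0 then f x else g x)"
  have [measurable]: "f \<in> borel_measurable borel" "g \<in> borel_measurable borel"
    using F G by (auto simp: ac_deriv_def)
  have pos: "(h has_integral H d - H c) {c..d}" if "0 \<le> c" "c \<le> d" for c d
  proof (rule has_integral_eq)
    show "(f has_integral H d - H c) {c..d}"
      using ac_deriv_has_integral[OF F \<open>c \<le> d\<close>] that by (simp add: H_def)
    show "f x = h x" if "x \<in> {c..d}" for x
      using that \<open>0 \<le> c\<close> by (simp add: h_def)
  qed
  have neg: "(h has_integral H d - H c) {c..d}" if "d \<le> 0" "c \<le> d" for c d
  proof (rule has_integral_spike_finite[of "{0}"])
    have "H x = G x" if "x \<le> 0" for x using that eq by (cases "x = 0") (auto simp: H_def)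
    then show "(g has_integral H d - H c) {c..d}"
      using ac_deriv_has_integral[OF G \<open>c \<le> d\<close>] that by simp
    show "h x = g x" if "x \<in> {c..d} - {0}" for x
      using that \<open>d \<le> 0\<close> by (simp add: h_def)
  qed simp
  have "ac_deriv H h"
  proof (rule ac_derivI)
    show hm: "h \<in> borel_measurable borel" unfolding h_def by measurable
    fix a b :: real assume ab: "a \<le> b"
    have "integrable lborel (\<lambda>x. cmod (indicator {a..b} x *\<^sub>R f x) + cmod (indicator {a..b} x *\<^sub>R g x))"
      using ac_deriv_set_integrable[OF F, of a b] ac_deriv_set_integrable[OF G, of a b]
      unfolding set_integrable_def by (intro Bochner_Integration.integrable_add integrable_norm)
    then show "set_integrable lborel {a..b} h"
      unfolding set_integrable_def
    proof (rule Bochner_Integration.integrable_bound)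
      show "(\<lambda>x. indicat_real {a..b} x *\<^sub>R h x) \<in> borel_measurable lborel"
        using hm by simp
    qed (auto intro!: AE_I2 simp: indicator_def h_def)
    consider "0 \<le> a" | "b \<le> 0" | "a \<le> 0" "0 \<le> b" by linarith
    then show "(h has_integral H b - H a) {a..b}"
    proof cases
      case 1 then show ?thesis using ab by (rule pos)
    next
      case 2 then show ?thesis using ab by (rule neg)
    next
      case 3
      have "(h has_integral (H 0 - H a) + (H b - H 0)) {a..b}"
        by (rule has_integral_combine[OF 3 neg[OF _ 3(1)] pos[OF _ 3(2)]]) simp_all
      then show ?thesis by simp
    qed
  qed
  then show ?thesis unfolding H_def h_def .
qed

lemma ac_deriv_reflect:
  assumes F: "ac_deriv F f"
  shows "ac_deriv (\<lambda>x. F (- x)) (\<lambda>x. - f (- x))"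
proof (rule ac_derivI)
  have [measurable]: "f \<in> borel_measurable borel" using F by (auto simp: ac_deriv_def)
  show "(\<lambda>x. - f (- x)) \<in> borel_measurable borel" by measurable
  fix a b :: real assume ab: "a \<le> b"
  have "integrable lborel (\<lambda>x. indicat_real {-b..-a} x *\<^sub>R f x)"
    using ac_deriv_set_integrable[OF F, of "-b" "-a"] unfolding set_integrable_def .
  from lborel_integrable_real_affine[OF this, of "-1" 0]
  have "integrable lborel (\<lambda>x. - (indicat_real {-b..-a} (- x) *\<^sub>R f (- x)))"
    by simp
  moreover have "(\<lambda>x. - (indicat_real {-b..-a} (- x) *\<^sub>R f (- x))) = (\<lambda>x. indicat_real {a..b} x *\<^sub>R (- f (- x)))"
    by (rule ext) (auto simp: indicator_def)
  ultimately show "set_integrable lborel {a..b} (\<lambda>x. - f (- x))"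
    unfolding set_integrable_def by (simp only:)
  have "((\<lambda>x. f (- x)) has_integral (F (- a) - F (- b))) {- (- a)..- (- b)}"
    by (rule has_integral_reflect_lemma_real[OF ac_deriv_has_integral[OF F]]) (use ab in simp)
  from has_integral_neg[OF this]
  show "((\<lambda>x. - f (- x)) has_integral (F (- b) - F (- a))) {a..b}"
    by (simp only: minus_minus minus_diff_eq)
qed

text \<open>The product rule, by Fubini. Writing both factors as integrals of their derivatives, the two terms
on the right become the integrals of \<open>f y * g x\<close> over the two triangles into which the diagonal cuts
the square, and together they give the product of the increments.\<close>

lemma ac_deriv_mult:
  assumes F: "ac_deriv F f" and G: "ac_deriv G g"
  shows "ac_deriv (\<lambda>x. F x * G x) (\<lambda>x. f x * G x + F x * g x)"
proof -
  have [measurable]: "f \<in> borel_measurable borel" "g \<in> borel_measurable borel"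
    "F \<in> borel_measurable borel" "G \<in> borel_measurable borel"
    using F G by (blast intro: ac_deriv_measurable ac_deriv_measurable_primitive)+
  \<comment> \<open>On bounded intervals the primitives are bounded, so the products below are integrable there.\<close>
  have bd: "\<exists>B. \<forall>x\<in>{a..b}. cmod (H x) \<le> B" if "ac_deriv H h" for H h a b
  proof -
    have "compact (H ` {a..b})"
      using ac_deriv_continuous[OF that] continuous_on_subset
      by (intro compact_continuous_image) auto
    then show ?thesis using compact_imp_bounded[of "H ` {a..b}"] by (auto simp: bounded_iff)
  qed
  have int: "set_integrable lborel {a..b} (\<lambda>x. H x * k x)"
    if H: "ac_deriv H h" and K: "ac_deriv K k" for H h K k a b
  proof -
    obtain B where B: "\<And>x. x \<in> {a..b} \<Longrightarrow> cmod (H x) \<le> B" using bd[OF H] by blast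
    have [measurable]: "H \<in> borel_measurable borel" "k \<in> borel_measurable borel"
      using H K by (blast intro: ac_deriv_measurable ac_deriv_measurable_primitive)+
    have "integrable lborel (\<lambda>x. B * cmod (indicator {a..b} x *\<^sub>R k x))"
      using integrable_norm[OF ac_deriv_set_integrable[OF K, of a b, unfolded set_integrable_def]]
      by (rule Bochner_Integration.integrable_mult_right)
    then show ?thesis unfolding set_integrable_def
    proof (rule Bochner_Integration.integrable_bound)
      have "norm (indicator {a..b} x *\<^sub>R (H x * k x)) \<le> norm (B * cmod (indicator {a..b} x *\<^sub>R k x))" for x
      proof (cases "x \<in> {a..b}")
        case True
        then have "cmod (H x) * cmod (k x) \<le> \<bar>B\<bar> * cmod (k x)"
          using B[OF True] by (intro mult_right_mono) auto
        then show ?thesis using True by (simp add: norm_mult abs_mult)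
      qed simp
      then show "AE x in lborel. norm (indicator {a..b} x *\<^sub>R (H x * k x)) \<le> norm (B * cmod (indicator {a..b} x *\<^sub>R k x))"
        by simp
    qed measurable
  qed
  have main: "F b * G b - F a * G a = (LINT x:{a..b}|lborel. f x * G x + F x * g x)" if ab: "a \<le> b" for a b
  proof -
    define f' where "f' = (\<lambda>x. indicator {a..b} x *\<^sub>R f x)"
    define g' where "g' = (\<lambda>x. indicator {a..b} x *\<^sub>R g x)"
    have i: "integrable lborel f'" "integrable lborel g'"
      using ac_deriv_set_integrable[OF F, of a b] ac_deriv_set_integrable[OF G, of a b]
      unfolding set_integrable_def f'_def g'_def by auto
    have [measurable]: "f' \<in> borel_measurable borel" "g' \<in> borel_measurable borel"
      unfolding f'_def g'_def by measurable
    \<comment> \<open>Parts of the increment of \<open>F\<close> up to and beyond \<open>x\<close>; that of \<open>G\<close> before \<open>y\<close>. The strict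
      inequality differs from the weak one on a null set only.\<close>
    define If where "If x = (LINT y|lborel. (if y \<le> x then f' y else 0))" for x
    define Jf where "Jf x = (LINT y|lborel. (if x < y then f' y else 0))" for x
    define Ig where "Ig y = (LINT x|lborel. (if x < y then g' x else 0))" for y
    have Feq: "F x = F a + If x" if "x \<in> {a..b}" for x
    proof -
      have "F x - F a = (LINT y|lborel. indicator {a..x} y *\<^sub>R f y)"
        using F that unfolding ac_deriv_def set_lebesgue_integral_def by auto
      also have "\<dots> = If x" unfolding If_def f'_def
        by (intro Bochner_Integration.integral_cong) (use that in \<open>auto simp: indicator_def\<close>)
      finally show ?thesis by (simp add: algebra_simps)
    qed
    have Geq: "G x = G a + Ig x" if "x \<in> {a..b}" for x
    proof -
      have "G x - G a = (LINT y|lborel. indicator {a..x} y *\<^sub>R g y)"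
        using G that unfolding ac_deriv_def set_lebesgue_integral_def by auto
      also have "\<dots> = Ig x" unfolding Ig_def g'_def
      proof (intro integral_cong_AE)
        show "AE y in lborel. indicator {a..x} y *\<^sub>R g y = (if y < x then indicator {a..b} y *\<^sub>R g y else 0)"
          using AE_lborel_singleton[of x] by eventually_elim (use that in \<open>auto simp: indicator_def\<close>)
      qed auto
      finally show ?thesis by (simp add: algebra_simps)
    qed
    have ifi: "integrable lborel (\<lambda>y. if y \<le> x then f' y else 0)" "integrable lborel (\<lambda>y. if x < y then f' y else 0)" for x
      by (rule Bochner_Integration.integrable_bound[OF i(1)]; auto)+
    have split: "If x + Jf x = F b - F a" for x
    proof -
      have "If x + Jf x = (LINT y|lborel. (if y \<le> x then f' y else 0) + (if x < y then f' y else 0))"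
        unfolding If_def Jf_def using ifi by simp
      also have "\<dots> = (LINT y|lborel. f' y)"
        by (intro Bochner_Integration.integral_cong) auto
      also have "\<dots> = F b - F a"
        using F ab unfolding ac_deriv_def set_lebesgue_integral_def f'_def by auto
      finally show ?thesis .
    qed
    have prodint: "integrable (lborel \<Otimes>\<^sub>M lborel) (\<lambda>(x, y). if x < y then f' y * g' x else 0)"
    proof (rule Bochner_Integration.integrable_bound)
      show "integrable (lborel \<Otimes>\<^sub>M lborel) (\<lambda>(x, y). f' y * g' x)"
      proof (rule lborel_pair.Fubini_integrable)
        show "integrable lborel (\<lambda>x. LINT y|lborel. norm (case (x, y) of (x, y) \<Rightarrow> f' y * g' x))"
          using i by (simp add: norm_mult)
        show "AE x in lborel. integrable lborel (\<lambda>y. case (x, y) of (x, y) \<Rightarrow> f' y * g' x)"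
          using i by simp
      qed measurable
      show "AE p in lborel \<Otimes>\<^sub>M lborel. norm (case p of (x, y) \<Rightarrow> (if x < y then f' y * g' x else 0))
          \<le> norm (case p of (x, y) \<Rightarrow> f' y * g' x)"
        by (rule AE_I2) (simp add: split_beta)
    qed measurable
    \<comment> \<open>Exchange of the order of integration over the triangle \<open>x < y\<close>.\<close>
    have "(LINT y|lborel. f' y * Ig y) = (LINT y|lborel. (LINT x|lborel. (if x < y then f' y * g' x else 0)))"
    proof (intro Bochner_Integration.integral_cong refl)
      fix y
      have "f' y * Ig y = (LINT x|lborel. f' y * (if x < y then g' x else 0))"
        unfolding Ig_def by simp
      also have "\<dots> = (LINT x|lborel. (if x < y then f' y * g' x else 0))"
        by (intro Bochner_Integration.integral_cong) auto
      finally show "f' y * Ig y = (LINT x|lborel. (if x < y then f' y * g' x else 0))" .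
    qed
    also have "\<dots> = (LINT x|lborel. (LINT y|lborel. (if x < y then f' y * g' x else 0)))"
      by (rule lborel_pair.Fubini_integral) (use prodint in simp)
    also have "\<dots> = (LINT x|lborel. Jf x * g' x)"
    proof (intro Bochner_Integration.integral_cong refl)
      fix x
      have "Jf x * g' x = (LINT y|lborel. (if x < y then f' y else 0) * g' x)"
        unfolding Jf_def by simp
      also have "\<dots> = (LINT y|lborel. (if x < y then f' y * g' x else 0))"
        by (intro Bochner_Integration.integral_cong) auto
      finally show "(LINT y|lborel. (if x < y then f' y * g' x else 0)) = Jf x * g' x" by simp
    qed
    finally have fub: "(LINT y|lborel. f' y * Ig y) = (LINT x|lborel. Jf x * g' x)" .
    have iG: "integrable lborel (\<lambda>x. f' x * G x)" "integrable lborel (\<lambda>x. F x * g' x)"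
      using int[OF F G, of a b] int[OF G F, of a b] unfolding f'_def g'_def set_integrable_def
      by (auto simp: mult.commute)
    have eqG: "f' x * G x = f' x * G a + f' x * Ig x" for x
      using Geq[of x] by (auto simp: f'_def indicator_def algebra_simps)
    have eqF: "F x * g' x = F b * g' x - Jf x * g' x" for x
    proof (cases "x \<in> {a..b}")
      case True
      have "F x = F b - Jf x" using Feq[OF True] split[of x] by (simp add: algebra_simps)
      then show ?thesis by (simp only: left_diff_distrib)
    qed (simp add: g'_def)
    have iI: "integrable lborel (\<lambda>x. f' x * Ig x)" "integrable lborel (\<lambda>x. Jf x * g' x)"
    proof -
      have "integrable lborel (\<lambda>x. f' x * G x - f' x * G a)"
        using iG i by auto
      then show "integrable lborel (\<lambda>x. f' x * Ig x)" by (simp add: eqG)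
      have "integrable lborel (\<lambda>x. F b * g' x - F x * g' x)"
        using iG i by auto
      then show "integrable lborel (\<lambda>x. Jf x * g' x)" by (simp add: eqF)
    qed
    have "(LINT x:{a..b}|lborel. f x * G x + F x * g x) = (LINT x|lborel. f' x * G x + F x * g' x)"
      unfolding set_lebesgue_integral_def f'_def g'_def
      by (intro Bochner_Integration.integral_cong) (auto simp: algebra_simps)
    also have "\<dots> = (LINT x|lborel. f' x * G x) + (LINT x|lborel. F x * g' x)"
      using iG by simp
    also have "\<dots> = (LINT x|lborel. f' x) * G a + (LINT x|lborel. f' x * Ig x)
        + (F b * (LINT x|lborel. g' x) - (LINT x|lborel. Jf x * g' x))"
      unfolding eqG eqF using i iI by simp
    also have "\<dots> = (F b - F a) * G a + F b * (G b - G a)"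
      using fub F G ab unfolding ac_deriv_def set_lebesgue_integral_def f'_def g'_def by auto
    finally show ?thesis by (simp add: algebra_simps)
  qed
  have "set_integrable lborel {a..b} (\<lambda>x. f x * G x + F x * g x)" for a b
    using set_integral_add(1)[OF int[OF G F, of a b] int[OF F G, of a b]] by (simp add: mult.commute)
  moreover have "(\<lambda>x. f x * G x + F x * g x) \<in> borel_measurable borel" by measurable
  ultimately show ?thesis
    using main unfolding ac_deriv_def by blast
qed

lemma ac_deriv_increment: "ac_deriv F f \<Longrightarrow> a \<le> b \<Longrightarrow> F b - F a = (LINT x:{a..b}|lborel. f x)"
  by (simp add: ac_deriv_def)

section \<open>Integration by parts for square-integrable functions\<close>

lemma square_integrable_measurable: "square_integrable f \<Longrightarrow> f \<in> borel_measurable borel"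
  by (simp add: square_integrable_def)

lemma square_integrable_cnj:
  assumes "square_integrable f"
  shows "square_integrable (\<lambda>x. cnj (f x))"
proof -
  have "(\<lambda>x. cnj (f x)) \<in> borel_measurable borel"
    by (intro borel_measurable_continuous_on[OF _ square_integrable_measurable[OF assms]] continuous_intros)
  then show ?thesis using assms by (simp add: square_integrable_def)
qed

lemma square_integrable_reflect:
  assumes "square_integrable f"
  shows "square_integrable (\<lambda>x. f (- x))"
proof -
  have [measurable]: "f \<in> borel_measurable borel" using assms by (rule square_integrable_measurable)
  have "integrable lborel (\<lambda>x. (cmod (f x))\<^sup>2)" using assms by (simp add: square_integrable_def)
  from lborel_integrable_real_affine[OF this, of "-1" 0]
  show ?thesis by (simp add: square_integrable_def)
qed

lemma square_integrable_if:
  assumes "square_integrable f" "square_integrable g"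
  shows "square_integrable (\<lambda>x. if x \<ge> (0::real) then f x else g x)"
proof -
  have [measurable]: "f \<in> borel_measurable borel" "g \<in> borel_measurable borel"
    using assms by (auto intro: square_integrable_measurable)
  have "integrable lborel (\<lambda>x. (cmod (f x))\<^sup>2 + (cmod (g x))\<^sup>2)"
    using assms by (auto simp: square_integrable_def)
  then have "integrable lborel (\<lambda>x. (cmod (if x \<ge> (0::real) then f x else g x))\<^sup>2)"
    by (rule Bochner_Integration.integrable_bound) (auto intro!: AE_I2)
  then show ?thesis by (simp add: square_integrable_def)
qed

lemma integrable_mult_l2:
  assumes "square_integrable f" "square_integrable g"
  shows "integrable lborel (\<lambda>x. f x * g x)"
proof -
  have [measurable]: "f \<in> borel_measurable borel" "g \<in> borel_measurable borel"
    using assms by (auto intro: square_integrable_measurable)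
  have "integrable lborel (\<lambda>x. (cmod (f x))\<^sup>2 + (cmod (g x))\<^sup>2)"
    using assms by (auto simp: square_integrable_def)
  then show ?thesis
  proof (rule Bochner_Integration.integrable_bound)
    have "norm (f x * g x) \<le> norm ((cmod (f x))\<^sup>2 + (cmod (g x))\<^sup>2)" for x
      using sum_squares_bound[of "cmod (f x)" "cmod (g x)"] mult_nonneg_nonneg[of "cmod (f x)" "cmod (g x)"]
      by (simp add: norm_mult del: mult_nonneg_nonneg)
    then show "AE x in lborel. norm (f x * g x) \<le> norm ((cmod (f x))\<^sup>2 + (cmod (g x))\<^sup>2)" by simp
  qed measurable
qed

text \<open>No boundary terms at infinity: the increments of \<open>G\<close> over \<open>{-b..b}\<close> tend to the integral of \<open>g\<close>, and
an integrable function cannot have \<open>G b - G (- b)\<close> tending to a nonzero limit.\<close>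

lemma integral_ac_deriv_eq_0:
  assumes ac: "ac_deriv G g" and G: "integrable lborel G" and g: "integrable lborel g"
  shows "(LINT x|lborel. g x) = 0"
proof (rule ccontr)
  define I where "I = (LINT x|lborel. g x)"
  assume "(LINT x|lborel. g x) \<noteq> 0"
  then have I: "cmod I > 0" by (simp add: I_def)
  have [measurable]: "g \<in> borel_measurable borel" "G \<in> borel_measurable borel"
    using ac by (blast intro: ac_deriv_measurable ac_deriv_measurable_primitive)+
  define h where "h b = G b - G (- b)" for b
  have "((\<lambda>b. LINT x|lborel. indicator {-b..b} x *\<^sub>R g x) \<longlongrightarrow> I) at_top"
    unfolding I_def
  proof (rule integral_dominated_convergence_at_top[where w = "\<lambda>x. cmod (g x)"])
    show "integrable lborel (\<lambda>x. cmod (g x))" using g by simp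
    show "AE x in lborel. ((\<lambda>b. indicator {-b..b} x *\<^sub>R g x) \<longlongrightarrow> g x) at_top"
    proof (rule AE_I2)
      fix x :: real
      have "\<forall>\<^sub>F b in at_top. indicator {-b..b} x *\<^sub>R g x = g x"
        using eventually_ge_at_top[of "\<bar>x\<bar>"] by eventually_elim (auto simp: indicator_def)
      then show "((\<lambda>b. indicator {-b..b} x *\<^sub>R g x) \<longlongrightarrow> g x) at_top"
        by (rule tendsto_eventually)
    qed
    show "\<forall>\<^sub>F b in at_top. AE x in lborel. norm (indicator {-b..b} x *\<^sub>R g x) \<le> cmod (g x)"
      by (intro always_eventually allI AE_I2) (simp add: indicator_def)
  qed measurable
  moreover have "\<forall>\<^sub>F b in at_top. (LINT x|lborel. indicator {-b..b} x *\<^sub>R g x) = h b"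
    using eventually_ge_at_top[of 0]
  proof eventually_elim
    fix b :: real assume "0 \<le> b"
    then have "- b \<le> b" by simp
    then show "(LINT x|lborel. indicator {-b..b} x *\<^sub>R g x) = h b"
      using ac_deriv_increment[OF ac, of "-b" b] by (simp add: h_def set_lebesgue_integral_def)
  qed
  ultimately have "(h \<longlongrightarrow> I) at_top" by (rule Lim_transform_eventually)
  then have "((\<lambda>b. cmod (h b)) \<longlongrightarrow> cmod I) at_top" by (rule tendsto_norm)
  then have "\<forall>\<^sub>F b in at_top. cmod I / 2 < cmod (h b)"
    using I by (auto dest!: order_tendstoD(1)[where a = "cmod I / 2"])
  then obtain B where B: "\<And>b. B \<le> b \<Longrightarrow> cmod I / 2 < cmod (h b)"
    by (auto simp: eventually_at_top_linorder)
  \<comment> \<open>The integrable function \<open>h\<close> would be bounded away from \<open>0\<close> on a set of infinite measure.\<close>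
  have "integrable lborel h"
    using G lborel_integrable_real_affine[OF G, of "-1" 0] unfolding h_def by simp
  then have "integrable lborel (\<lambda>b. (2 / cmod I) *\<^sub>R h b)" by simp
  then have "integrable lborel (\<lambda>b. indicat_real {B..} b)"
  proof (rule Bochner_Integration.integrable_bound)
    have "norm (indicat_real {B..} b) \<le> norm ((2 / cmod I) *\<^sub>R h b)" for b
      using B[of b] I by (auto simp: indicator_def field_simps)
    then show "AE b in lborel. norm (indicat_real {B..} b) \<le> norm ((2 / cmod I) *\<^sub>R h b)" by simp
  qed measurable
  then have "emeasure lborel {B..} < \<infinity>"
    using integrable_indicator_iff[of lborel "{B..}"] by (simp add: less_top[symmetric])
  then obtain r where r: "0 \<le> r" "emeasure lborel {B..} = ennreal r"
    by (cases "emeasure lborel {B..}") auto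
  have "emeasure lborel {B..B + (r + 1)} \<le> emeasure lborel {B..}"
    by (intro emeasure_mono) auto
  then show False using r by simp
qed

lemma integration_by_parts_l2:
  assumes "ac_deriv U u" "ac_deriv W w"
    and L: "square_integrable U" "square_integrable u" "square_integrable W" "square_integrable w"
  shows "(LINT x|lborel. u x * W x) = - (LINT x|lborel. U x * w x)"
proof -
  have "(LINT x|lborel. u x * W x + U x * w x) = 0"
    by (rule integral_ac_deriv_eq_0[OF ac_deriv_mult[OF assms(1,2)]])
      (intro Bochner_Integration.integrable_add integrable_mult_l2 L)+
  then show ?thesis
    using integrable_mult_l2[OF L(2,3)] integrable_mult_l2[OF L(1,4)]
    by (simp add: eq_neg_iff_add_eq_0)
qed

section \<open>Smooth bump functions\<close>

text \<open>For \<open>p = 1\<close> this is the classical smooth function that is flat at the origin. The polynomial factor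
in \<open>1 / x\<close> makes the family closed under differentiation, which handles all derivatives at once.\<close>

definition flat_exp :: "real poly \<Rightarrow> real \<Rightarrow> real" where
  "flat_exp p x = (if x > 0 then poly p (1 / x) * exp (- (1 / x)) else 0)"

lemma poly_times_exp_minus_tendsto_0: "((\<lambda>t. poly p t * exp (- t)) \<longlongrightarrow> (0::real)) at_top"
proof -
  have "((\<lambda>t. \<Sum>i\<le>degree p. coeff p i * (t ^ i / exp t)) \<longlongrightarrow> (\<Sum>i\<le>degree p. coeff p i * (0::real))) at_top"
    by (intro tendsto_sum tendsto_mult tendsto_const tendsto_power_div_exp_0)
  then show ?thesis
    by (simp add: poly_altdef exp_minus sum_distrib_right divide_inverse mult.assoc)
qed

lemma flat_exp_has_derivative:
  "(flat_exp p has_real_derivative flat_exp ([:0, 0, 1:] * (p - pderiv p)) x) (at x)"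
proof -
  consider "x > 0" | "x < 0" | "x = 0" by linarith
  then show ?thesis
  proof cases
    case 1
    have "((\<lambda>x. poly p (1 / x) * exp (- (1 / x))) has_real_derivative
        flat_exp ([:0, 0, 1:] * (p - pderiv p)) x) (at x)"
      using 1 unfolding flat_exp_def
      by (auto intro!: derivative_eq_intros DERIV_chain2[OF poly_DERIV]
          simp: field_simps power2_eq_square)
    then show ?thesis
      by (rule has_field_derivative_transform_within_open[where S = "{0<..}"])
        (use 1 in \<open>auto simp: flat_exp_def\<close>)
  next
    case 2
    have "((\<lambda>x. 0) has_real_derivative flat_exp ([:0, 0, 1:] * (p - pderiv p)) x) (at x)"
      using 2 by (simp add: flat_exp_def)
    then show ?thesis
      by (rule has_field_derivative_transform_within_open[where S = "{..<0}"])
        (use 2 in \<open>auto simp: flat_exp_def\<close>)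
  next
    case 3
    \<comment> \<open>At the origin the difference quotient becomes, with \<open>t = 1 / h\<close>, a polynomial in \<open>t\<close> times
      \<open>exp (- t)\<close>.\<close>
    have R: "((\<lambda>h. flat_exp p h / h) \<longlongrightarrow> 0) (at_right 0)"
    proof -
      have "((\<lambda>t. poly (pCons 0 p) t * exp (- t)) \<longlongrightarrow> 0) at_top"
        by (rule poly_times_exp_minus_tendsto_0)
      then have "((\<lambda>h. poly (pCons 0 p) (inverse h) * exp (- inverse h)) \<longlongrightarrow> 0) (at_right (0::real))"
        by (rule filterlim_compose[OF _ filterlim_inverse_at_top_right])
      moreover have "\<forall>\<^sub>F h in at_right 0. poly (pCons 0 p) (inverse h) * exp (- inverse h) = flat_exp p h / h"
        using eventually_at_right_less[of "0::real"]
        by eventually_elim (simp add: flat_exp_def divide_inverse mult.commute mult.left_commute)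
      ultimately show ?thesis by (rule Lim_transform_eventually)
    qed
    have "\<forall>\<^sub>F h in at_left 0. 0 = flat_exp p h / h"
      by (simp add: eventually_at_filter flat_exp_def)
    then have L: "((\<lambda>h. flat_exp p h / h) \<longlongrightarrow> 0) (at_left 0)"
      by (rule Lim_transform_eventually[OF tendsto_const])
    have "((\<lambda>h. flat_exp p h / h) \<longlongrightarrow> 0) (at 0)"
      using L R by (simp add: filterlim_at_split)
    then show ?thesis unfolding 3 DERIV_def by (simp add: flat_exp_def)
  qed
qed

text \<open>Every member of this algebra has a derivative in the algebra, so all its members are smooth, without
a formula for the higher derivatives of a product.\<close>

inductive_set bump_algebra :: "(real \<Rightarrow> real) set" where
  flat: "(\<lambda>x. flat_exp p (c * x + d)) \<in> bump_algebra"
| const: "(\<lambda>x. c) \<in> bump_algebra"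
| add: "f \<in> bump_algebra \<Longrightarrow> g \<in> bump_algebra \<Longrightarrow> (\<lambda>x. f x + g x) \<in> bump_algebra"
| mult: "f \<in> bump_algebra \<Longrightarrow> g \<in> bump_algebra \<Longrightarrow> (\<lambda>x. f x * g x) \<in> bump_algebra"

lemma bump_algebra_deriv:
  "f \<in> bump_algebra \<Longrightarrow> \<exists>g\<in>bump_algebra. \<forall>x. (f has_real_derivative g x) (at x)"
proof (induction rule: bump_algebra.induct)
  case (flat p c d)
  let ?q = "[:0, 0, 1:] * (p - pderiv p)"
  have "((\<lambda>x. flat_exp p (c * x + d)) has_real_derivative c * flat_exp ?q (c * x + d)) (at x)" for x
    by (rule DERIV_chain2[OF flat_exp_has_derivative, THEN DERIV_cong]) (auto intro!: derivative_eq_intros)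
  moreover have "(\<lambda>x. c * flat_exp ?q (c * x + d)) \<in> bump_algebra"
    by (intro bump_algebra.intros)
  ultimately show ?case by (intro bexI allI)
next
  case (const c)
  show ?case
    by (rule bexI[where x = "\<lambda>x. 0"]) (auto intro: bump_algebra.const)
next
  case (add f g)
  then obtain f' g' where "f' \<in> bump_algebra" "g' \<in> bump_algebra"
    "\<And>x. (f has_real_derivative f' x) (at x)" "\<And>x. (g has_real_derivative g' x) (at x)" by blast
  then show ?case
    by (intro bexI[where x = "\<lambda>x. f' x + g' x"] allI bump_algebra.add DERIV_add)
next
  case (mult f g)
  then obtain f' g' where d: "f' \<in> bump_algebra" "g' \<in> bump_algebra"
    "\<And>x. (f has_real_derivative f' x) (at x)" "\<And>x. (g has_real_derivative g' x) (at x)" by blast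
  have "(\<lambda>x. f' x * g x + g' x * f x) \<in> bump_algebra"
    using d mult by (intro bump_algebra.intros)
  then show ?case
    using d by (intro bexI[where x = "\<lambda>x. f' x * g x + g' x * f x"] allI DERIV_mult)
qed

lemma DERIV_imp_differentiable_on:
  fixes f :: "real \<Rightarrow> real"
  assumes "\<And>x. (f has_real_derivative f' x) (at x)"
  shows "f differentiable_on UNIV"
  using assms by (auto simp: differentiable_on_def real_differentiable_def)

definition smooth :: "(real \<Rightarrow> real) \<Rightarrow> bool" where
  "smooth f \<longleftrightarrow> (\<forall>k. (deriv ^^ k) f differentiable_on UNIV)"

lemma smooth_bump_algebra:
  assumes "f \<in> bump_algebra"
  shows "smooth f"
proof -
  have "(deriv ^^ k) f \<in> bump_algebra" for k
  proof (induction k)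
    case 0 then show ?case using assms by simp
  next
    case (Suc k)
    then obtain g where g: "g \<in> bump_algebra" "\<And>x. ((deriv ^^ k) f has_real_derivative g x) (at x)"
      using bump_algebra_deriv by blast
    have "deriv ((deriv ^^ k) f) = g"
      using g(2) by (intro ext DERIV_imp_deriv)
    then show ?case using g by simp
  qed
  then show ?thesis unfolding smooth_def
    using bump_algebra_deriv DERIV_imp_differentiable_on by metis
qed

lemma smooth_DERIV: "smooth f \<Longrightarrow> (f has_real_derivative deriv f x) (at x)"
  unfolding smooth_def DERIV_deriv_iff_real_differentiable
  by (drule spec[where x = 0]) (simp add: differentiable_on_def)

lemma smooth_deriv: "smooth f \<Longrightarrow> smooth (deriv f)"
proof -
  have "(deriv ^^ k) (deriv f) = (deriv ^^ Suc k) f" for k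
    by (simp add: funpow_Suc_right del: funpow.simps)
  then show "smooth f \<Longrightarrow> smooth (deriv f)" unfolding smooth_def by metis
qed

text \<open>Higher derivatives of \<open>F\<close> are derivatives of \<open>f\<close>, one order lower.\<close>

lemma smooth_antiderivative:
  assumes "\<And>x. (F has_real_derivative f x) (at x)" "smooth f"
  shows "smooth F"
  unfolding smooth_def
proof
  fix k
  have d: "deriv F = f" using assms(1) by (intro ext DERIV_imp_deriv)
  show "(deriv ^^ k) F differentiable_on UNIV"
  proof (cases k)
    case 0
    then show ?thesis using DERIV_imp_differentiable_on[OF assms(1)] by simp
  next
    case (Suc j)
    then show ?thesis using assms(2) d by (simp add: smooth_def funpow_Suc_right del: funpow.simps)
  qed
qed

lemma smooth_lincomb:
  assumes "smooth f" "smooth g"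
  shows "smooth (\<lambda>x. f x + c * g x)"
proof -
  have D: "((deriv ^^ k) h has_real_derivative (deriv ^^ Suc k) h x) (at x)" if "smooth h" for h k x
    using that DERIV_deriv_iff_real_differentiable by (auto simp: smooth_def differentiable_on_def)
  have 1: "(deriv ^^ k) (\<lambda>x. f x + c * g x) = (\<lambda>x. (deriv ^^ k) f x + c * (deriv ^^ k) g x)" for k
  proof (induction k)
    case (Suc k)
    have "((\<lambda>x. (deriv ^^ k) f x + c * (deriv ^^ k) g x) has_real_derivative
        (deriv ^^ Suc k) f x + c * (deriv ^^ Suc k) g x) (at x)" for x
      by (intro derivative_intros DERIV_cmult D assms)
    then show ?case using Suc by (auto intro!: ext DERIV_imp_deriv)
  qed simp
  show ?thesis unfolding smooth_def 1
    using assms unfolding smooth_def by (intro allI derivative_intros) auto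
qed

lemma test_function_smooth: "test_function \<phi> \<Longrightarrow> smooth \<phi>"
  by (simp add: test_function_def smooth_def)

lemma test_functionI:
  assumes "smooth \<phi>" "\<And>x. \<phi> x \<noteq> 0 \<Longrightarrow> \<bar>x\<bar> \<le> R"
  shows "test_function \<phi>"
proof -
  have "{x. \<phi> x \<noteq> 0} \<subseteq> {-R..R}" using assms(2) by (force simp: abs_le_iff)
  then have "bounded {x. \<phi> x \<noteq> 0}" using bounded_subset bounded_closed_interval by blast
  then show ?thesis using assms(1) by (simp add: test_function_def smooth_def)
qed

text \<open>The support condition in the form that is convenient on the line: vanishing outside a bounded
interval.\<close>

lemma test_function_support:
  assumes "test_function \<phi>"
  shows "\<exists>R>0. \<forall>x. \<bar>x\<bar> \<ge> R \<longrightarrow> \<phi> x = 0"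
proof -
  have "bounded (closure {x. \<phi> x \<noteq> 0})"
    using assms by (simp add: test_function_def compact_imp_bounded)
  then have "bounded {x. \<phi> x \<noteq> 0}"
    using bounded_subset closure_subset by blast
  then obtain B where B: "B > 0" "\<forall>x. \<phi> x \<noteq> 0 \<longrightarrow> \<bar>x\<bar> \<le> B"
    unfolding bounded_pos by auto
  show ?thesis
  proof (intro exI conjI allI impI)
    show "\<phi> x = 0" if "B + 1 \<le> \<bar>x\<bar>" for x using B(2) that by fastforce
  qed (use B in simp)
qed

lemma test_function_deriv:
  assumes "test_function \<phi>"
  shows "test_function (deriv \<phi>)"
proof -
  obtain R where R: "R > 0" "\<And>x. \<bar>x\<bar> \<ge> R \<Longrightarrow> \<phi> x = 0" using test_function_support[OF assms] by blast
  have vanish: "deriv \<phi> x = 0" if "\<bar>x\<bar> > R" for x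
  proof (rule DERIV_imp_deriv)
    have "open {x. \<bar>x\<bar> > R}" by (intro open_Collect_less continuous_intros)
    then show "(\<phi> has_real_derivative 0) (at x)"
      by (rule has_field_derivative_transform_within_open[OF DERIV_const[of 0]]) (use that R in simp_all)
  qed
  show ?thesis
  proof (rule test_functionI[where R = R])
    show "\<bar>x\<bar> \<le> R" if "deriv \<phi> x \<noteq> 0" for x
      using vanish[of x] that by linarith
  qed (rule smooth_deriv[OF test_function_smooth[OF assms]])
qed

lemma test_function_lincomb:
  assumes "test_function f" "test_function g"
  shows "test_function (\<lambda>x. f x + c * g x)"
proof -
  obtain R where R: "\<And>x. \<bar>x\<bar> \<ge> R \<Longrightarrow> f x = 0" using test_function_support[OF assms(1)] by blast
  obtain S where S: "\<And>x. \<bar>x\<bar> \<ge> S \<Longrightarrow> g x = 0" using test_function_support[OF assms(2)] by blast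
  show ?thesis
  proof (rule test_functionI[where R = "max R S"])
    show "\<bar>x\<bar> \<le> max R S" if "f x + c * g x \<noteq> 0" for x
      using R[of x] S[of x] that by fastforce
  qed (intro smooth_lincomb test_function_smooth assms)
qed

lemma test_function_continuous: "test_function \<phi> \<Longrightarrow> continuous_on UNIV \<phi>"
  by (intro continuous_at_imp_continuous_on ballI DERIV_isCont[OF smooth_DERIV[OF test_function_smooth]])

lemma test_function_square_integrable:
  assumes "test_function \<phi>"
  shows "square_integrable (\<lambda>x. complex_of_real (\<phi> x))"
proof -
  have c: "continuous_on UNIV \<phi>" by (rule test_function_continuous[OF assms])
  obtain R where R: "R > 0" "\<And>x. \<bar>x\<bar> \<ge> R \<Longrightarrow> \<phi> x = 0" using test_function_support[OF assms] by blast
  have [measurable]: "\<phi> \<in> borel_measurable borel" using c by (rule borel_measurable_continuous_onI)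
  have "set_integrable lborel {-R..R} (\<lambda>x. (\<phi> x)\<^sup>2)"
    by (rule borel_integrable_atLeastAtMost')
      (intro continuous_intros continuous_on_subset[OF c] subset_UNIV)
  moreover have "(\<lambda>x. indicator {-R..R} x *\<^sub>R (\<phi> x)\<^sup>2) = (\<lambda>x. (\<phi> x)\<^sup>2)"
  proof
    fix x show "indicator {-R..R} x *\<^sub>R (\<phi> x)\<^sup>2 = (\<phi> x)\<^sup>2"
    using R(2)[of x] by (cases "R \<le> \<bar>x\<bar>") (simp, auto simp: indicator_def abs_less_iff not_le)
  qed
  ultimately show ?thesis by (simp add: square_integrable_def set_integrable_def)
qed

lemma test_function_ac_deriv:
  assumes "test_function \<phi>"
  shows "ac_deriv (\<lambda>x. complex_of_real (\<phi> x)) (\<lambda>x. complex_of_real (deriv \<phi> x))"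
proof (rule ac_deriv_C1)
  show "((\<lambda>x. complex_of_real (\<phi> x)) has_vector_derivative complex_of_real (deriv \<phi> x)) (at x)" for x
    using smooth_DERIV[OF test_function_smooth[OF assms]]
    by (intro has_vector_derivative_of_real) (simp add: has_real_derivative_iff_has_vector_derivative)
  show "continuous_on UNIV (\<lambda>x. complex_of_real (deriv \<phi> x))"
    by (intro continuous_intros test_function_continuous test_function_deriv assms)
qed

text \<open>Supported in \<open>{a..b}\<close>, and steepening with \<open>n\<close>: the exponents are \<open>-1 / ((n + 1) * (x - a))\<close> and
\<open>-1 / ((n + 1) * (b - x))\<close>, so the bumps tend to the indicator of the open interval and are bounded
by \<open>1\<close>.\<close>

definition bump :: "real \<Rightarrow> real \<Rightarrow> nat \<Rightarrow> real \<Rightarrow> real" where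
  "bump a b n x = flat_exp 1 (real (Suc n) * (x - a)) * flat_exp 1 (real (Suc n) * (b - x))"

lemma flat_exp_1_bounds: "0 \<le> flat_exp 1 x" "flat_exp 1 x \<le> 1"
  by (auto simp: flat_exp_def)

lemma bump_bounds: "0 \<le> bump a b n x" "bump a b n x \<le> 1"
  unfolding bump_def by (simp_all add: flat_exp_1_bounds mult_le_one)

lemma bump_eq_0: "x \<notin> {a<..<b} \<Longrightarrow> bump a b n x = 0"
  unfolding bump_def flat_exp_def zero_less_mult_iff by auto

lemma test_function_bump: "test_function (bump a b n)"
proof (rule test_functionI)
  \<comment> \<open>Affine arguments written out, to match the generators of the algebra.\<close>
  have "(\<lambda>x. flat_exp 1 (real (Suc n) * x + - (real (Suc n) * a)) * flat_exp 1 (- real (Suc n) * x + real (Suc n) * b))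
      \<in> bump_algebra" by (intro bump_algebra.intros)
  also have "(\<lambda>x. flat_exp 1 (real (Suc n) * x + - (real (Suc n) * a)) * flat_exp 1 (- real (Suc n) * x + real (Suc n) * b))
      = bump a b n"
    by (rule ext) (simp add: bump_def algebra_simps)
  finally show "smooth (bump a b n)" by (rule smooth_bump_algebra)
  show "\<bar>x\<bar> \<le> max \<bar>a\<bar> \<bar>b\<bar>" if "bump a b n x \<noteq> 0" for x
  proof -
    have "x \<in> {a<..<b}" using bump_eq_0 that by blast
    then show ?thesis unfolding greaterThanLessThan_iff by linarith
  qed
qed

lemma bump_tendsto_indicator: "(\<lambda>n. bump a b n x) \<longlonglongrightarrow> indicator {a<..<b} x"
proof (cases "x \<in> {a<..<b}")
  case False then show ?thesis by (simp add: bump_eq_0)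
next
  case True
  have "(\<lambda>n. flat_exp 1 (real (Suc n) * y)) \<longlonglongrightarrow> 1" if "y > 0" for y
  proof -
    have "(\<lambda>n. inverse (real (Suc n))) \<longlonglongrightarrow> 0" by (rule LIMSEQ_inverse_real_of_nat)
    then have "(\<lambda>n. exp (- (inverse (real (Suc n)) * inverse y))) \<longlonglongrightarrow> exp (- (0 * inverse y))"
      by (intro tendsto_intros)
    moreover have "exp (- (inverse (real (Suc n)) * inverse y)) = flat_exp 1 (real (Suc n) * y)" for n
      using that by (simp add: flat_exp_def inverse_eq_divide)
    ultimately show ?thesis by simp
  qed
  from tendsto_mult[OF this this, of "x - a" "b - x"] True
  show ?thesis by (simp add: bump_def)
qed

section \<open>The fundamental lemma of the calculus of variations\<close>

text \<open>The sets on which the integral of \<open>g\<close> vanishes include the intersection-stable generator \<open>{a<..}\<close> of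
the Borel sets and are closed under complements and disjoint unions, so they are all the Borel sets.\<close>

lemma set_integral_zero_on_intervals_imp_AE_zero:
  fixes g :: "real \<Rightarrow> complex"
  assumes g: "integrable lborel g" and zero: "\<And>a. (LINT x:{a<..}|lborel. g x) = 0"
  shows "AE x in lborel. g x = 0"
proof (rule sigma_finite_measure.density_zero[OF sigma_finite_lborel g])
  have si: "set_integrable lborel A g" if "A \<in> sets borel" for A
    using integrable_mult_indicator[OF _ g, of A] that by (simp add: set_integrable_def)
  \<comment> \<open>Complements need the integral over the whole line, which is the limit over \<open>{- n<..}\<close>.\<close>
  have total: "(LINT x|lborel. g x) = 0"
  proof -
    have "(\<lambda>n::nat. LINT x:{- real n<..}|lborel. g x) \<longlonglongrightarrow> (LINT x:(\<Union>n::nat. {- real n<..})|lborel. g x)"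
    proof (rule set_integral_cont_up)
      show "incseq (\<lambda>n. {- real n<..})" by (auto simp: incseq_def)
    qed (auto intro!: si)
    moreover have "(\<Union>n::nat. {- real n<..}) = (UNIV :: real set)"
    proof -
      have "x \<in> (\<Union>n::nat. {- real n<..})" for x
      proof -
        obtain n where "- x < real n" using reals_Archimedean2 by blast
        then have "x \<in> {- real n<..}" by simp
        then show ?thesis by blast
      qed
      then show ?thesis by blast
    qed
    ultimately have "(\<lambda>n::nat. 0) \<longlonglongrightarrow> (LINT x|lborel. g x)"
      by (simp add: zero) (simp add: set_lebesgue_integral_def)
    then show ?thesis using LIMSEQ_unique tendsto_const by metis
  qed
  have borel_eq: "sets borel = sigma_sets UNIV (range (greaterThan :: real \<Rightarrow> _))"
    by (subst borel_Ioi) simp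
  fix A :: "real set" assume "A \<in> sets lborel"
  then have A: "A \<in> sigma_sets UNIV (range greaterThan)"
    by (simp add: borel_eq)
  have stable: "Int_stable (range (greaterThan :: real \<Rightarrow> _))"
  proof -
    have "{a<..} \<inter> {b<..} = {max a b<..}" for a b :: real by auto
    then show ?thesis by (simp add: Int_stable_def)
  qed
  show "(LINT x:A|lborel. g x) = 0"
  proof (rule sigma_sets_induct_disjoint[OF stable _ A])
    show "(LINT x:B|lborel. g x) = 0" if "B \<in> range greaterThan" for B
      using that zero by auto
    show "(LINT x:{}|lborel. g x) = 0" by (simp add: set_lebesgue_integral_def)
    show "(LINT x:UNIV - B|lborel. g x) = 0"
      if "B \<in> sigma_sets UNIV (range greaterThan)" and B0: "(LINT x:B|lborel. g x) = 0" for B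
    proof -
      have B: "B \<in> sets borel" using that(1) by (simp add: borel_eq)
      have "(LINT x:B \<union> (UNIV - B)|lborel. g x) = (LINT x:B|lborel. g x) + (LINT x:UNIV - B|lborel. g x)"
        by (rule set_integral_Un) (use B in \<open>auto intro!: si\<close>)
      then show ?thesis
        using B0 total by (simp add: set_lebesgue_integral_def)
    qed
    show "(LINT x:(\<Union>i. B i)|lborel. g x) = 0"
      if "disjoint_family B" "range B \<subseteq> sigma_sets UNIV (range greaterThan)"
        and B0: "\<And>i. (LINT x:B i|lborel. g x) = 0" for B :: "nat \<Rightarrow> real set"
    proof -
      have B: "B i \<in> sets borel" for i unfolding borel_eq using that(2) by blast
      have "(LINT x:(\<Union>i. B i)|lborel. g x) = (\<Sum>i. LINT x:B i|lborel. g x)"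
      proof (rule lebesgue_integral_countable_add)
        show "B i \<inter> B j = {}" if "i \<noteq> j" for i j
          using \<open>disjoint_family B\<close> that by (auto simp: disjoint_family_on_def)
      qed (use B in \<open>auto intro!: si\<close>)
      then show ?thesis using B0 by simp
    qed
  qed simp
qed

text \<open>Bumps converge to the indicator of the interval while staying bounded by it, so dominated
convergence carries the vanishing from test functions to intervals.\<close>

lemma set_integral_open_interval_eq_0:
  fixes g :: "real \<Rightarrow> complex"
  assumes [measurable]: "g \<in> borel_measurable borel"
    and loc: "\<And>a b. set_integrable lborel {a..b} g"
    and zero: "\<And>\<phi>. test_function \<phi> \<Longrightarrow> (LINT x|lborel. g x * complex_of_real (\<phi> x)) = 0"
  shows "(LINT x:{a<..<b}|lborel. g x) = 0"
proof -
  have [measurable]: "bump a b n \<in> borel_measurable borel" for n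
    by (intro borel_measurable_continuous_onI test_function_continuous test_function_bump)
  have "(\<lambda>n. LINT x|lborel. g x * complex_of_real (bump a b n x)) \<longlonglongrightarrow>
      (LINT x|lborel. indicator {a<..<b} x *\<^sub>R g x)"
  proof (rule integral_dominated_convergence)
    show "integrable lborel (\<lambda>x. cmod (indicator {a..b} x *\<^sub>R g x))"
      using loc[of a b] unfolding set_integrable_def by (rule integrable_norm)
    have "(\<lambda>n. g x * complex_of_real (bump a b n x)) \<longlonglongrightarrow> g x * complex_of_real (indicator {a<..<b} x)" for x
      by (intro tendsto_intros bump_tendsto_indicator)
    then show "AE x in lborel. (\<lambda>n. g x * complex_of_real (bump a b n x)) \<longlonglongrightarrow> indicator {a<..<b} x *\<^sub>R g x"
      by (simp add: scaleR_conv_of_real mult.commute)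
    fix n
    have "norm (g x * complex_of_real (bump a b n x)) \<le> cmod (indicator {a..b} x *\<^sub>R g x)" for x
    proof (cases "x \<in> {a<..<b}")
      case True
      then show ?thesis using bump_bounds[of a b n x] by (simp add: norm_mult mult_left_le)
    qed (simp add: bump_eq_0)
    then show "AE x in lborel. norm (g x * complex_of_real (bump a b n x)) \<le> cmod (indicator {a..b} x *\<^sub>R g x)"
      by simp
  qed measurable
  then have "(\<lambda>n. 0) \<longlonglongrightarrow> (LINT x:{a<..<b}|lborel. g x)"
    by (simp add: zero test_function_bump set_lebesgue_integral_def)
  then show ?thesis using LIMSEQ_unique tendsto_const by metis
qed

lemma fundamental_lemma_calculus_of_variations:
  fixes g :: "real \<Rightarrow> complex"
  assumes g[measurable]: "g \<in> borel_measurable borel"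
    and loc: "\<And>a b. set_integrable lborel {a..b} g"
    and zero: "\<And>\<phi>. test_function \<phi> \<Longrightarrow> (LINT x|lborel. g x * complex_of_real (\<phi> x)) = 0"
  shows "AE x in lborel. g x = 0"
proof -
  \<comment> \<open>Truncation makes \<open>g\<close> integrable; countably many truncations exhaust the line.\<close>
  have "AE x in lborel. indicator {- real n<..<real n} x *\<^sub>R g x = 0" for n :: nat
  proof (rule set_integral_zero_on_intervals_imp_AE_zero)
    have "set_integrable lborel {- real n<..<real n} g"
      by (rule set_integrable_subset[OF loc[of "- real n" "real n"]]) auto
    then show "integrable lborel (\<lambda>x. indicator {- real n<..<real n} x *\<^sub>R g x)"
      by (simp add: set_integrable_def)
    fix a :: real
    have "(\<lambda>x. indicat_real {a<..} x *\<^sub>R (indicat_real {- real n<..<real n} x *\<^sub>R g x)) =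
        (\<lambda>x. indicat_real {max a (- real n)<..<real n} x *\<^sub>R g x)"
      by (rule ext) (auto simp: indicator_def)
    then show "(LINT x:{a<..}|lborel. indicator {- real n<..<real n} x *\<^sub>R g x) = 0"
      using set_integral_open_interval_eq_0[OF g loc zero, of "max a (- real n)" "real n"]
      by (simp only: set_lebesgue_integral_def)
  qed
  then have "AE x in lborel. \<forall>n::nat. indicator {- real n<..<real n} x *\<^sub>R g x = 0"
    unfolding AE_all_countable by blast
  then show ?thesis
  proof eventually_elim
    fix x assume *: "\<forall>n::nat. indicator {- real n<..<real n} x *\<^sub>R g x = 0"
    obtain n :: nat where "\<bar>x\<bar> < real n" using reals_Archimedean2 by blast
    then show "g x = 0" using *[rule_format, of n] by (auto simp: abs_less_iff indicator_def split: if_splits)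
  qed
qed

text \<open>An antiderivative of \<open>\<psi>\<close> is constant on either side of the support; normalised to vanish on the
left, it vanishes on the right because the total integral is zero.\<close>

lemma test_function_antiderivative:
  assumes "test_function \<psi>" and zero: "(LINT x|lborel. complex_of_real (\<psi> x)) = 0"
  shows "\<exists>\<phi>. test_function \<phi> \<and> deriv \<phi> = \<psi>"
proof -
  have c: "continuous_on UNIV \<psi>" by (rule test_function_continuous[OF assms(1)])
  obtain R where R: "R > 0" "\<And>x. \<bar>x\<bar> \<ge> R \<Longrightarrow> \<psi> x = 0"
    using test_function_support[OF assms(1)] by blast
  have "\<exists>F. \<forall>x::real. - \<infinity> < ereal x \<longrightarrow> ereal x < \<infinity> \<longrightarrow> (F has_vector_derivative \<psi> x) (at x)"
    using c by (intro einterval_antiderivative) (auto simp: continuous_on_eq_continuous_at)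
  then obtain F where F: "\<And>x. (F has_real_derivative \<psi> x) (at x)"
    by (auto simp: has_real_derivative_iff_has_vector_derivative)
  define \<phi> where "\<phi> x = F x - F (- R)" for x
  have D: "(\<phi> has_real_derivative \<psi> x) (at x)" for x
    unfolding \<phi>_def using DERIV_diff[OF F DERIV_const] by simp
  have ac: "ac_deriv (\<lambda>x. complex_of_real (\<phi> x)) (\<lambda>x. complex_of_real (\<psi> x))"
  proof (rule ac_deriv_C1)
    show "((\<lambda>x. complex_of_real (\<phi> x)) has_vector_derivative complex_of_real (\<psi> x)) (at x)" for x
      using D by (intro has_vector_derivative_of_real) (simp add: has_real_derivative_iff_has_vector_derivative)
  qed (intro continuous_intros c)
  have out: "\<phi> b = \<phi> a" if "a \<le> b" "\<And>x. a \<le> x \<Longrightarrow> x \<le> b \<Longrightarrow> \<psi> x = 0" for a b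
  proof -
    have "complex_of_real (\<phi> b) - complex_of_real (\<phi> a) = (LINT x:{a..b}|lborel. complex_of_real (\<psi> x))"
      by (rule ac_deriv_increment[OF ac that(1)])
    also have "\<dots> = (LINT x:{a..b}|lborel. 0)"
      by (rule set_lebesgue_integral_cong) (use that in auto)
    finally show ?thesis by simp
  qed
  have m: "\<phi> (- R) = 0" by (simp add: \<phi>_def)
  have "complex_of_real (\<phi> R) - complex_of_real (\<phi> (- R)) = (LINT x:{-R..R}|lborel. complex_of_real (\<psi> x))"
    by (rule ac_deriv_increment[OF ac]) (use R in simp)
  also have "\<dots> = (LINT x|lborel. complex_of_real (\<psi> x))"
  proof -
    have "indicator {-R..R} x *\<^sub>R complex_of_real (\<psi> x) = complex_of_real (\<psi> x)" for x
      using R(2)[of x] by (cases "R \<le> \<bar>x\<bar>") (simp, auto simp: indicator_def)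
    then show ?thesis by (simp add: set_lebesgue_integral_def)
  qed
  finally have p: "\<phi> R = 0" using zero m by simp
  have "test_function \<phi>"
  proof (rule test_functionI)
    show "smooth \<phi>" by (rule smooth_antiderivative[OF D test_function_smooth[OF assms(1)]])
    show "\<bar>x\<bar> \<le> R" if "\<phi> x \<noteq> 0" for x
    proof (rule ccontr)
      assume "\<not> \<bar>x\<bar> \<le> R"
      then consider "x \<le> - R" | "R \<le> x" by linarith
      then have "\<phi> x = 0"
      proof cases
        case 1 then show ?thesis using out[of x "- R"] R m by simp
      next
        case 2 then show ?thesis using out[of R x] R p by simp
      qed
      then show False using that by simp
    qed
  qed
  moreover have "deriv \<phi> = \<psi>" using D by (intro ext DERIV_imp_deriv)
  ultimately show ?thesis by blast
qed

section \<open>Weak derivatives and absolute continuity\<close>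

lemma square_integrable_locally_integrable:
  assumes v: "square_integrable v"
  shows "set_integrable lborel {a..b} v"
proof -
  have "square_integrable (\<lambda>x. complex_of_real (indicator {a..b} x))"
    unfolding square_integrable_def
  proof
    have "(cmod (complex_of_real (indicator {a..b} x)))\<^sup>2 = indicator {a..b} x" for x
      by (simp add: indicator_def)
    then show "integrable lborel (\<lambda>x. (cmod (complex_of_real (indicator {a..b} x)))\<^sup>2)"
      by (simp add: integrable_indicator_iff emeasure_lborel_Icc_eq)
  qed measurable
  from integrable_mult_l2[OF this v] show ?thesis
    by (simp add: set_integrable_def scaleR_conv_of_real)
qed

lemma ac_deriv_square_integrable_primitive:
  assumes v: "square_integrable v"
  shows "\<exists>W. ac_deriv W v"
proof -
  define W where "W x = (if x \<ge> 0 then integral {0..x} v else - integral {x..0} v)" for x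
  have "(v has_integral W b - W a) {a..b}" if "a \<le> b" for a b
  proof -
    have I: "v integrable_on {c..d}" for c d
      by (rule set_borel_integral_eq_integral(1)[OF square_integrable_locally_integrable[OF v]])
    have comb: "integral {c..d} v + integral {d..e} v = integral {c..e} v" if "c \<le> d" "d \<le> e" for c d e
      by (rule Henstock_Kurzweil_Integration.integral_combine[OF that I])
    have "W b - W a = integral {a..b} v"
      using comb[of 0 a b] comb[of a 0 b] comb[of a b 0] that
      by (cases "0 \<le> a"; cases "0 \<le> b") (auto simp: W_def algebra_simps)
    then show ?thesis using integrable_integral[OF I] by simp
  qed
  then have "ac_deriv W v"
    by (intro ac_derivI square_integrable_locally_integrable square_integrable_measurable v)
  then show ?thesis by blast
qed

lemma test_function_ac_deriv_mult_integral:
  assumes g: "ac_deriv G g" and t: "test_function \<phi>"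
  shows "integrable lborel (\<lambda>x. g x * complex_of_real (\<phi> x) + G x * complex_of_real (deriv \<phi> x))"
    "(LINT x|lborel. g x * complex_of_real (\<phi> x) + G x * complex_of_real (deriv \<phi> x)) = 0"
proof -
  obtain R where R: "R > 0" "\<And>x. \<bar>x\<bar> \<ge> R \<Longrightarrow> \<phi> x = 0"
    using test_function_support[OF t] by blast
  obtain S where S: "S > 0" "\<And>x. \<bar>x\<bar> \<ge> S \<Longrightarrow> deriv \<phi> x = 0"
    using test_function_support[OF test_function_deriv[OF t]] by blast
  define T where "T = max R S"
  have T: "T > 0" "\<And>x. \<bar>x\<bar> \<ge> T \<Longrightarrow> \<phi> x = 0" "\<And>x. \<bar>x\<bar> \<ge> T \<Longrightarrow> deriv \<phi> x = 0"
    using R S by (auto simp: T_def)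
  define h where "h x = g x * complex_of_real (\<phi> x) + G x * complex_of_real (deriv \<phi> x)" for x
  have ac: "ac_deriv (\<lambda>x. G x * complex_of_real (\<phi> x)) h"
    unfolding h_def by (rule ac_deriv_mult[OF g test_function_ac_deriv[OF t]])
  have eq: "(\<lambda>x. indicator {-T..T} x *\<^sub>R h x) = h"
  proof
    fix x show "indicator {-T..T} x *\<^sub>R h x = h x"
      using T(2,3)[of x] by (cases "T \<le> \<bar>x\<bar>") (simp add: h_def, auto simp: indicator_def)
  qed
  have "integrable lborel h"
    using ac_deriv_set_integrable[OF ac, of "-T" T] by (simp only: set_integrable_def eq)
  then show "integrable lborel (\<lambda>x. g x * complex_of_real (\<phi> x) + G x * complex_of_real (deriv \<phi> x))"
    unfolding h_def[abs_def] .
  have "(LINT x|lborel. h x) = 0"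
    using ac_deriv_increment[OF ac, of "-T" T] T by (simp add: set_lebesgue_integral_def eq)
  then show "(LINT x|lborel. g x * complex_of_real (\<phi> x) + G x * complex_of_real (deriv \<phi> x)) = 0"
    unfolding h_def[abs_def] .
qed

lemma integrable_mult_test_function:
  fixes g :: "real \<Rightarrow> complex"
  assumes [measurable]: "g \<in> borel_measurable borel"
    and loc: "\<And>a b. set_integrable lborel {a..b} g" and t: "test_function \<phi>"
  shows "integrable lborel (\<lambda>x. g x * complex_of_real (\<phi> x))"
proof -
  obtain R where R: "R > 0" "\<And>x. \<bar>x\<bar> \<ge> R \<Longrightarrow> \<phi> x = 0"
    using test_function_support[OF t] by blast
  have c: "continuous_on UNIV \<phi>" by (rule test_function_continuous[OF t])
  then have [measurable]: "\<phi> \<in> borel_measurable borel" by (rule borel_measurable_continuous_onI)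
  have "compact (\<phi> ` {-R..R})"
    by (intro compact_continuous_image continuous_on_subset[OF c]) auto
  then have "bounded (\<phi> ` {-R..R})" by (rule compact_imp_bounded)
  then obtain B where B: "\<forall>x\<in>{-R..R}. \<bar>\<phi> x\<bar> \<le> B"
    by (auto simp: bounded_iff)
  have "integrable lborel (\<lambda>x. B *\<^sub>R (indicator {-R..R} x *\<^sub>R g x))"
    using loc[of "-R" R] unfolding set_integrable_def by (rule integrable_scaleR_right)
  then show ?thesis
  proof (rule Bochner_Integration.integrable_bound)
    have "norm (g x * complex_of_real (\<phi> x)) \<le> norm (B *\<^sub>R (indicat_real {-R..R} x *\<^sub>R g x))" for x
    proof (cases "R \<le> \<bar>x\<bar>")
      case False
      then have x: "x \<in> {-R..R}" by auto
      then have "\<bar>\<phi> x\<bar> * cmod (g x) \<le> \<bar>B\<bar> * cmod (g x)"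
        using B[rule_format, OF x] by (intro mult_right_mono) auto
      then show ?thesis using x by (simp add: norm_mult mult.commute)
    qed (simp add: R)
    then show "AE x in lborel. norm (g x * complex_of_real (\<phi> x)) \<le> norm (B *\<^sub>R (indicat_real {-R..R} x *\<^sub>R g x))"
      by simp
  qed measurable
qed

text \<open>The hypothesis kills all test functions that are derivatives, that is, those of mean zero. Fixing
one test function \<open>\<psi>\<close> of nonzero mean and subtracting a multiple of it from an arbitrary one shows
that \<open>g\<close> acts on test functions as integration against a constant.\<close>

lemma weak_derivative_zero_imp_constant:
  fixes g :: "real \<Rightarrow> complex"
  assumes g[measurable]: "g \<in> borel_measurable borel"
    and loc: "\<And>a b. set_integrable lborel {a..b} g"
    and zero: "\<And>\<phi>. test_function \<phi> \<Longrightarrow> (LINT x|lborel. g x * complex_of_real (deriv \<phi> x)) = 0"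
  shows "\<exists>c. AE x in lborel. g x = c"
proof -
  have const_loc: "set_integrable lborel {a..b} (\<lambda>x. c)" for a b :: real and c :: complex
    by (rule borel_integrable_atLeastAtMost') (intro continuous_intros)
  \<comment> \<open>If all test functions had mean zero, the constant \<open>1\<close> would vanish almost everywhere.\<close>
  have "\<exists>\<psi>. test_function \<psi> \<and> (LINT x|lborel. complex_of_real (\<psi> x)) \<noteq> 0"
  proof (rule ccontr)
    assume "\<not> ?thesis"
    then have "AE x::real in lborel. (1 :: complex) = 0"
      by (intro fundamental_lemma_calculus_of_variations[of "\<lambda>x. 1"] const_loc) auto
    then have "emeasure lborel (UNIV :: real set) = 0" by (simp add: AE_iff_measurable[OF _ refl])
    then show False by simp
  qed
  then obtain \<psi> where \<psi>: "test_function \<psi>" and nz: "(LINT x|lborel. complex_of_real (\<psi> x)) \<noteq> 0"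
    by blast
  define J where "J = (LINT x|lborel. \<psi> x)"
  have J: "(LINT x|lborel. complex_of_real (\<psi> x)) = complex_of_real J" by (simp add: J_def)
  with nz have Jnz: "J \<noteq> 0" by auto
  define c where "c = (LINT x|lborel. g x * complex_of_real (\<psi> x)) / complex_of_real J"
  have i1: "integrable lborel (\<lambda>x. complex_of_real (\<phi> x))" if "test_function \<phi>" for \<phi>
    using integrable_mult_test_function[OF _ const_loc that, of 1] by simp
  have ig: "integrable lborel (\<lambda>x. g x * complex_of_real (\<phi> x))" if "test_function \<phi>" for \<phi>
    by (rule integrable_mult_test_function[OF g loc that])
  have "AE x in lborel. g x - c = 0"
  proof (rule fundamental_lemma_calculus_of_variations)
    show "set_integrable lborel {a..b} (\<lambda>x. g x - c)" for a b
      using loc const_loc by (rule set_integral_diff)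
    fix \<phi> assume t: "test_function \<phi>"
    \<comment> \<open>The coefficient that gives \<open>\<phi> - m \<psi>\<close> mean zero.\<close>
    define m where "m = (LINT x|lborel. \<phi> x) / J"
    have t2: "test_function (\<lambda>x. \<phi> x + (- m) * \<psi> x)"
      by (rule test_function_lincomb[OF t \<psi>])
    have split: "complex_of_real (\<phi> x + (- m) * \<psi> x) = complex_of_real (\<phi> x) - complex_of_real m * complex_of_real (\<psi> x)" for x
      by simp
    have "(LINT x|lborel. complex_of_real (\<phi> x + (- m) * \<psi> x)) = 0"
      unfolding split using i1[OF t] i1[OF \<psi>] Jnz by (simp add: m_def J_def)
    then obtain \<eta> where \<eta>: "test_function \<eta>" "deriv \<eta> = (\<lambda>x. \<phi> x + (- m) * \<psi> x)"
      using test_function_antiderivative[OF t2] by blast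
    have "0 = (LINT x|lborel. g x * complex_of_real (\<phi> x + (- m) * \<psi> x))"
      using zero[OF \<eta>(1)] by (simp add: \<eta>(2))
    also have "\<dots> = (LINT x|lborel. g x * complex_of_real (\<phi> x) - complex_of_real m * (g x * complex_of_real (\<psi> x)))"
      unfolding split by (simp add: algebra_simps)
    also have "\<dots> = (LINT x|lborel. g x * complex_of_real (\<phi> x)) - complex_of_real m * (LINT x|lborel. g x * complex_of_real (\<psi> x))"
      using ig[OF t] ig[OF \<psi>] by simp
    finally have "(LINT x|lborel. g x * complex_of_real (\<phi> x)) = c * (LINT x|lborel. complex_of_real (\<phi> x))"
      using Jnz by (simp add: m_def c_def)
    moreover have "(LINT x|lborel. (g x - c) * complex_of_real (\<phi> x)) =
        (LINT x|lborel. g x * complex_of_real (\<phi> x)) - c * (LINT x|lborel. complex_of_real (\<phi> x))"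
    proof -
      have "(g x - c) * complex_of_real (\<phi> x) = g x * complex_of_real (\<phi> x) - c * complex_of_real (\<phi> x)" for x
        by (simp add: algebra_simps)
      then show ?thesis using ig[OF t] i1[OF t] by simp
    qed
    ultimately show "(LINT x|lborel. (g x - c) * complex_of_real (\<phi> x)) = 0" by simp
  qed measurable
  then show ?thesis by auto
qed

text \<open>A primitive \<open>W\<close> of \<open>V\<close> has the same weak derivative as \<open>U\<close>, hence differs from it by a constant.\<close>

lemma weak_derivative_imp_ac_deriv:
  assumes U: "square_integrable U" and V: "square_integrable V"
    and weak: "\<And>\<phi>. test_function \<phi> \<Longrightarrow>
      (LINT x|lborel. U x * complex_of_real (deriv \<phi> x)) = - (LINT x|lborel. V x * complex_of_real (\<phi> x))"
  shows "\<exists>W. ac_deriv W V \<and> (AE x in lborel. U x = W x)"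
proof -
  obtain W where W: "ac_deriv W V" using ac_deriv_square_integrable_primitive[OF V] by blast
  have [measurable]: "U \<in> borel_measurable borel" "W \<in> borel_measurable borel"
    using square_integrable_measurable[OF U] ac_deriv_measurable_primitive[OF W] by auto
  have Wloc: "set_integrable lborel {a..b} W" for a b
    by (intro borel_integrable_atLeastAtMost' continuous_on_subset[OF ac_deriv_continuous[OF W]] subset_UNIV)
  have "\<exists>c. AE x in lborel. U x - W x = c"
  proof (rule weak_derivative_zero_imp_constant)
    show "set_integrable lborel {a..b} (\<lambda>x. U x - W x)" for a b
      using square_integrable_locally_integrable[OF U] Wloc by (rule set_integral_diff)
    fix \<phi> assume t: "test_function \<phi>"
    have iV: "integrable lborel (\<lambda>x. V x * complex_of_real (\<phi> x))"
      by (rule integrable_mult_l2[OF V test_function_square_integrable[OF t]])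
    have iU: "integrable lborel (\<lambda>x. U x * complex_of_real (deriv \<phi> x))"
      by (rule integrable_mult_l2[OF U test_function_square_integrable[OF test_function_deriv[OF t]]])
    have iW: "integrable lborel (\<lambda>x. W x * complex_of_real (deriv \<phi> x))"
      by (rule integrable_mult_test_function[OF _ Wloc test_function_deriv[OF t]]) measurable
    have "(LINT x|lborel. W x * complex_of_real (deriv \<phi> x)) = - (LINT x|lborel. V x * complex_of_real (\<phi> x))"
      using test_function_ac_deriv_mult_integral(2)[OF W t] iV iW by (simp add: eq_neg_iff_add_eq_0 add.commute)
    then show "(LINT x|lborel. (U x - W x) * complex_of_real (deriv \<phi> x)) = 0"
      using weak[OF t] iU iW by (simp add: left_diff_distrib)
  qed measurable
  then obtain c where c: "AE x in lborel. U x - W x = c" by blast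
  have const: "ac_deriv (\<lambda>x. c) (\<lambda>x. 0)"
    by (rule ac_deriv_C1) auto
  have "ac_deriv (\<lambda>x. W x + c) V" using ac_deriv_add[OF W const] by simp
  moreover have "AE x in lborel. U x = W x + c" using c by eventually_elim (simp add: algebra_simps)
  ultimately show ?thesis by blast
qed

section \<open>Representatives of Sobolev functions\<close>

lemma l2_rel_refl: "l2_rel f f \<longleftrightarrow> square_integrable f"
  by (simp add: l2_rel_def)

text \<open>Elements of the quotient are handled through chosen square-integrable representatives from here on.\<close>

lemma l2_cases:
  obtains f where "square_integrable f" "u = abs_l2 f"
proof -
  have "\<exists>f. square_integrable f \<and> u = abs_l2 f"
    by (induction u rule: l2.abs_induct) (auto simp: l2_rel_refl)
  then show ?thesis using that by blast
qed

lemma abs_l2_eqI: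
  "square_integrable f \<Longrightarrow> square_integrable g \<Longrightarrow> AE x in lborel. f x = g x \<Longrightarrow> abs_l2 f = abs_l2 g"
  by (rule Quotient_rel_abs[OF Quotient_l2]) (simp add: l2_rel_def)

lemma abs_l2_add: "square_integrable f \<Longrightarrow> square_integrable g \<Longrightarrow> abs_l2 f + abs_l2 g = abs_l2 (\<lambda>x. f x + g x)"
  by (simp add: plus_l2.abs_eq l2_rel_refl)

lemma abs_l2_scaleC: "square_integrable f \<Longrightarrow> c *\<^sub>C abs_l2 f = abs_l2 (\<lambda>x. c * f x)"
  by (simp add: scaleC_l2.abs_eq l2_rel_refl)

lemma abs_l2_uminus: "square_integrable f \<Longrightarrow> - abs_l2 f = abs_l2 (\<lambda>x. - f x)"
  by (simp add: uminus_l2.abs_eq l2_rel_refl)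

lemma abs_l2_diff: "square_integrable f \<Longrightarrow> square_integrable g \<Longrightarrow> abs_l2 f - abs_l2 g = abs_l2 (\<lambda>x. f x - g x)"
  by (simp add: minus_l2.abs_eq l2_rel_refl)

lemma abs_l2_inner: "square_integrable f \<Longrightarrow> square_integrable g \<Longrightarrow>
    inner (abs_l2 f) (abs_l2 g) = (LINT x|lborel. inner (f x) (g x))"
  by (simp add: inner_l2.abs_eq l2_rel_refl)

lemma norm_abs_l2: "square_integrable f \<Longrightarrow> (norm (abs_l2 f))\<^sup>2 = (LINT x|lborel. (cmod (f x))\<^sup>2)"
  by (simp add: power2_norm_eq_inner abs_l2_inner)

lemma square_integrable_step_potential:
  assumes "square_integrable f"
  shows "square_integrable (\<lambda>x. step_potential Vp Vm x * f x)"
proof (rule square_integrable_mult_bounded[OF assms])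
  show "step_potential Vp Vm \<in> borel_measurable lborel"
    unfolding step_potential_def by measurable
  show "cmod (step_potential Vp Vm x) \<le> max (cmod Vp) (cmod Vm)" for x
    by (simp add: step_potential_def)
qed

lemma abs_l2_mult_step_potential: "square_integrable f \<Longrightarrow>
    mult_step_potential Vp Vm (abs_l2 f) = abs_l2 (\<lambda>x. step_potential Vp Vm x * f x)"
  by (simp add: mult_step_potential.abs_eq l2_rel_refl)

lemma has_weak_deriv_abs_l2:
  "square_integrable U \<Longrightarrow> square_integrable V \<Longrightarrow> has_weak_deriv k (abs_l2 U) (abs_l2 V) \<longleftrightarrow>
     (\<forall>\<phi>. test_function \<phi> \<longrightarrow> (LINT x|lborel. U x * complex_of_real ((deriv ^^ k) \<phi> x)) =
          (- 1) ^ k * (LINT x|lborel. V x * complex_of_real (\<phi> x)))"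
  by (simp add: has_weak_deriv.abs_eq l2_rel_refl)

lemma has_weak_deriv_unique:
  assumes "has_weak_deriv k u v" "has_weak_deriv k u w"
  shows "v = w"
proof -
  obtain U where U: "square_integrable U" "u = abs_l2 U" by (rule l2_cases)
  obtain V where V: "square_integrable V" "v = abs_l2 V" by (rule l2_cases)
  obtain W where W: "square_integrable W" "w = abs_l2 W" by (rule l2_cases)
  have d: "square_integrable (\<lambda>x. V x - W x)" using V W by (intro square_integrable_diff)
  have "AE x in lborel. V x - W x = 0"
  proof (rule fundamental_lemma_calculus_of_variations)
    fix \<phi> assume t: "test_function \<phi>"
    have "(LINT x|lborel. V x * complex_of_real (\<phi> x)) = (LINT x|lborel. W x * complex_of_real (\<phi> x))"
      using assms t unfolding U V W by (auto simp: has_weak_deriv_abs_l2 U V W)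
    then show "(LINT x|lborel. (V x - W x) * complex_of_real (\<phi> x)) = 0"
      using integrable_mult_l2[OF V(1) test_function_square_integrable[OF t]]
        integrable_mult_l2[OF W(1) test_function_square_integrable[OF t]]
      by (simp add: left_diff_distrib)
  qed (rule square_integrable_measurable[OF d] square_integrable_locally_integrable[OF d])+
  then have "AE x in lborel. V x = W x" by eventually_elim simp
  then show ?thesis using V W by (auto intro: abs_l2_eqI)
qed

text \<open>Concrete form of an element of the Sobolev space of order two: \<open>U\<close> is the continuously
differentiable representative, \<open>U1\<close> its classical derivative, and \<open>U2\<close> its second derivative in the
almost-everywhere sense.\<close>

definition h2_representative :: "(real \<Rightarrow> complex) \<Rightarrow> (real \<Rightarrow> complex) \<Rightarrow> (real \<Rightarrow> complex) \<Rightarrow> bool" where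
  "h2_representative U U1 U2 \<longleftrightarrow> square_integrable U \<and> square_integrable U1 \<and> square_integrable U2 \<and>
     ac_deriv U U1 \<and> ac_deriv U1 U2"

lemma ac_deriv_imp_weak:
  assumes "ac_deriv U U1" "square_integrable U" "square_integrable U1" "test_function \<phi>"
  shows "(LINT x|lborel. U x * complex_of_real (deriv \<phi> x)) = - (LINT x|lborel. U1 x * complex_of_real (\<phi> x))"
  using integration_by_parts_l2[OF assms(1) test_function_ac_deriv[OF assms(4)] assms(2,3)
      test_function_square_integrable[OF assms(4)] test_function_square_integrable[OF test_function_deriv[OF assms(4)]]]
  by simp

lemma h2_representative_sobolev:
  assumes "h2_representative U U1 U2"
  shows "abs_l2 U \<in> sobolev 2" "weak_deriv 2 (abs_l2 U) = abs_l2 U2"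
proof -
  note h = assms[unfolded h2_representative_def]
  have 0: "has_weak_deriv 0 (abs_l2 U) (abs_l2 U)"
    using h by (simp add: has_weak_deriv_abs_l2)
  have 1: "has_weak_deriv 1 (abs_l2 U) (abs_l2 U1)"
    using h ac_deriv_imp_weak by (simp add: has_weak_deriv_abs_l2)
  have 2: "has_weak_deriv 2 (abs_l2 U) (abs_l2 U2)"
  proof -
    have "(LINT x|lborel. U x * complex_of_real (deriv (deriv \<phi>) x)) = (LINT x|lborel. U2 x * complex_of_real (\<phi> x))"
      if "test_function \<phi>" for \<phi>
      using ac_deriv_imp_weak[of U U1 "deriv \<phi>"] ac_deriv_imp_weak[of U1 U2 \<phi>] h that
      by (simp add: test_function_deriv)
    then show ?thesis using h by (simp add: has_weak_deriv_abs_l2 numeral_2_eq_2)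
  qed
  have "k = 0 \<or> k = 1 \<or> k = 2" if "k \<le> 2" for k :: nat using that by auto
  then show "abs_l2 U \<in> sobolev 2" unfolding sobolev_def using 0 1 2 by blast
  show "weak_deriv 2 (abs_l2 U) = abs_l2 U2"
    unfolding weak_deriv_def using 2 has_weak_deriv_unique by blast
qed

text \<open>Testing the first weak derivative against derivatives of test functions shows that the second weak
derivative is the weak derivative of the first; both then have absolutely continuous
representatives.\<close>

lemma sobolev_imp_h2_representative:
  assumes "u \<in> sobolev 2"
  obtains U U1 U2 where "h2_representative U U1 U2" "u = abs_l2 U" "weak_deriv 2 u = abs_l2 U2"
proof -
  obtain u1 u2 where w: "has_weak_deriv 1 u u1" "has_weak_deriv 2 u u2"
    using assms unfolding sobolev_def by fastforce
  obtain F where F: "square_integrable F" "u = abs_l2 F" by (rule l2_cases)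
  obtain G where G: "square_integrable G" "u1 = abs_l2 G" by (rule l2_cases)
  obtain U2 where U2: "square_integrable U2" "u2 = abs_l2 U2" by (rule l2_cases)
  have FG: "(LINT x|lborel. F x * complex_of_real (deriv \<phi> x)) = - (LINT x|lborel. G x * complex_of_real (\<phi> x))"
    if "test_function \<phi>" for \<phi>
    using w(1) that unfolding F G by (simp add: has_weak_deriv_abs_l2 F G)
  have GU: "(LINT x|lborel. G x * complex_of_real (deriv \<phi> x)) = - (LINT x|lborel. U2 x * complex_of_real (\<phi> x))"
    if t: "test_function \<phi>" for \<phi>
  proof -
    have "(LINT x|lborel. F x * complex_of_real (deriv (deriv \<phi>) x)) = (LINT x|lborel. U2 x * complex_of_real (\<phi> x))"
      using w(2) t unfolding F U2 by (simp add: has_weak_deriv_abs_l2 F U2 numeral_2_eq_2)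
    then show ?thesis using FG[OF test_function_deriv[OF t]] by (metis minus_minus)
  qed
  obtain U1 where U1: "ac_deriv U1 U2" "AE x in lborel. G x = U1 x"
    using weak_derivative_imp_ac_deriv[OF G(1) U2(1) GU] by blast
  obtain U where U: "ac_deriv U G" "AE x in lborel. F x = U x"
    using weak_derivative_imp_ac_deriv[OF F(1) G(1) FG] by blast
  have [measurable]: "U1 \<in> borel_measurable borel" "U \<in> borel_measurable borel"
    using ac_deriv_measurable_primitive U U1 by auto
  have cong: "square_integrable g" if "square_integrable f" "AE x in lborel. f x = g x" "g \<in> borel_measurable borel" for f g
  proof -
    have [measurable]: "f \<in> borel_measurable borel" "g \<in> borel_measurable borel"
      using that square_integrable_measurable by auto
    have "integrable lborel (\<lambda>x. (cmod (f x))\<^sup>2) \<longleftrightarrow> integrable lborel (\<lambda>x. (cmod (g x))\<^sup>2)"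
    proof (rule integrable_cong_AE)
      show "AE x in lborel. (cmod (f x))\<^sup>2 = (cmod (g x))\<^sup>2"
        using that(2) by eventually_elim simp
    qed measurable
    then show ?thesis using that by (simp add: square_integrable_def)
  qed
  have "ac_deriv U U1" by (rule ac_deriv_cong_AE[OF U(1) U1(2)]) measurable
  moreover have "square_integrable U1" by (rule cong[OF G(1) U1(2)]) measurable
  moreover have sU: "square_integrable U" by (rule cong[OF F(1) U(2)]) measurable
  ultimately have h: "h2_representative U U1 U2"
    using U1 U2 by (simp add: h2_representative_def)
  have u: "u = abs_l2 U" unfolding F(2) by (rule abs_l2_eqI[OF F(1) sU U(2)])
  show ?thesis
    using that[OF h u] h2_representative_sobolev(2)[OF h] u by simp
qed

text \<open>This turns every question about the operator into one about the ordinary differential expression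
acting on representatives.\<close>

lemma schroedinger_step_h2:
  assumes "h2_representative U U1 U2"
  shows "snd (schroedinger_step Vp Vm) (abs_l2 U) - z *\<^sub>C abs_l2 U =
    abs_l2 (\<lambda>x. - U2 x + (step_potential Vp Vm x - z) * U x)"
proof -
  note h = assms[unfolded h2_representative_def]
  have "snd (schroedinger_step Vp Vm) (abs_l2 U) - z *\<^sub>C abs_l2 U =
      - abs_l2 U2 + mult_step_potential Vp Vm (abs_l2 U) - z *\<^sub>C abs_l2 U"
    by (simp add: schroedinger_step_def h2_representative_sobolev(2)[OF assms])
  also have "\<dots> = abs_l2 (\<lambda>x. - U2 x + step_potential Vp Vm x * U x - z * U x)"
    using h by (simp add: abs_l2_uminus abs_l2_mult_step_potential abs_l2_scaleC abs_l2_add abs_l2_diff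
        square_integrable_uminus square_integrable_step_potential square_integrable_scale square_integrable_add square_integrable_diff)
  finally show ?thesis by (simp add: algebra_simps)
qed

lemma square_integrable_schroedinger:
  assumes "h2_representative U U1 U2"
  shows "square_integrable (\<lambda>x. - U2 x + (step_potential Vp Vm x - z) * U x)"
proof -
  note h = assms[unfolded h2_representative_def]
  have "square_integrable (\<lambda>x. - U2 x + (step_potential Vp Vm x * U x - z * U x))"
    using h by (intro square_integrable_add square_integrable_diff square_integrable_uminus
        square_integrable_step_potential square_integrable_scale) auto
  then show ?thesis by (simp add: algebra_simps)
qed

section \<open>The resolvent of the constant-coefficient operator\<close>

lemma norm_abs_l2_mono:
  assumes "square_integrable f" "square_integrable g" "\<And>x. cmod (f x) \<le> cmod (g x)"
  shows "norm (abs_l2 f) \<le> norm (abs_l2 g)"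
proof -
  have "(LINT x|lborel. (cmod (f x))\<^sup>2) \<le> (LINT x|lborel. (cmod (g x))\<^sup>2)"
    using assms by (intro integral_mono power_mono) (auto simp: square_integrable_def)
  then have "(norm (abs_l2 f))\<^sup>2 \<le> (norm (abs_l2 g))\<^sup>2" by (simp add: norm_abs_l2 assms)
  then show ?thesis by (rule power2_le_imp_le) simp
qed

lemma norm_abs_l2_cnj:
  assumes "square_integrable f"
  shows "norm (abs_l2 (\<lambda>x. cnj (f x))) = norm (abs_l2 f)"
  using assms square_integrable_cnj[OF assms]
  by (intro antisym norm_abs_l2_mono) auto

lemma norm_abs_l2_reflect:
  assumes "square_integrable f"
  shows "norm (abs_l2 (\<lambda>x. f (- x))) = norm (abs_l2 f)"
proof -
  have "(norm (abs_l2 (\<lambda>x. f (- x))))\<^sup>2 = (norm (abs_l2 f))\<^sup>2"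
    using lborel_integral_real_affine[of "-1" "\<lambda>x. (cmod (f x))\<^sup>2" 0]
    by (simp add: norm_abs_l2 assms square_integrable_reflect[OF assms])
  then show ?thesis by (simp add: power2_eq_iff_nonneg)
qed

text \<open>The inner product on the quotient is the real part of the complex one, so the integrand is first
rotated to make its integral real.\<close>

lemma cauchy_schwarz_l2:
  assumes f: "square_integrable f" and g: "square_integrable g"
  shows "cmod (LINT x|lborel. f x * g x) \<le> norm (abs_l2 f) * norm (abs_l2 g)"
proof -
  define z where "z = (LINT x|lborel. f x * g x)"
  \<comment> \<open>The phase that rotates \<open>z\<close> to its modulus; it is \<open>0\<close> when \<open>z = 0\<close>.\<close>
  define c where "c = cnj (sgn z)"
  have cz: "c * z = complex_of_real (cmod z)"
    by (simp add: c_def sgn_eq complex_norm_square[symmetric] field_simps power2_eq_square)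
  have nc: "cmod c \<le> 1" by (simp add: c_def norm_sgn)
  have i: "integrable lborel (\<lambda>x. c * (f x * g x))"
    using integrable_mult_l2[OF f g] by simp
  have "cmod z = Re (c * z)" by (simp add: cz)
  also have "c * z = (LINT x|lborel. c * (f x * g x))" by (simp add: z_def)
  also have "Re \<dots> = (LINT x|lborel. Re (c * (f x * g x)))" by (simp only: integral_Re[OF i])
  also have "\<dots> = (LINT x|lborel. inner (c * f x) (cnj (g x)))"
    by (intro Bochner_Integration.integral_cong refl) (simp add: inner_complex_def algebra_simps)
  also have "\<dots> = inner (c *\<^sub>C abs_l2 f) (abs_l2 (\<lambda>x. cnj (g x)))"
    using f g by (simp add: abs_l2_scaleC abs_l2_inner square_integrable_scale square_integrable_cnj)
  also have "\<dots> \<le> norm (c *\<^sub>C abs_l2 f) * norm (abs_l2 (\<lambda>x. cnj (g x)))"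
    by (rule norm_cauchy_schwarz)
  also have "\<dots> = cmod c * (norm (abs_l2 f) * norm (abs_l2 g))"
    by (simp add: norm_scaleC norm_abs_l2_cnj g)
  also have "\<dots> \<le> norm (abs_l2 f) * norm (abs_l2 g)"
    using nc by (intro mult_left_le_one_le) auto
  finally show ?thesis by (simp add: z_def)
qed

lemma has_bochner_integral_exp_half_line:
  fixes \<kappa> :: real
  assumes "\<kappa> > 0"
  shows "has_bochner_integral lborel (\<lambda>x. if x \<ge> 0 then exp (- (\<kappa> * x)) else 0) (1 / \<kappa>)"
proof (rule has_bochner_integral_nn_integral)
  have "(\<integral>\<^sup>+ x. ennreal (exp (- (\<kappa> * x))) * indicator {0..} x \<partial>lborel) = ennreal (0 - (- exp (- (\<kappa> * 0)) / \<kappa>))"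
  proof (rule nn_integral_FTC_atLeast)
    show "((\<lambda>x. - exp (- (\<kappa> * x)) / \<kappa>) has_real_derivative exp (- (\<kappa> * x))) (at x)" for x
      using assms by (auto intro!: derivative_eq_intros)
    have "((\<lambda>x. exp (- (\<kappa> * x))) \<longlongrightarrow> 0) at_top"
      using assms
      by (intro filterlim_compose[OF exp_at_bot] filterlim_compose[OF filterlim_uminus_at_bot_at_top]
          filterlim_tendsto_pos_mult_at_top[OF tendsto_const] filterlim_ident)
    then have "((\<lambda>x. - exp (- (\<kappa> * x)) / \<kappa>) \<longlongrightarrow> - 0 / \<kappa>) at_top"
      using assms by (intro tendsto_intros) auto
    then show "((\<lambda>x. - exp (- (\<kappa> * x)) / \<kappa>) \<longlongrightarrow> 0) at_top" by simp
  qed auto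
  moreover have "ennreal (if x \<ge> 0 then exp (- (\<kappa> * x)) else 0) = ennreal (exp (- (\<kappa> * x))) * indicator {0..} x" for x
    by (simp add: indicator_def)
  ultimately show "(\<integral>\<^sup>+ x. ennreal (if x \<ge> 0 then exp (- (\<kappa> * x)) else 0) \<partial>lborel) = ennreal (1 / \<kappa>)"
    by simp
qed (use assms in auto)

definition exp_right :: "complex \<Rightarrow> real \<Rightarrow> complex" where
  "exp_right p x = (if x \<ge> 0 then exp (- p * complex_of_real x) else 0)"

definition exp_left :: "complex \<Rightarrow> real \<Rightarrow> complex" where
  "exp_left q x = (if x \<ge> 0 then 0 else exp (q * complex_of_real x))"

lemma exp_right_norm:
  assumes "Re p > 0"
  shows "square_integrable (exp_right p)" "(norm (abs_l2 (exp_right p)))\<^sup>2 = 1 / (2 * Re p)"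
proof -
  have eq: "(cmod (exp_right p x))\<^sup>2 = (if x \<ge> 0 then exp (- ((2 * Re p) * x)) else 0)" for x
    by (simp add: exp_right_def power2_eq_square exp_add[symmetric])
  have b: "has_bochner_integral lborel (\<lambda>x. (cmod (exp_right p x))\<^sup>2) (1 / (2 * Re p))"
    unfolding eq by (rule has_bochner_integral_exp_half_line) (use assms in simp)
  have "exp_right p \<in> borel_measurable borel"
    unfolding exp_right_def[abs_def] by (intro measurable_If borel_measurable_continuous_onI continuous_intros) auto
  then show s: "square_integrable (exp_right p)"
    using b by (simp add: square_integrable_def has_bochner_integral_iff)
  show "(norm (abs_l2 (exp_right p)))\<^sup>2 = 1 / (2 * Re p)"
    using b s by (simp add: norm_abs_l2 has_bochner_integral_iff)
qed

lemma exp_left_norm: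
  assumes "Re q > 0"
  shows "square_integrable (exp_left q)" "(norm (abs_l2 (exp_left q)))\<^sup>2 = 1 / (2 * Re q)"
proof -
  have r: "square_integrable (\<lambda>x. exp_right q (- x))"
    by (intro square_integrable_reflect exp_right_norm assms)
  have m: "exp_left q \<in> borel_measurable borel"
    unfolding exp_left_def[abs_def] by (intro measurable_If borel_measurable_continuous_onI continuous_intros) auto
  have ae: "AE x in lborel. exp_right q (- x) = exp_left q x"
    using AE_lborel_singleton[of 0] by eventually_elim (simp add: exp_right_def exp_left_def)
  show s: "square_integrable (exp_left q)"
  proof -
    have [measurable]: "exp_right q \<in> borel_measurable borel" "exp_left q \<in> borel_measurable borel"
      using square_integrable_measurable[OF exp_right_norm(1)[OF assms]] m by auto
    have "integrable lborel (\<lambda>x. (cmod (exp_right q (- x)))\<^sup>2) \<longleftrightarrow> integrable lborel (\<lambda>x. (cmod (exp_left q x))\<^sup>2)"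
    proof (rule integrable_cong_AE)
      show "AE x in lborel. (cmod (exp_right q (- x)))\<^sup>2 = (cmod (exp_left q x))\<^sup>2"
        using ae by eventually_elim simp
    qed measurable
    then show ?thesis using r m by (simp add: square_integrable_def)
  qed
  have "abs_l2 (\<lambda>x. exp_right q (- x)) = abs_l2 (exp_left q)"
    by (rule abs_l2_eqI[OF r s ae])
  then show "(norm (abs_l2 (exp_left q)))\<^sup>2 = 1 / (2 * Re q)"
    using norm_abs_l2_reflect[OF exp_right_norm(1)[OF assms]] exp_right_norm(2)[OF assms] by simp
qed

lemma integrable_of_bounded_increasing_integrals:
  fixes g :: "real \<Rightarrow> real"
  assumes [measurable]: "g \<in> borel_measurable borel" and nonneg: "\<And>x. 0 \<le> g x"
    and loc: "\<And>a b. set_integrable lborel {a..b} g"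
    and bound: "\<And>a b. a \<le> b \<Longrightarrow> (LINT x:{a..b}|lborel. g x) \<le> C"
  shows "integrable lborel g" "(LINT x|lborel. g x) \<le> C"
proof -
  define G where "G n x = indicator {- real n..real n} x *\<^sub>R g x" for n :: nat and x
  have iG: "integrable lborel (G n)" for n
    using loc[of "- real n" "real n"] unfolding set_integrable_def G_def .
  have mono: "mono (\<lambda>n. G n x)" for x
    by (rule monoI) (auto simp: G_def indicator_def nonneg)
  have lim: "(\<lambda>n. G n x) \<longlonglongrightarrow> g x" for x
  proof -
    obtain N :: nat where N: "\<bar>x\<bar> \<le> real N" using real_arch_simple by blast
    have "\<forall>\<^sub>F n in sequentially. G n x = g x"
      using eventually_ge_at_top[of N] by eventually_elim (use N in \<open>auto simp: G_def indicator_def\<close>)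
    then show ?thesis by (rule tendsto_eventually)
  qed
  have le: "(LINT x|lborel. G n x) \<le> C" for n
    using bound[of "- real n" "real n"] by (simp add: G_def set_lebesgue_integral_def)
  have inc: "incseq (\<lambda>n. LINT x|lborel. G n x)"
  proof (rule incseq_SucI)
    show "(LINT x|lborel. G n x) \<le> (LINT x|lborel. G (Suc n) x)" for n
      by (intro integral_mono iG monoD[OF mono]) simp
  qed
  obtain L where L: "(\<lambda>n. LINT x|lborel. G n x) \<longlonglongrightarrow> L"
    using incseq_convergent[OF inc, of C] le by blast
  show "integrable lborel g"
    by (rule integrable_monotone_convergence[OF iG _ _ L]) (use mono lim in auto)
  have "(LINT x|lborel. g x) = L"
    by (rule integral_monotone_convergence[OF iG _ _ L]) (use mono lim in auto)
  moreover have "L \<le> C" by (rule LIMSEQ_le_const2[OF L]) (use le in blast)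
  ultimately show "(LINT x|lborel. g x) \<le> C" by simp
qed

text \<open>Integrating the derivative of the squared modulus of \<open>P\<close> gives
\<open>\<bar>P b\<bar>\<^sup>2 - \<bar>P a\<bar>\<^sup>2 = \<integral> 2 Re (f cnj P) - 2 Re k \<bar>P\<bar>\<^sup>2\<close> over \<open>{a..b}\<close>. Half of the dissipation absorbs
the forcing term, and the bound on \<open>P a\<close> makes what remains uniform in the interval.\<close>

lemma first_order_energy_estimate:
  assumes k: "Re k > 0" and f: "square_integrable f" and P_ac: "ac_deriv P (\<lambda>x. f x - k * P x)"
    and P_bound: "\<And>x. cmod (P x) \<le> norm (abs_l2 f) / sqrt (2 * Re k)"
  shows "square_integrable P" "norm (abs_l2 P) \<le> 2 / Re k * norm (abs_l2 f)"
proof -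
  define \<kappa> where "\<kappa> = Re k"
  have \<kappa>: "\<kappa> > 0" using k by (simp add: \<kappa>_def)
  define N where "N = norm (abs_l2 f)"
  have [measurable]: "P \<in> borel_measurable borel" by (rule ac_deriv_measurable_primitive[OF P_ac])
  have loc: "set_integrable lborel {a..b} (\<lambda>x. (cmod (P x))\<^sup>2)" for a b
    by (intro borel_integrable_atLeastAtMost' continuous_intros continuous_on_subset[OF ac_deriv_continuous[OF P_ac]] subset_UNIV)
  have fint: "integrable lborel (\<lambda>x. (cmod (f x))\<^sup>2)" and fN: "(LINT x|lborel. (cmod (f x))\<^sup>2) = N\<^sup>2"
    using f by (auto simp: square_integrable_def N_def norm_abs_l2)
  have floc: "set_integrable lborel {a..b} (\<lambda>x. (cmod (f x))\<^sup>2)" for a b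
    using integrable_mult_indicator[OF _ fint, of "{a..b}"] by (simp add: set_integrable_def)
  have energy: "(LINT x:{a..b}|lborel. (cmod (P x))\<^sup>2) \<le> 3 / 2 * N\<^sup>2 / \<kappa>\<^sup>2" if ab: "a \<le> b" for a b
  proof -
    define h where "h x = (f x - k * P x) * cnj (P x) + P x * cnj (f x - k * P x)" for x
    have ac: "ac_deriv (\<lambda>x. P x * cnj (P x)) h"
      unfolding h_def by (rule ac_deriv_mult[OF P_ac ac_deriv_cnj[OF P_ac]])
    \<comment> \<open>Young's inequality with weight \<open>\<kappa>\<close>, so that exactly half of \<open>2 \<kappa> \<bar>P\<bar>\<^sup>2\<close> survives.\<close>
    have hR: "Re (h x) \<le> (cmod (f x))\<^sup>2 / \<kappa> - \<kappa> * (cmod (P x))\<^sup>2" for x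
    proof -
      have e: "Re (h x) = 2 * Re (f x * cnj (P x)) - 2 * \<kappa> * (cmod (P x))\<^sup>2"
        unfolding cmod_power2 by (simp add: h_def \<kappa>_def power2_eq_square algebra_simps)
      have "Re (f x * cnj (P x)) \<le> cmod (f x) * cmod (P x)"
        using complex_Re_le_cmod[of "f x * cnj (P x)"] by (simp add: norm_mult)
      moreover have "2 * (cmod (f x) * cmod (P x)) \<le> (cmod (f x))\<^sup>2 / \<kappa> + \<kappa> * (cmod (P x))\<^sup>2"
      proof -
        have "0 \<le> (cmod (f x) - \<kappa> * cmod (P x))\<^sup>2 / \<kappa>" using \<kappa> by simp
        also have "\<dots> = (cmod (f x))\<^sup>2 / \<kappa> + \<kappa> * (cmod (P x))\<^sup>2 - 2 * (cmod (f x) * cmod (P x))"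
          using \<kappa> by (simp add: power2_eq_square field_simps)
        finally show ?thesis by simp
      qed
      ultimately show ?thesis using e by simp
    qed
    have si: "set_integrable lborel {a..b} h" by (rule ac_deriv_set_integrable[OF ac])
    have siR: "set_integrable lborel {a..b} (\<lambda>x. Re (h x))"
      using integrable_Re[OF si[unfolded set_integrable_def]] by (simp add: set_integrable_def)
    have "(LINT x:{a..b}|lborel. Re (h x)) = Re (LINT x:{a..b}|lborel. h x)"
      using integral_Re[OF si[unfolded set_integrable_def]] by (simp add: set_lebesgue_integral_def)
    also have "\<dots> = Re (P b * cnj (P b) - P a * cnj (P a))"
      using ac_deriv_increment[OF ac ab] by simp
    also have "\<dots> = (cmod (P b))\<^sup>2 - (cmod (P a))\<^sup>2"
      unfolding cmod_power2 by (simp add: power2_eq_square)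
    finally have inc: "(LINT x:{a..b}|lborel. Re (h x)) = (cmod (P b))\<^sup>2 - (cmod (P a))\<^sup>2" .
    have "(LINT x:{a..b}|lborel. Re (h x)) \<le> (LINT x:{a..b}|lborel. (cmod (f x))\<^sup>2 / \<kappa> - \<kappa> * (cmod (P x))\<^sup>2)"
      by (rule set_integral_mono[OF siR]) (use hR floc loc in auto)
    also have "\<dots> = (LINT x:{a..b}|lborel. (cmod (f x))\<^sup>2) / \<kappa> - \<kappa> * (LINT x:{a..b}|lborel. (cmod (P x))\<^sup>2)"
      using floc loc by (subst set_integral_diff) auto
    finally have up: "(LINT x:{a..b}|lborel. Re (h x)) \<le>
        (LINT x:{a..b}|lborel. (cmod (f x))\<^sup>2) / \<kappa> - \<kappa> * (LINT x:{a..b}|lborel. (cmod (P x))\<^sup>2)" .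
    have "(LINT x:{a..b}|lborel. (cmod (f x))\<^sup>2) \<le> N\<^sup>2"
      unfolding fN[symmetric] set_lebesgue_integral_def
      by (intro integral_mono fint floc[unfolded set_integrable_def]) (auto simp: indicator_def)
    then have "(LINT x:{a..b}|lborel. (cmod (f x))\<^sup>2) / \<kappa> \<le> N\<^sup>2 / \<kappa>"
      using \<kappa> by (simp add: divide_right_mono)
    then have 1: "\<kappa> * (LINT x:{a..b}|lborel. (cmod (P x))\<^sup>2) \<le> N\<^sup>2 / \<kappa> + (cmod (P a))\<^sup>2"
      using up inc zero_le_power2[of "cmod (P b)"] by linarith
    have "(cmod (P a))\<^sup>2 \<le> (N / sqrt (2 * \<kappa>))\<^sup>2"
      using P_bound by (intro power_mono) (auto simp: N_def \<kappa>_def)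
    also have "\<dots> = N\<^sup>2 / (2 * \<kappa>)" using \<kappa> by (simp add: power_divide)
    finally have "\<kappa> * (LINT x:{a..b}|lborel. (cmod (P x))\<^sup>2) \<le> N\<^sup>2 / \<kappa> + N\<^sup>2 / (2 * \<kappa>)"
      using 1 by simp
    then show ?thesis using \<kappa> by (simp add: field_simps power2_eq_square)
  qed
  have res: "integrable lborel (\<lambda>x. (cmod (P x))\<^sup>2)" "(LINT x|lborel. (cmod (P x))\<^sup>2) \<le> 3 / 2 * N\<^sup>2 / \<kappa>\<^sup>2"
    by (rule integrable_of_bounded_increasing_integrals[OF _ _ loc energy]; simp)+
  then show sP: "square_integrable P" by (simp add: square_integrable_def)
  have "(norm (abs_l2 P))\<^sup>2 \<le> 3 / 2 * N\<^sup>2 / \<kappa>\<^sup>2" using res sP by (simp add: norm_abs_l2)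
  also have "\<dots> \<le> 4 * N\<^sup>2 / \<kappa>\<^sup>2" by (intro divide_right_mono) auto
  also have "\<dots> = (2 / \<kappa> * N)\<^sup>2" by (simp add: power_mult_distrib power_divide)
  finally have "norm (abs_l2 P) \<le> 2 / \<kappa> * N"
    by (rule power2_le_imp_le) (use \<kappa> in \<open>simp add: N_def\<close>)
  then show "norm (abs_l2 P) \<le> 2 / Re k * norm (abs_l2 f)"
    by (simp add: N_def \<kappa>_def)
qed

text \<open>The causal solution of \<open>P' + k P = f\<close>, namely \<open>P x = \<integral> exp (- k (x - y)) f y dy\<close> over \<open>y \<le> x\<close>. The
Cauchy-Schwarz inequality bounds it pointwise.\<close>

lemma first_order_solution:
  assumes k: "Re k > 0" and f: "square_integrable f"
  shows "\<exists>P. ac_deriv P (\<lambda>x. f x - k * P x) \<and> square_integrable P \<and>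
    norm (abs_l2 P) \<le> 2 / Re k * norm (abs_l2 f) \<and>
    (\<forall>x. cmod (P x) \<le> norm (abs_l2 f) / sqrt (2 * Re k))"
proof -
  define \<kappa> where "\<kappa> = Re k"
  have \<kappa>: "\<kappa> > 0" using k by (simp add: \<kappa>_def)
  define N where "N = norm (abs_l2 f)"
  have [measurable]: "f \<in> borel_measurable borel" using f by (rule square_integrable_measurable)
  define Q where "Q x = (LINT y|lborel. (if y \<le> x then exp (k * complex_of_real y) * f y else 0))" for x
  define P where "P x = exp (- k * complex_of_real x) * Q x" for x
  \<comment> \<open>As a function of \<open>y\<close>, the kernel is a reflected and translated half-line exponential.\<close>
  have kernel: "square_integrable (\<lambda>y. exp_right k (x - y))"
      "norm (abs_l2 (\<lambda>y. exp_right k (x - y))) = 1 / sqrt (2 * \<kappa>)" for x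
  proof -
    have m[measurable]: "exp_right k \<in> borel_measurable borel"
      using exp_right_norm(1)[OF k] by (rule square_integrable_measurable)
    have "integrable lborel (\<lambda>y. (cmod (exp_right k y))\<^sup>2)"
      using exp_right_norm(1)[OF k] by (simp add: square_integrable_def)
    from lborel_integrable_real_affine[OF this, of "-1" x]
    show s: "square_integrable (\<lambda>y. exp_right k (x - y))"
      by (simp add: square_integrable_def)
    have "(norm (abs_l2 (\<lambda>y. exp_right k (x - y))))\<^sup>2 = 1 / (2 * \<kappa>)"
      using lborel_integral_real_affine[of "-1" "\<lambda>y. (cmod (exp_right k y))\<^sup>2" x] exp_right_norm[OF k]
      by (simp add: norm_abs_l2 s \<kappa>_def)
    then show "norm (abs_l2 (\<lambda>y. exp_right k (x - y))) = 1 / sqrt (2 * \<kappa>)"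
      using real_sqrt_unique[of "norm (abs_l2 (\<lambda>y. exp_right k (x - y)))" "1 / (2 * \<kappa>)"]
      by (simp add: real_sqrt_divide)
  qed
  have factor: "(if y \<le> x then exp (k * complex_of_real y) * f y else 0) =
      exp (k * complex_of_real x) * (exp_right k (x - y) * f y)" for x y
  proof -
    have "exp (k * complex_of_real x) * exp (- k * complex_of_real (x - y)) = exp (k * complex_of_real y)"
      unfolding exp_add[symmetric] by (simp add: algebra_simps)
    then have E: "exp (k * complex_of_real x) * (exp (- k * complex_of_real (x - y)) * f y) = exp (k * complex_of_real y) * f y"
      by (metis mult.assoc)
    show ?thesis
    proof (cases "y \<le> x")
      case True
      then show ?thesis by (simp only: exp_right_def E diff_ge_0_iff_ge if_True)
    qed (simp add: exp_right_def)
  qed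
  have cancel: "exp (- k * complex_of_real x) * (exp (k * complex_of_real x) * w) = w" for x w
  proof -
    have "exp (- k * complex_of_real x) * exp (k * complex_of_real x) = 1"
      unfolding exp_add[symmetric] by simp
    then show ?thesis by (metis mult.assoc mult_1)
  qed
  have iQ: "integrable lborel (\<lambda>y. if y \<le> x then exp (k * complex_of_real y) * f y else 0)" for x
    unfolding factor using integrable_mult_l2[OF kernel(1) f] by simp
  have P_eq: "P x = (LINT y|lborel. exp_right k (x - y) * f y)" for x
    unfolding P_def Q_def factor integral_mult_right_zero cancel ..
  have P_bound: "cmod (P x) \<le> N / sqrt (2 * \<kappa>)" for x
    using cauchy_schwarz_l2[OF kernel(1) f, of x] by (simp add: P_eq kernel(2) N_def)
  \<comment> \<open>Removing the factor \<open>exp (- k x)\<close> leaves a plain primitive.\<close>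
  have Q_ac: "ac_deriv Q (\<lambda>x. exp (k * complex_of_real x) * f x)"
    unfolding ac_deriv_def
  proof (intro conjI allI impI)
    have [measurable]: "(\<lambda>x. exp (k * complex_of_real x)) \<in> borel_measurable borel"
      by (intro borel_measurable_continuous_onI continuous_intros)
    show "(\<lambda>x. exp (k * complex_of_real x) * f x) \<in> borel_measurable borel" by measurable
    fix a b :: real assume ab: "a \<le> b"
    have i: "integrable lborel (\<lambda>y. (if y \<le> b then exp (k * complex_of_real y) * f y else 0)
        - (if y \<le> a then exp (k * complex_of_real y) * f y else 0))"
      by (intro Bochner_Integration.integrable_diff iQ)
    have ae: "AE y in lborel. (if y \<le> b then exp (k * complex_of_real y) * f y else 0)
        - (if y \<le> a then exp (k * complex_of_real y) * f y else 0)
        = indicator {a..b} y *\<^sub>R (exp (k * complex_of_real y) * f y)"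
      using AE_lborel_singleton[of a] by eventually_elim (use ab in \<open>auto simp: indicator_def\<close>)
    show "set_integrable lborel {a..b} (\<lambda>x. exp (k * complex_of_real x) * f x)"
      unfolding set_integrable_def
      by (rule integrable_cong_AE_imp[OF i]) (measurable, use ae in eventually_elim, simp)
    have "Q b - Q a = (LINT y|lborel. (if y \<le> b then exp (k * complex_of_real y) * f y else 0)
        - (if y \<le> a then exp (k * complex_of_real y) * f y else 0))"
      unfolding Q_def using iQ by simp
    also have "\<dots> = (LINT x:{a..b}|lborel. exp (k * complex_of_real x) * f x)"
      unfolding set_lebesgue_integral_def
      by (rule integral_cong_AE[OF _ _ ae]) measurable
    finally show "Q b - Q a = (LINT x:{a..b}|lborel. exp (k * complex_of_real x) * f x)" .
  qed
  have "(\<lambda>x. (- k) * exp ((- k) * complex_of_real x) * Q x + exp ((- k) * complex_of_real x) * (exp (k * complex_of_real x) * f x))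
      = (\<lambda>x. f x - k * P x)"
    unfolding P_def cancel by (rule ext) (simp add: algebra_simps)
  then have P_ac: "ac_deriv P (\<lambda>x. f x - k * P x)"
    using ac_deriv_mult[OF ac_deriv_exp[of "- k"] Q_ac] by (simp add: P_def[abs_def])
  show ?thesis
    using P_ac first_order_energy_estimate[OF k f P_ac] P_bound unfolding N_def \<kappa>_def by blast
qed

text \<open>The operator \<open>- d\<^sup>2/dx\<^sup>2 + k\<^sup>2\<close> factors as \<open>(d/dx + k) (- d/dx + k)\<close>. The second factor is inverted
by the reflected first-order solution, the first by the solution itself. The values at the origin
are recorded because they enter the matching conditions across the jump of the potential.\<close>

lemma constant_coefficient_resolvent:
  assumes k: "Re k > 0"
  shows "\<exists>C\<ge>0. \<forall>f. square_integrable f \<longrightarrow> (\<exists>U U1. h2_representative U U1 (\<lambda>x. k\<^sup>2 * U x - f x) \<and>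
    norm (abs_l2 U) \<le> C * norm (abs_l2 f) \<and> cmod (U 0) \<le> C * norm (abs_l2 f) \<and> cmod (U1 0) \<le> C * norm (abs_l2 f))"
proof -
  define a where "a = 2 / Re k"
  define b where "b = 1 / sqrt (2 * Re k)"
  have ab: "a \<ge> 0" "b \<ge> 0" using k by (auto simp: a_def b_def)
  define C where "C = a * a + a * b + b + cmod k * (a * b)"
  have C: "C \<ge> 0" "C \<ge> a * a" "C \<ge> a * b" "C \<ge> b + cmod k * (a * b)" using ab by (auto simp: C_def)
  have "\<exists>U U1. h2_representative U U1 (\<lambda>x. k\<^sup>2 * U x - f x) \<and>
    norm (abs_l2 U) \<le> C * norm (abs_l2 f) \<and> cmod (U 0) \<le> C * norm (abs_l2 f) \<and> cmod (U1 0) \<le> C * norm (abs_l2 f)"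
    if f: "square_integrable f" for f
  proof -
    let ?N = "norm (abs_l2 f)"
    obtain P where P: "ac_deriv P (\<lambda>x. f (- x) - k * P x)" "square_integrable P"
      "norm (abs_l2 P) \<le> a * ?N" "\<And>x. cmod (P x) \<le> b * ?N"
      using first_order_solution[OF k square_integrable_reflect[OF f]] norm_abs_l2_reflect[OF f]
      by (auto simp: a_def b_def)
    \<comment> \<open>Reflection turns the solution operator of \<open>P' + k P\<close> into that of \<open>- p' + k p\<close>.\<close>
    define p where "p = (\<lambda>x. P (- x))"
    have p: "ac_deriv p (\<lambda>x. k * p x - f x)" "square_integrable p" "norm (abs_l2 p) \<le> a * ?N" "\<And>x. cmod (p x) \<le> b * ?N"
      using ac_deriv_reflect[OF P(1)] square_integrable_reflect[OF P(2)] norm_abs_l2_reflect[OF P(2)] P(3,4)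
      by (auto simp: p_def)
    obtain U where U: "ac_deriv U (\<lambda>x. p x - k * U x)" "square_integrable U"
      "norm (abs_l2 U) \<le> a * norm (abs_l2 p)" "\<And>x. cmod (U x) \<le> b * norm (abs_l2 p)"
      using first_order_solution[OF k p(2)] by (auto simp: a_def b_def)
    define U1 where "U1 x = p x - k * U x" for x
    have "ac_deriv U1 (\<lambda>x. (k * p x - f x) - k * (p x - k * U x))"
      unfolding U1_def by (intro ac_deriv_diff ac_deriv_cmult p(1) U(1))
    moreover have "(\<lambda>x. (k * p x - f x) - k * (p x - k * U x)) = (\<lambda>x. k\<^sup>2 * U x - f x)"
      by (rule ext) (simp add: algebra_simps power2_eq_square)
    ultimately have "ac_deriv U1 (\<lambda>x. k\<^sup>2 * U x - f x)" by simp
    moreover have "square_integrable U1" "square_integrable (\<lambda>x. k\<^sup>2 * U x - f x)"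
      unfolding U1_def by (intro square_integrable_diff square_integrable_scale p(2) U(2) f)+
    moreover have "ac_deriv U U1" using U(1) by (simp add: U1_def[abs_def])
    ultimately have h: "h2_representative U U1 (\<lambda>x. k\<^sup>2 * U x - f x)"
      using U(2) by (simp add: h2_representative_def)
    have n1: "norm (abs_l2 U) \<le> a * a * ?N"
      using order_trans[OF U(3) mult_left_mono[OF p(3) ab(1)]] by (simp add: mult.assoc)
    have n2: "cmod (U 0) \<le> a * b * ?N"
      using order_trans[OF U(4) mult_left_mono[OF p(3) ab(2)]] by (simp add: mult.assoc mult.left_commute)
    have "cmod (U1 0) \<le> cmod (p 0) + cmod k * cmod (U 0)"
      unfolding U1_def using norm_triangle_ineq4[of "p 0" "k * U 0"] by (simp add: norm_mult)
    also have "\<dots> \<le> b * ?N + cmod k * (a * b * ?N)"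
      by (intro add_mono p(4) mult_left_mono n2) simp
    finally have n3: "cmod (U1 0) \<le> (b + cmod k * (a * b)) * ?N" by (simp add: algebra_simps)
    have up: "t \<le> C * ?N" if "t \<le> c * ?N" "c \<le> C" for t c
      using that mult_right_mono[OF that(2), of ?N] by simp
    show ?thesis using h up[OF n1 C(2)] up[OF n2 C(3)] up[OF n3 C(4)] by blast
  qed
  then show ?thesis using C(1) by blast
qed

section \<open>Matching solutions across the jump\<close>

text \<open>The value at \<open>0\<close> is taken from the right, in agreement with the convention of the step potential.\<close>

definition paste :: "(real \<Rightarrow> complex) \<Rightarrow> (real \<Rightarrow> complex) \<Rightarrow> real \<Rightarrow> complex" where
  "paste F G x = (if x \<ge> 0 then F x else G x)"

lemma square_integrable_paste:
  "square_integrable f \<Longrightarrow> square_integrable g \<Longrightarrow> square_integrable (paste f g)"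
  unfolding paste_def[abs_def] by (rule square_integrable_if)

lemma h2_representative_paste:
  assumes "ac_deriv F F1" "ac_deriv F1 F2" "ac_deriv G G1" "ac_deriv G1 G2" "F 0 = G 0" "F1 0 = G1 0"
    and "square_integrable (paste F G)" "square_integrable (paste F1 G1)" "square_integrable (paste F2 G2)"
  shows "h2_representative (paste F G) (paste F1 G1) (paste F2 G2)"
  unfolding h2_representative_def
  using assms ac_deriv_glue[OF assms(1,3,5)] ac_deriv_glue[OF assms(2,4,6)]
  by (simp add: paste_def[abs_def])

lemma paste_exp_eq:
  "paste (\<lambda>x. f x + a * exp (- p * complex_of_real x)) (\<lambda>x. g x + b * exp (q * complex_of_real x))
    = (\<lambda>x. paste f g x + (a * exp_right p x + b * exp_left q x))"
  by (rule ext) (simp add: paste_def exp_right_def exp_left_def)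

lemma square_integrable_paste_exp:
  assumes "Re p > 0" "Re q > 0" "square_integrable (paste f g)"
  shows "square_integrable (paste (\<lambda>x. f x + a * exp (- p * complex_of_real x)) (\<lambda>x. g x + b * exp (q * complex_of_real x)))"
  unfolding paste_exp_eq
  by (intro square_integrable_add square_integrable_scale exp_right_norm exp_left_norm assms)

lemma norm_paste_exp_le:
  assumes "Re p > 0" "Re q > 0" "square_integrable f" "square_integrable g"
  shows "norm (abs_l2 (paste (\<lambda>x. f x + a * exp (- p * complex_of_real x)) (\<lambda>x. g x + b * exp (q * complex_of_real x))))
    \<le> norm (abs_l2 f) + norm (abs_l2 g) + cmod a * norm (abs_l2 (exp_right p)) + cmod b * norm (abs_l2 (exp_left q))"
proof -
  have z: "square_integrable (\<lambda>x. 0)" by (rule square_integrable_zero)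
  note L = assms(3,4) exp_right_norm(1)[OF assms(1)] exp_left_norm(1)[OF assms(2)]
    square_integrable_paste[OF assms(3) z] square_integrable_paste[OF z assms(4)]
  have "paste f g = (\<lambda>x. paste f (\<lambda>x. 0) x + paste (\<lambda>x. 0) g x)"
    by (rule ext) (simp add: paste_def)
  then have "abs_l2 (paste (\<lambda>x. f x + a * exp (- p * complex_of_real x)) (\<lambda>x. g x + b * exp (q * complex_of_real x)))
      = (abs_l2 (paste f (\<lambda>x. 0)) + abs_l2 (paste (\<lambda>x. 0) g)) + (a *\<^sub>C abs_l2 (exp_right p) + b *\<^sub>C abs_l2 (exp_left q))"
    unfolding paste_exp_eq
    by (simp add: L abs_l2_add abs_l2_scaleC square_integrable_add square_integrable_scale)
  also have "norm \<dots> \<le> (norm (abs_l2 (paste f (\<lambda>x. 0))) + norm (abs_l2 (paste (\<lambda>x. 0) g)))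
      + (norm (a *\<^sub>C abs_l2 (exp_right p)) + norm (b *\<^sub>C abs_l2 (exp_left q)))"
    by (intro norm_triangle_le add_mono norm_triangle_ineq)
  also have "norm (abs_l2 (paste f (\<lambda>x. 0))) \<le> norm (abs_l2 f)"
    by (intro norm_abs_l2_mono L) (simp add: paste_def)
  also have "norm (abs_l2 (paste (\<lambda>x. 0) g)) \<le> norm (abs_l2 g)"
    by (intro norm_abs_l2_mono L) (simp add: paste_def)
  finally show ?thesis by (simp add: norm_scaleC)
qed

lemma ac_deriv_exp_cmult: "ac_deriv (\<lambda>x. a * exp (c * complex_of_real x)) (\<lambda>x. (c * a) * exp (c * complex_of_real x))"
  using ac_deriv_cmult[OF ac_deriv_exp[of c], of a] by (simp add: mult.assoc mult.left_commute)

text \<open>On each half-line the constant-coefficient solutions \<open>P\<close> and \<open>M\<close> solve the equation, but they do not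
fit together at \<open>0\<close>. Adding the decaying homogeneous solutions \<open>A exp (- kp x)\<close> on the right and
\<open>B exp (km x)\<close> on the left repairs value and slope; the linear system for \<open>A\<close> and \<open>B\<close> has
determinant \<open>- (kp + km)\<close>, which is nonzero since both roots have positive real part.\<close>

lemma schroedinger_solution_exists:
  assumes kp: "Re kp > 0" "kp\<^sup>2 = Vp - z" and km: "Re km > 0" "km\<^sup>2 = Vm - z"
  shows "\<exists>C. \<forall>f. square_integrable f \<longrightarrow> (\<exists>U U1 U2. h2_representative U U1 U2 \<and>
    (\<forall>x. - U2 x + (step_potential Vp Vm x - z) * U x = f x) \<and> norm (abs_l2 U) \<le> C * norm (abs_l2 f))"
proof -
  obtain Cp where Cp: "Cp \<ge> 0" "\<And>f. square_integrable f \<Longrightarrow> \<exists>U U1. h2_representative U U1 (\<lambda>x. kp\<^sup>2 * U x - f x) \<and>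
    norm (abs_l2 U) \<le> Cp * norm (abs_l2 f) \<and> cmod (U 0) \<le> Cp * norm (abs_l2 f) \<and> cmod (U1 0) \<le> Cp * norm (abs_l2 f)"
    using constant_coefficient_resolvent[OF kp(1)] by blast
  obtain Cm where Cm: "Cm \<ge> 0" "\<And>f. square_integrable f \<Longrightarrow> \<exists>U U1. h2_representative U U1 (\<lambda>x. km\<^sup>2 * U x - f x) \<and>
    norm (abs_l2 U) \<le> Cm * norm (abs_l2 f) \<and> cmod (U 0) \<le> Cm * norm (abs_l2 f) \<and> cmod (U1 0) \<le> Cm * norm (abs_l2 f)"
    using constant_coefficient_resolvent[OF km(1)] by blast
  define D where "D = Cp + Cm"
  define a where "a = (cmod km * D + D) / cmod (kp + km)"
  define b where "b = (cmod kp * D + D) / cmod (kp + km)"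
  define C where "C = D + a * norm (abs_l2 (exp_right kp)) + b * norm (abs_l2 (exp_left km))"
  have sum: "kp + km \<noteq> 0" using kp(1) km(1) by (metis add_pos_pos less_irrefl plus_complex.sel(1) zero_complex.sel(1))
  have "\<exists>U U1 U2. h2_representative U U1 U2 \<and>
    (\<forall>x. - U2 x + (step_potential Vp Vm x - z) * U x = f x) \<and> norm (abs_l2 U) \<le> C * norm (abs_l2 f)"
    if f: "square_integrable f" for f
  proof -
    let ?N = "norm (abs_l2 f)"
    obtain P P1 where P: "h2_representative P P1 (\<lambda>x. kp\<^sup>2 * P x - f x)"
      "norm (abs_l2 P) \<le> Cp * ?N" "cmod (P 0) \<le> Cp * ?N" "cmod (P1 0) \<le> Cp * ?N"
      using Cp(2)[OF f] by blast
    obtain M M1 where M: "h2_representative M M1 (\<lambda>x. km\<^sup>2 * M x - f x)"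
      "norm (abs_l2 M) \<le> Cm * ?N" "cmod (M 0) \<le> Cm * ?N" "cmod (M1 0) \<le> Cm * ?N"
      using Cm(2)[OF f] by blast
    have acP: "ac_deriv P P1" "ac_deriv P1 (\<lambda>x. kp\<^sup>2 * P x - f x)" "square_integrable P" "square_integrable P1"
        "square_integrable (\<lambda>x. kp\<^sup>2 * P x - f x)"
      using P(1) by (auto simp: h2_representative_def)
    have acM: "ac_deriv M M1" "ac_deriv M1 (\<lambda>x. km\<^sup>2 * M x - f x)" "square_integrable M" "square_integrable M1"
        "square_integrable (\<lambda>x. km\<^sup>2 * M x - f x)"
      using M(1) by (auto simp: h2_representative_def)
    \<comment> \<open>The jumps of value and slope at the origin that the exponentials have to compensate.\<close>
    define r where "r = M 0 - P 0"
    define s where "s = M1 0 - P1 0"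
    define A where "A = (km * r - s) / (kp + km)"
    define B where "B = - (kp * r + s) / (kp + km)"
    have AB: "P 0 + A = M 0 + B" "P1 0 - kp * A = M1 0 + km * B"
      using sum unfolding A_def B_def by (simp_all add: r_def s_def field_simps) 
    have r: "cmod r \<le> D * ?N"
      using norm_triangle_ineq4[of "M 0" "P 0"] P(3) M(3) by (simp add: r_def D_def distrib_right)
    have s: "cmod s \<le> D * ?N"
      using norm_triangle_ineq4[of "M1 0" "P1 0"] P(4) M(4) by (simp add: s_def D_def distrib_right)
    have A: "cmod A \<le> a * ?N"
    proof -
      have "cmod (km * r - s) \<le> cmod km * cmod r + cmod s"
        using norm_triangle_ineq4[of "km * r" s] by (simp add: norm_mult)
      also have "\<dots> \<le> cmod km * (D * ?N) + D * ?N" by (intro add_mono mult_left_mono r s) simp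
      finally show ?thesis
        by (simp add: A_def a_def norm_divide divide_right_mono distrib_right mult.assoc)
    qed
    have B: "cmod B \<le> b * ?N"
    proof -
      have "cmod (- (kp * r + s)) \<le> cmod kp * cmod r + cmod s"
        using norm_triangle_ineq[of "kp * r" s] by (simp add: norm_mult del: minus_add_distrib)
      also have "\<dots> \<le> cmod kp * (D * ?N) + D * ?N" by (intro add_mono mult_left_mono r s) simp
      finally show ?thesis
        by (simp add: B_def b_def norm_divide divide_right_mono distrib_right mult.assoc)
    qed
    define U where "U = paste (\<lambda>x. P x + A * exp (- kp * complex_of_real x)) (\<lambda>x. M x + B * exp (km * complex_of_real x))"
    define U1 where "U1 = paste (\<lambda>x. P1 x + (- kp * A) * exp (- kp * complex_of_real x)) (\<lambda>x. M1 x + (km * B) * exp (km * complex_of_real x))"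
    define U2 where "U2 = paste (\<lambda>x. (kp\<^sup>2 * P x - f x) + (- kp * (- kp * A)) * exp (- kp * complex_of_real x))
        (\<lambda>x. (km\<^sup>2 * M x - f x) + (km * (km * B)) * exp (km * complex_of_real x))"
    have h: "h2_representative U U1 U2"
      unfolding U_def U1_def U2_def
      by (rule h2_representative_paste[OF ac_deriv_add[OF acP(1) ac_deriv_exp_cmult] ac_deriv_add[OF acP(2) ac_deriv_exp_cmult]
            ac_deriv_add[OF acM(1) ac_deriv_exp_cmult] ac_deriv_add[OF acM(2) ac_deriv_exp_cmult] _ _
            square_integrable_paste_exp[OF kp(1) km(1) square_integrable_paste[OF acP(3) acM(3)]]
            square_integrable_paste_exp[OF kp(1) km(1) square_integrable_paste[OF acP(4) acM(4)]]
            square_integrable_paste_exp[OF kp(1) km(1) square_integrable_paste[OF acP(5) acM(5)]]])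
        (use AB in simp_all)
    have eq: "- U2 x + (step_potential Vp Vm x - z) * U x = f x" for x
      using kp(2) km(2) by (auto simp: U2_def U_def paste_def step_potential_def power2_eq_square algebra_simps)
    have "norm (abs_l2 U) \<le> norm (abs_l2 P) + norm (abs_l2 M) + cmod A * norm (abs_l2 (exp_right kp)) + cmod B * norm (abs_l2 (exp_left km))"
      unfolding U_def by (intro norm_paste_exp_le kp km acP acM)
    also have "\<dots> \<le> Cp * ?N + Cm * ?N + a * ?N * norm (abs_l2 (exp_right kp)) + b * ?N * norm (abs_l2 (exp_left km))"
      by (intro add_mono P M mult_right_mono A B) auto
    also have "\<dots> = C * ?N" by (simp add: C_def D_def algebra_simps)
    finally show ?thesis using h eq by blast
  qed
  then show ?thesis by blast
qed

section \<open>Green identities and the numerical range\<close>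

lemma h2_green:
  assumes "h2_representative U U1 U2" "h2_representative W W1 W2"
  shows "(LINT x|lborel. U2 x * W x) = - (LINT x|lborel. U1 x * W1 x)"
  using assms unfolding h2_representative_def by (intro integration_by_parts_l2) auto

lemma h2_representative_cnj:
  assumes "h2_representative U U1 U2"
  shows "h2_representative (\<lambda>x. cnj (U x)) (\<lambda>x. cnj (U1 x)) (\<lambda>x. cnj (U2 x))"
  using assms unfolding h2_representative_def by (auto intro: ac_deriv_cnj square_integrable_cnj)

text \<open>Pair the equation with \<open>U\<close> and rotate by \<open>c\<close>. The kinetic term contributes \<open>Re c\<close> times the squared
norm of \<open>U1\<close>, which is nonnegative, and the potential term contributes at least \<open>d\<close> times the
squared norm of \<open>U\<close>.\<close>

lemma numerical_range_bound:
  assumes h: "h2_representative U U1 U2" and c: "Re c \<ge> 0" "cmod c \<le> 1"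
    and d: "d \<le> Re (c * (Vp - z))" "d \<le> Re (c * (Vm - z))"
  shows "d * norm (abs_l2 U) \<le> norm (abs_l2 (\<lambda>x. - U2 x + (step_potential Vp Vm x - z) * U x))"
proof -
  note hu = h[unfolded h2_representative_def]
  define F where "F x = - U2 x + (step_potential Vp Vm x - z) * U x" for x
  define S where "S x = (step_potential Vp Vm x - z) * U x" for x
  have F: "square_integrable F" unfolding F_def by (rule square_integrable_schroedinger[OF h])
  have S: "square_integrable S"
  proof -
    have "S = (\<lambda>x. step_potential Vp Vm x * U x - z * U x)" by (rule ext) (simp add: S_def algebra_simps)
    then show ?thesis using hu by (auto intro!: square_integrable_diff square_integrable_step_potential square_integrable_scale)
  qed
  have cU: "square_integrable (\<lambda>x. cnj (U x))" using hu square_integrable_cnj by blast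
  have sq: "w * cnj w = complex_of_real ((cmod w)\<^sup>2)" for w by (simp only: complex_norm_square)
  have U1int: "(LINT x|lborel. U1 x * cnj (U1 x)) = complex_of_real (LINT x|lborel. (cmod (U1 x))\<^sup>2)"
    unfolding sq by (rule integral_complex_of_real)
  have "(LINT x|lborel. F x * cnj (U x)) = (LINT x|lborel. - (U2 x * cnj (U x)) + S x * cnj (U x))"
    by (simp add: F_def S_def algebra_simps)
  also have "\<dots> = - (LINT x|lborel. U2 x * cnj (U x)) + (LINT x|lborel. S x * cnj (U x))"
    using integrable_mult_l2[of U2 "\<lambda>x. cnj (U x)"] integrable_mult_l2[OF S cU] hu cU by simp
  also have "\<dots> = complex_of_real (LINT x|lborel. (cmod (U1 x))\<^sup>2) + (LINT x|lborel. S x * cnj (U x))"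
    using h2_green[OF h h2_representative_cnj[OF h]] U1int by simp
  finally have FU: "(LINT x|lborel. F x * cnj (U x)) = complex_of_real (LINT x|lborel. (cmod (U1 x))\<^sup>2) + (LINT x|lborel. S x * cnj (U x))" .
  have i: "integrable lborel (\<lambda>x. c * (S x * cnj (U x)))" using integrable_mult_l2[OF S cU] by simp
  have "d * (norm (abs_l2 U))\<^sup>2 = (LINT x|lborel. d * (cmod (U x))\<^sup>2)"
    using hu by (simp add: norm_abs_l2)
  also have "\<dots> \<le> (LINT x|lborel. Re (c * (S x * cnj (U x))))"
  proof (rule integral_mono)
    show "integrable lborel (\<lambda>x. d * (cmod (U x))\<^sup>2)" using hu by (simp add: square_integrable_def)
    show "integrable lborel (\<lambda>x. Re (c * (S x * cnj (U x))))" by (rule integrable_Re[OF i])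
    fix x
    have "c * (S x * cnj (U x)) = c * (step_potential Vp Vm x - z) * complex_of_real ((cmod (U x))\<^sup>2)"
      unfolding S_def by (simp only: sq[symmetric] mult.assoc)
    moreover have "Re (w * complex_of_real t) = Re w * t" for w t by simp
    ultimately have "Re (c * (S x * cnj (U x))) = Re (c * (step_potential Vp Vm x - z)) * (cmod (U x))\<^sup>2"
      by metis
    moreover have "d \<le> Re (c * (step_potential Vp Vm x - z))"
      using d by (auto simp: step_potential_def)
    ultimately show "d * (cmod (U x))\<^sup>2 \<le> Re (c * (S x * cnj (U x)))"
      by (simp add: mult_right_mono)
  qed
  also have "\<dots> = Re (c * (LINT x|lborel. S x * cnj (U x)))"
    using integral_Re[OF i] by simp
  also have "\<dots> \<le> Re (c * (LINT x|lborel. F x * cnj (U x)))"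
    unfolding FU distrib_left using c(1) by (simp del: of_real_power)
  also have "\<dots> \<le> cmod c * cmod (LINT x|lborel. F x * cnj (U x))"
    using complex_Re_le_cmod by (metis norm_mult)
  also have "\<dots> \<le> 1 * (norm (abs_l2 F) * norm (abs_l2 (\<lambda>x. cnj (U x))))"
    by (intro mult_mono c cauchy_schwarz_l2 F cU) auto
  also have "\<dots> = norm (abs_l2 F) * norm (abs_l2 U)"
    using hu by (simp add: norm_abs_l2_cnj)
  finally have "d * norm (abs_l2 U) * norm (abs_l2 U) \<le> norm (abs_l2 F) * norm (abs_l2 U)"
    by (simp add: power2_eq_square mult.assoc)
  then have "d * norm (abs_l2 U) \<le> norm (abs_l2 F)"
    by (cases "norm (abs_l2 U) = 0") (simp_all add: mult_le_cancel_right)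
  then show ?thesis by (simp add: F_def[abs_def])
qed

text \<open>The operator is symmetric for the bilinear pairing \<open>\<integral> U W\<close>. Hence a solution \<open>U\<close> of the homogeneous
equation is orthogonal to the range, and if \<open>cnj U\<close> lies in the range, then \<open>\<integral> U cnj U = 0\<close>. In this
way injectivity follows from solvability.\<close>

lemma schroedinger_homogeneous_solution_zero:
  assumes h: "h2_representative U U1 U2" and z: "AE x in lborel. - U2 x + (step_potential Vp Vm x - z) * U x = 0"
    and W: "h2_representative W W1 W2" "\<And>x. - W2 x + (step_potential Vp Vm x - z) * W x = cnj (U x)"
  shows "abs_l2 U = 0"
proof -
  note hu = h[unfolded h2_representative_def] and hw = W(1)[unfolded h2_representative_def]
  have [measurable]: "U \<in> borel_measurable borel" "W \<in> borel_measurable borel" "U2 \<in> borel_measurable borel"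
      "W2 \<in> borel_measurable borel"
    using hu hw square_integrable_measurable by auto
  have [measurable]: "step_potential Vp Vm \<in> borel_measurable borel"
    unfolding step_potential_def by measurable
  have i: "integrable lborel (\<lambda>x. U2 x * W x)" "integrable lborel (\<lambda>x. W2 x * U x)"
    using hu hw by (auto intro: integrable_mult_l2)
  have "(LINT x|lborel. U2 x * W x) = (LINT x|lborel. W2 x * U x)"
    using h2_green[OF h W(1)] h2_green[OF W(1) h] by (simp add: mult.commute)
  then have "(LINT x|lborel. U2 x * W x - W2 x * U x) = 0" using i by simp
  also have "(LINT x|lborel. U2 x * W x - W2 x * U x) = (LINT x|lborel. complex_of_real ((cmod (U x))\<^sup>2))"
  proof (rule integral_cong_AE)
    show "AE x in lborel. U2 x * W x - W2 x * U x = complex_of_real ((cmod (U x))\<^sup>2)"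
      using z
    proof eventually_elim
      fix x assume *: "- U2 x + (step_potential Vp Vm x - z) * U x = 0"
      \<comment> \<open>The potential terms cancel, leaving the equations for \<open>U\<close> and \<open>W\<close>.\<close>
      have "U2 x * W x - W2 x * U x = - (- U2 x + (step_potential Vp Vm x - z) * U x) * W x
          + (- W2 x + (step_potential Vp Vm x - z) * W x) * U x"
        by (simp add: algebra_simps)
      also have "\<dots> = cnj (U x) * U x" unfolding * W(2) by simp
      finally show "U2 x * W x - W2 x * U x = complex_of_real ((cmod (U x))\<^sup>2)"
        by (simp only: complex_norm_square mult.commute)
    qed
  qed measurable
  also have "\<dots> = complex_of_real (LINT x|lborel. (cmod (U x))\<^sup>2)" by (rule integral_complex_of_real)
  also have "\<dots> = complex_of_real ((norm (abs_l2 U))\<^sup>2)" using hu by (simp add: norm_abs_l2)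
  finally show ?thesis by simp
qed

section \<open>The resolvent set\<close>

text \<open>Each domain element is a test for a lower bound on the norm of the resolvent; all lower bounds below
come from this with an explicit \<open>u\<close>.\<close>

lemma norm_le_onorm_resolvent:
  assumes z: "z \<in> resolvent_set S" and u: "u \<in> fst S"
  shows "norm u \<le> onorm (resolvent S z) * norm (snd S u - z *\<^sub>C u)"
proof -
  have b: "bij_betw (\<lambda>u. snd S u - z *\<^sub>C u) (fst S) UNIV" and bl: "bounded_linear (resolvent S z)"
    using z by (auto simp: resolvent_set_def)
  have "resolvent S z (snd S u - z *\<^sub>C u) = u"
    unfolding resolvent_def using inv_into_f_f[OF bij_betw_imp_inj_on[OF b] u] by simp
  then show ?thesis using onorm[OF bl, of "snd S u - z *\<^sub>C u"] by simp
qed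

lemma onorm_resolvent_le:
  assumes z: "z \<in> resolvent_set S" and d: "d > 0"
    and lower: "\<And>u. u \<in> fst S \<Longrightarrow> d * norm u \<le> norm (snd S u - z *\<^sub>C u)"
  shows "onorm (resolvent S z) \<le> inverse d"
proof (rule onorm_bound)
  fix f
  have b: "bij_betw (\<lambda>u. snd S u - z *\<^sub>C u) (fst S) UNIV"
    using z by (auto simp: resolvent_set_def)
  then have f: "f \<in> (\<lambda>u. snd S u - z *\<^sub>C u) ` fst S" by (simp add: bij_betw_def)
  have "resolvent S z f \<in> fst S" unfolding resolvent_def by (rule inv_into_into[OF f])
  from lower[OF this] have "d * norm (resolvent S z f) \<le> norm f"
    unfolding resolvent_def f_inv_into_f[OF f] .
  then show "norm (resolvent S z f) \<le> inverse d * norm f"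
    using d by (simp add: field_simps)
qed (use d in simp)

lemma fst_schroedinger_step [simp]: "fst (schroedinger_step Vp Vm) = sobolev 2"
  by (simp add: schroedinger_step_def)

lemma h2_representative_lincomb:
  assumes "h2_representative U U1 U2" "h2_representative W W1 W2"
  shows "h2_representative (\<lambda>x. U x + c * W x) (\<lambda>x. U1 x + c * W1 x) (\<lambda>x. U2 x + c * W2 x)"
  using assms unfolding h2_representative_def
  by (auto intro!: square_integrable_add square_integrable_scale ac_deriv_add ac_deriv_cmult)

lemma schroedinger_lincomb:
  assumes u: "u \<in> sobolev 2" and v: "v \<in> sobolev 2"
  shows "u + r *\<^sub>R v \<in> sobolev 2"
    "snd (schroedinger_step Vp Vm) (u + r *\<^sub>R v) - z *\<^sub>C (u + r *\<^sub>R v) =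
      (snd (schroedinger_step Vp Vm) u - z *\<^sub>C u) + r *\<^sub>R (snd (schroedinger_step Vp Vm) v - z *\<^sub>C v)"
proof -
  obtain U U1 U2 where U: "h2_representative U U1 U2" "u = abs_l2 U"
    using u by (rule sobolev_imp_h2_representative)
  obtain W W1 W2 where W: "h2_representative W W1 W2" "v = abs_l2 W"
    using v by (rule sobolev_imp_h2_representative)
  note s = U(1)[unfolded h2_representative_def] W(1)[unfolded h2_representative_def]
  have eq: "u + r *\<^sub>R v = abs_l2 (\<lambda>x. U x + complex_of_real r * W x)"
    using s by (simp add: U W scaleC_of_real[symmetric] abs_l2_scaleC abs_l2_add square_integrable_scale)
  note h = h2_representative_lincomb[OF U(1) W(1), of "complex_of_real r"]
  show "u + r *\<^sub>R v \<in> sobolev 2" unfolding eq by (rule h2_representative_sobolev(1)[OF h])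
  define FU where "FU x = - U2 x + (step_potential Vp Vm x - z) * U x" for x
  define FW where "FW x = - W2 x + (step_potential Vp Vm x - z) * W x" for x
  have F: "square_integrable FU" "square_integrable FW"
    unfolding FU_def FW_def by (rule square_integrable_schroedinger[OF U(1)] square_integrable_schroedinger[OF W(1)])+
  have "snd (schroedinger_step Vp Vm) (u + r *\<^sub>R v) - z *\<^sub>C (u + r *\<^sub>R v) =
      abs_l2 (\<lambda>x. - (U2 x + complex_of_real r * W2 x) + (step_potential Vp Vm x - z) * (U x + complex_of_real r * W x))"
    unfolding eq by (rule schroedinger_step_h2[OF h])
  also have "\<dots> = abs_l2 (\<lambda>x. FU x + complex_of_real r * FW x)"
    by (simp add: FU_def FW_def algebra_simps)
  also have "\<dots> = abs_l2 FU + r *\<^sub>R abs_l2 FW"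
    by (simp add: scaleC_of_real[symmetric] abs_l2_scaleC abs_l2_add square_integrable_scale F)
  also have "\<dots> = (snd (schroedinger_step Vp Vm) u - z *\<^sub>C u) + r *\<^sub>R (snd (schroedinger_step Vp Vm) v - z *\<^sub>C v)"
    by (simp only: schroedinger_step_h2[OF U(1)] schroedinger_step_h2[OF W(1)] U(2) W(2) FU_def[abs_def] FW_def[abs_def])
  finally show "snd (schroedinger_step Vp Vm) (u + r *\<^sub>R v) - z *\<^sub>C (u + r *\<^sub>R v) =
      (snd (schroedinger_step Vp Vm) u - z *\<^sub>C u) + r *\<^sub>R (snd (schroedinger_step Vp Vm) v - z *\<^sub>C v)" .
qed

definition half_line :: "complex \<Rightarrow> complex set" where
  "half_line V = {z. Im z = Im V \<and> Re V \<le> Re z}"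

text \<open>The principal root has nonnegative real part, and a purely imaginary root would make \<open>V - z\<close> a
nonpositive real number.\<close>

lemma decaying_root_exists:
  assumes "z \<notin> half_line V"
  shows "\<exists>k. Re k > 0 \<and> k\<^sup>2 = V - z"
proof -
  define k where "k = csqrt (V - z)"
  have k2: "k\<^sup>2 = V - z" by (simp add: k_def)
  have "Re k \<noteq> 0"
  proof
    assume 0: "Re k = 0"
    have "Re (V - z) = - (Im k)\<^sup>2" "Im (V - z) = 0"
      unfolding k2[symmetric] using 0 by (simp_all add: power2_eq_square)
    moreover have "(Im k)\<^sup>2 \<ge> 0" by simp
    ultimately have "Im z = Im V" "Re V \<le> Re z" unfolding minus_complex.sel by linarith+
    then show False using assms by (simp add: half_line_def)
  qed
  moreover have "Re k \<ge> 0" unfolding k_def by (rule Re_csqrt)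
  ultimately show ?thesis using k2 by (intro exI[of _ k]) simp
qed

text \<open>Solvability with a norm bound gives surjectivity and boundedness of the inverse; the bilinear
symmetry gives injectivity.\<close>

lemma resolvent_set_schroedinger_step:
  assumes "z \<notin> half_line Vp" "z \<notin> half_line Vm"
  shows "z \<in> resolvent_set (schroedinger_step Vp Vm)"
proof -
  define A where "A u = snd (schroedinger_step Vp Vm) u - z *\<^sub>C u" for u
  obtain kp km where k: "Re kp > 0" "kp\<^sup>2 = Vp - z" "Re km > 0" "km\<^sup>2 = Vm - z"
    using decaying_root_exists[OF assms(1)] decaying_root_exists[OF assms(2)] by blast
  obtain C where C: "\<And>f. square_integrable f \<Longrightarrow> \<exists>U U1 U2. h2_representative U U1 U2 \<and>
    (\<forall>x. - U2 x + (step_potential Vp Vm x - z) * U x = f x) \<and> norm (abs_l2 U) \<le> C * norm (abs_l2 f)"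
    using schroedinger_solution_exists[OF k] by blast
  have solve: "\<exists>u\<in>sobolev 2. A u = g \<and> norm u \<le> C * norm g" for g
  proof -
    obtain f where f: "square_integrable f" "g = abs_l2 f" by (rule l2_cases)
    obtain U U1 U2 where U: "h2_representative U U1 U2"
      "\<And>x. - U2 x + (step_potential Vp Vm x - z) * U x = f x" "norm (abs_l2 U) \<le> C * norm (abs_l2 f)"
      using C[OF f(1)] by blast
    show ?thesis
      using h2_representative_sobolev(1)[OF U(1)] schroedinger_step_h2[OF U(1), of Vp Vm z] U(2,3)
      by (intro bexI[of _ "abs_l2 U"]) (simp_all add: A_def f(2))
  qed
  have ker: "u = 0" if u: "u \<in> sobolev 2" and 0: "A u = 0" for u
  proof -
    obtain U U1 U2 where U: "h2_representative U U1 U2" "u = abs_l2 U"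
      using u by (rule sobolev_imp_h2_representative)
    have F: "square_integrable (\<lambda>x. - U2 x + (step_potential Vp Vm x - z) * U x)"
      by (rule square_integrable_schroedinger[OF U(1)])
    have "(norm (abs_l2 (\<lambda>x. - U2 x + (step_potential Vp Vm x - z) * U x)))\<^sup>2 = 0"
      using 0 schroedinger_step_h2[OF U(1), of Vp Vm z] by (simp add: A_def U(2))
    then have "(LINT x|lborel. (cmod (- U2 x + (step_potential Vp Vm x - z) * U x))\<^sup>2) = 0"
      by (simp only: norm_abs_l2[OF F])
    then have "AE x in lborel. (cmod (- U2 x + (step_potential Vp Vm x - z) * U x))\<^sup>2 = 0"
      using F by (subst (asm) integral_nonneg_eq_0_iff_AE) (auto simp: square_integrable_def)
    then have ae: "AE x in lborel. - U2 x + (step_potential Vp Vm x - z) * U x = 0"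
      by eventually_elim simp
    have "square_integrable (\<lambda>x. cnj (U x))"
      using U(1) by (auto simp: h2_representative_def intro: square_integrable_cnj)
    then obtain W W1 W2 where "h2_representative W W1 W2"
      "\<And>x. - W2 x + (step_potential Vp Vm x - z) * W x = cnj (U x)"
      using C by blast
    then show ?thesis unfolding U(2) by (rule schroedinger_homogeneous_solution_zero[OF U(1) ae])
  qed
  have inj: "inj_on A (sobolev 2)"
  proof (rule inj_onI)
    fix u v assume uv: "u \<in> sobolev 2" "v \<in> sobolev 2" "A u = A v"
    have "A (u + (-1) *\<^sub>R v) = A u + (-1) *\<^sub>R A v" "u + (-1) *\<^sub>R v \<in> sobolev 2"
      unfolding A_def by (rule schroedinger_lincomb[OF uv(1,2)])+
    then show "u = v" using ker[of "u + (-1) *\<^sub>R v"] uv(3) by simp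
  qed
  have bij: "bij_betw A (sobolev 2) UNIV"
    unfolding bij_betw_def using inj solve by (auto simp: image_iff) metis
  define R where "R = resolvent (schroedinger_step Vp Vm) z"
  have Rinv: "R g = u" if "u \<in> sobolev 2" "A u = g" for u g
    using inv_into_f_f[OF inj that(1)] that(2) by (simp add: R_def resolvent_def A_def[abs_def])
  have RA: "R g \<in> sobolev 2" "A (R g) = g" "norm (R g) \<le> C * norm g" for g
    using solve[of g] Rinv by auto
  have "bounded_linear R"
  proof (rule bounded_linear_intro)
    have lin: "R (f + r *\<^sub>R g) = R f + r *\<^sub>R R g" for f g r
      using schroedinger_lincomb(1)[OF RA(1)[of f] RA(1)[of g], of r]
        schroedinger_lincomb(2)[OF RA(1)[of f] RA(1)[of g], of Vp Vm r z] RA(2)[of f] RA(2)[of g]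
      by (intro Rinv) (simp_all add: A_def)
    show "R (f + g) = R f + R g" for f g using lin[of f 1 g] by simp
    show "R (r *\<^sub>R g) = r *\<^sub>R R g" for r g
    proof -
      have "R 0 = 0" using lin[of 0 1 0] by simp
      then show ?thesis using lin[of 0 r g] by simp
    qed
    show "norm (R g) \<le> norm g * C" for g using RA(3)[of g] by (simp add: mult.commute)
  qed
  then show ?thesis
    using bij by (simp add: resolvent_set_def R_def A_def[abs_def])
qed

section \<open>Quasimodes and the spectrum\<close>

text \<open>A supply of explicit domain elements: two decaying exponentials on each half-line whose values and
slopes agree at the origin. The operator acts on each exponential as a scalar.\<close>

lemma two_exponential_state:
  fixes Vp Vm z :: complex
  assumes p: "Re p1 > 0" "Re p2 > 0" and q: "Re q1 > 0" "Re q2 > 0"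
    and match: "a1 + a2 = b1 + b2" "- (p1 * a1 + p2 * a2) = q1 * b1 + q2 * b2"
  defines "u \<equiv> a1 *\<^sub>C abs_l2 (exp_right p1) + a2 *\<^sub>C abs_l2 (exp_right p2)
    + b1 *\<^sub>C abs_l2 (exp_left q1) + b2 *\<^sub>C abs_l2 (exp_left q2)"
  shows "u \<in> sobolev 2"
    "snd (schroedinger_step Vp Vm) u - z *\<^sub>C u =
      ((Vp - z - p1\<^sup>2) * a1) *\<^sub>C abs_l2 (exp_right p1) + ((Vp - z - p2\<^sup>2) * a2) *\<^sub>C abs_l2 (exp_right p2)
      + ((Vm - z - q1\<^sup>2) * b1) *\<^sub>C abs_l2 (exp_left q1) + ((Vm - z - q2\<^sup>2) * b2) *\<^sub>C abs_l2 (exp_left q2)"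
proof -
  define E where "E c1 c2 d1 d2 x = c1 * exp_right p1 x + c2 * exp_right p2 x + d1 * exp_left q1 x + d2 * exp_left q2 x"
    for c1 c2 d1 d2 x
  note L = exp_right_norm(1)[OF p(1)] exp_right_norm(1)[OF p(2)] exp_left_norm(1)[OF q(1)] exp_left_norm(1)[OF q(2)]
  have EL: "square_integrable (E c1 c2 d1 d2)" for c1 c2 d1 d2
    unfolding E_def[abs_def] by (intro square_integrable_add square_integrable_scale L)
  have Eabs: "abs_l2 (E c1 c2 d1 d2) = c1 *\<^sub>C abs_l2 (exp_right p1) + c2 *\<^sub>C abs_l2 (exp_right p2)
      + d1 *\<^sub>C abs_l2 (exp_left q1) + d2 *\<^sub>C abs_l2 (exp_left q2)" for c1 c2 d1 d2
    unfolding E_def[abs_def] by (simp add: L abs_l2_add abs_l2_scaleC square_integrable_add square_integrable_scale)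
  have Epaste: "E c1 c2 d1 d2 = paste (\<lambda>x. c1 * exp (- p1 * complex_of_real x) + c2 * exp (- p2 * complex_of_real x))
      (\<lambda>x. d1 * exp (q1 * complex_of_real x) + d2 * exp (q2 * complex_of_real x))" for c1 c2 d1 d2
    by (rule ext) (simp add: E_def paste_def exp_right_def exp_left_def)
  have h: "h2_representative (E a1 a2 b1 b2) (E (- p1 * a1) (- p2 * a2) (q1 * b1) (q2 * b2))
      (E (- p1 * (- p1 * a1)) (- p2 * (- p2 * a2)) (q1 * (q1 * b1)) (q2 * (q2 * b2)))"
    using EL[of a1 a2 b1 b2] EL[of "- p1 * a1" "- p2 * a2" "q1 * b1" "q2 * b2"]
      EL[of "- p1 * (- p1 * a1)" "- p2 * (- p2 * a2)" "q1 * (q1 * b1)" "q2 * (q2 * b2)"]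
    unfolding Epaste
    by (intro h2_representative_paste[OF ac_deriv_add[OF ac_deriv_exp_cmult ac_deriv_exp_cmult]
          ac_deriv_add[OF ac_deriv_exp_cmult ac_deriv_exp_cmult] ac_deriv_add[OF ac_deriv_exp_cmult ac_deriv_exp_cmult]
          ac_deriv_add[OF ac_deriv_exp_cmult ac_deriv_exp_cmult]]) (use match in simp_all)
  have u: "u = abs_l2 (E a1 a2 b1 b2)" by (simp add: u_def Eabs)
  show "u \<in> sobolev 2" unfolding u by (rule h2_representative_sobolev(1)[OF h])
  have "(\<lambda>x. - E (- p1 * (- p1 * a1)) (- p2 * (- p2 * a2)) (q1 * (q1 * b1)) (q2 * (q2 * b2)) x
      + (step_potential Vp Vm x - z) * E a1 a2 b1 b2 x)
      = E ((Vp - z - p1\<^sup>2) * a1) ((Vp - z - p2\<^sup>2) * a2) ((Vm - z - q1\<^sup>2) * b1) ((Vm - z - q2\<^sup>2) * b2)"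
    by (rule ext) (simp add: E_def step_potential_def exp_right_def exp_left_def power2_eq_square algebra_simps)
  then show "snd (schroedinger_step Vp Vm) u - z *\<^sub>C u =
      ((Vp - z - p1\<^sup>2) * a1) *\<^sub>C abs_l2 (exp_right p1) + ((Vp - z - p2\<^sup>2) * a2) *\<^sub>C abs_l2 (exp_right p2)
      + ((Vm - z - q1\<^sup>2) * b1) *\<^sub>C abs_l2 (exp_left q1) + ((Vm - z - q2\<^sup>2) * b2) *\<^sub>C abs_l2 (exp_left q2)"
    unfolding u schroedinger_step_h2[OF h] by (simp only: Eabs)
qed

text \<open>Multiplying by \<open>sqrt (2 * \<delta>)\<close> and letting \<open>\<delta>\<close> tend to \<open>0\<close> removes the errors \<open>K1\<close> and \<open>K2\<close>, which
stay bounded while the norm \<open>1 / sqrt (2 * \<delta>)\<close> of the slowly decaying exponential blows up.\<close>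

lemma quasimode_limit:
  fixes d K1 K2 N \<xi> :: real
  assumes "\<And>\<delta>. 0 < \<delta> \<Longrightarrow> \<delta> \<le> 1 \<Longrightarrow>
    1 / sqrt (2 * \<delta>) - K1 \<le> N * ((d + \<delta>\<^sup>2 + 2 * \<delta> * \<xi>) * (1 / sqrt (2 * \<delta>)) + K2)"
  shows "1 \<le> N * d"
proof (rule tendsto_le)
  show "\<forall>\<^sub>F \<delta> in at_right 0. 1 - K1 * sqrt (2 * \<delta>) \<le> N * ((d + \<delta>\<^sup>2 + 2 * \<delta> * \<xi>) + K2 * sqrt (2 * \<delta>))"
    using eventually_at_right_less[of "0::real"] eventually_at_right_real[of 0 "1::real", OF zero_less_one]
  proof eventually_elim
    fix \<delta> :: real assume "0 < \<delta>" "\<delta> \<in> {0<..<1}"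
    define s where "s = sqrt (2 * \<delta>)"
    have s: "s > 0" using \<open>0 < \<delta>\<close> by (simp add: s_def)
    have "(1 / s - K1) * s \<le> (N * ((d + \<delta>\<^sup>2 + 2 * \<delta> * \<xi>) * (1 / s) + K2)) * s"
      using assms[of \<delta>] \<open>\<delta> \<in> {0<..<1}\<close> s by (intro mult_right_mono) (auto simp: s_def)
    also have "\<dots> = N * ((d + \<delta>\<^sup>2 + 2 * \<delta> * \<xi>) + K2 * s)"
    proof -
      have "(e * (1 / s) + K2) * s = e + K2 * s" for e using s by (simp add: distrib_right)
      then show ?thesis by (simp only: mult.assoc)
    qed
    also have "(1 / s - K1) * s = 1 - K1 * s" using s by (simp add: left_diff_distrib)
    finally show "1 - K1 * sqrt (2 * \<delta>) \<le> N * ((d + \<delta>\<^sup>2 + 2 * \<delta> * \<xi>) + K2 * sqrt (2 * \<delta>))"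
      by (simp only: s_def)
  qed
  have "((\<lambda>\<delta>. 1 - K1 * sqrt (2 * \<delta>)) \<longlongrightarrow> 1 - K1 * sqrt (2 * 0)) (at_right 0)"
    by (intro tendsto_intros)
  then show "((\<lambda>\<delta>. 1 - K1 * sqrt (2 * \<delta>)) \<longlongrightarrow> 1) (at_right 0)" by simp
  have "((\<lambda>\<delta>. N * ((d + \<delta>\<^sup>2 + 2 * \<delta> * \<xi>) + K2 * sqrt (2 * \<delta>))) \<longlongrightarrow>
      N * ((d + 0\<^sup>2 + 2 * 0 * \<xi>) + K2 * sqrt (2 * 0))) (at_right 0)"
    by (intro tendsto_intros)
  then show "((\<lambda>\<delta>. N * ((d + \<delta>\<^sup>2 + 2 * \<delta> * \<xi>) + K2 * sqrt (2 * \<delta>))) \<longlongrightarrow> N * d) (at_right 0)" by simp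
qed simp

lemma norm_exp_right: "Re p > 0 \<Longrightarrow> norm (abs_l2 (exp_right p)) = 1 / sqrt (2 * Re p)"
  using real_sqrt_unique[OF exp_right_norm(2)] by (simp add: real_sqrt_divide)

lemma norm_exp_left: "Re q > 0 \<Longrightarrow> norm (abs_l2 (exp_left q)) = 1 / sqrt (2 * Re q)"
  using real_sqrt_unique[OF exp_left_norm(2)] by (simp add: real_sqrt_divide)

text \<open>The exponential of rate \<open>p\<close> is a plane wave of frequency \<open>\<xi>\<close>, damped at rate \<open>\<delta>\<close>; damping perturbs
the energy \<open>V + \<xi>\<^sup>2\<close> by \<open>- \<delta>\<^sup>2 + 2 \<i> \<delta> \<xi>\<close>.\<close>

lemma quasimode_shift:
  assumes "0 < \<delta>" "\<xi> \<ge> 0"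
  defines "p \<equiv> Complex \<delta> (- \<xi>)"
  shows "cmod (V - z - p\<^sup>2) \<le> cmod (V + complex_of_real (\<xi>\<^sup>2) - z) + \<delta>\<^sup>2 + 2 * \<delta> * \<xi>"
    "\<delta> \<le> 1 \<Longrightarrow> cmod p \<le> 1 + \<xi>"
proof -
  have "V - z - p\<^sup>2 = (V + complex_of_real (\<xi>\<^sup>2) - z) + (complex_of_real (- (\<delta>\<^sup>2)) + \<i> * complex_of_real (2 * \<delta> * \<xi>))"
    by (simp add: p_def complex_eq_iff power2_eq_square)
  also have "cmod \<dots> \<le> cmod (V + complex_of_real (\<xi>\<^sup>2) - z) + (\<delta>\<^sup>2 + 2 * \<delta> * \<xi>)"
  proof (intro norm_triangle_le add_left_mono)
    show "cmod (complex_of_real (- (\<delta>\<^sup>2))) + cmod (\<i> * complex_of_real (2 * \<delta> * \<xi>)) \<le> \<delta>\<^sup>2 + 2 * \<delta> * \<xi>"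
      unfolding norm_mult norm_of_real using assms by (simp add: abs_mult)
  qed
  finally show "cmod (V - z - p\<^sup>2) \<le> cmod (V + complex_of_real (\<xi>\<^sup>2) - z) + \<delta>\<^sup>2 + 2 * \<delta> * \<xi>" by simp
  show "\<delta> \<le> 1 \<Longrightarrow> cmod p \<le> 1 + \<xi>"
    using cmod_le[of p] assms by (simp add: p_def)
qed

lemma norm_diff_diff_le: "norm (x - y - w) \<le> norm x + norm y + norm w"
  for x y w :: "'a::real_normed_vector"
  using norm_triangle_ineq4[of "x - y" w] norm_triangle_ineq4[of x y] by linarith

text \<open>A long wave \<open>e\<close> on one half-line is continued to the other by \<open>(2 + p) g1 + (- p - 1) g2\<close>, with \<open>g1\<close>
and \<open>g2\<close> exponentials of rates \<open>1\<close> and \<open>2\<close>: these are the coefficients for which value and slope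
match. The continuation has norm bounded uniformly in \<open>p\<close>, so it only perturbs the estimate by
constants.\<close>

lemma matched_quasimode_estimate:
  fixes e g1 g2 u F :: "'a::complex_normed_vector"
  assumes u: "u = e + (2 + p) *\<^sub>C g1 + (- p - 1) *\<^sub>C g2"
    and F: "F = s *\<^sub>C e + (c1 * (2 + p)) *\<^sub>C g1 + (c2 * (- p - 1)) *\<^sub>C g2"
    and p: "cmod p \<le> 1 + \<xi>" and s: "cmod s \<le> t" and le: "norm u \<le> N * norm F" and N: "N \<ge> 0"
  defines "G1 \<equiv> (3 + \<xi>) * norm g1" and "G2 \<equiv> (2 + \<xi>) * norm g2"
  shows "norm e - (G1 + G2) \<le> N * (t * norm e + (cmod c1 * G1 + cmod c2 * G2))"
proof -
  have a1: "cmod (2 + p) \<le> 3 + \<xi>" using norm_triangle_ineq[of 2 p] p by simp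
  have a2: "cmod (- p - 1) \<le> 2 + \<xi>" using norm_triangle_ineq4[of "- p" 1] p by simp
  have b1: "norm ((2 + p) *\<^sub>C g1) \<le> G1" unfolding G1_def norm_scaleC by (intro mult_right_mono a1) simp
  have b2: "norm ((- p - 1) *\<^sub>C g2) \<le> G2" unfolding G2_def norm_scaleC by (intro mult_right_mono a2) simp
  have "e = u - (2 + p) *\<^sub>C g1 - (- p - 1) *\<^sub>C g2" by (simp add: u)
  then have "norm e \<le> norm u + norm ((2 + p) *\<^sub>C g1) + norm ((- p - 1) *\<^sub>C g2)"
    by (simp only: norm_diff_diff_le)
  then have 1: "norm e - (G1 + G2) \<le> norm u" using b1 b2 by simp
  have "norm F \<le> norm (s *\<^sub>C e) + norm ((c1 * (2 + p)) *\<^sub>C g1) + norm ((c2 * (- p - 1)) *\<^sub>C g2)"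
    unfolding F by (intro norm_triangle_le add_right_mono norm_triangle_ineq)
  also have "\<dots> = cmod s * norm e + cmod c1 * norm ((2 + p) *\<^sub>C g1) + cmod c2 * norm ((- p - 1) *\<^sub>C g2)"
    by (simp add: norm_scaleC norm_mult mult.assoc)
  also have "\<dots> \<le> t * norm e + cmod c1 * G1 + cmod c2 * G2"
    by (intro add_mono mult_right_mono mult_left_mono s b1 b2) auto
  finally have "N * norm F \<le> N * (t * norm e + (cmod c1 * G1 + cmod c2 * G2))"
    using N by (intro mult_left_mono) auto
  then show ?thesis using 1 le by linarith
qed

lemma scaleC_one: "1 *\<^sub>C x = (x :: 'a::complex_normed_vector)"
  using scaleC_of_real[of 1 x] by simp

lemma scaleC_zero: "0 *\<^sub>C x = (0 :: 'a::complex_normed_vector)"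
  using scaleC_of_real[of 0 x] by simp

text \<open>A point \<open>l\<close> of either half-line is an approximate eigenvalue. The damped plane wave on the
corresponding side of the origin, continued to the other side by a fixed profile, is almost an
eigenvector, so \<open>L - z\<close> stretches it by at most \<open>\<bar>l - z\<bar>\<close> in the limit of weak damping.\<close>

lemma onorm_resolvent_ge_inverse_distance:
  assumes z: "z \<in> resolvent_set (schroedinger_step Vp Vm)" and l: "l \<in> half_line Vp \<union> half_line Vm"
  shows "1 \<le> onorm (resolvent (schroedinger_step Vp Vm) z) * cmod (l - z)"
proof -
  let ?L = "schroedinger_step Vp Vm"
  define N where "N = onorm (resolvent ?L z)"
  have N: "N \<ge> 0" unfolding N_def using z by (intro onorm_pos_le) (simp add: resolvent_set_def)
  have le: "norm u \<le> N * norm (snd ?L u - z *\<^sub>C u)" if "u \<in> sobolev 2" for u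
    using norm_le_onorm_resolvent[OF z] that by (simp add: N_def)
  consider (right) "l \<in> half_line Vp" | (left) "l \<in> half_line Vm" using l by blast
  then have "1 \<le> N * cmod (l - z)"
  proof cases
    case right
    define \<xi> where "\<xi> = sqrt (Re l - Re Vp)"
    have \<xi>: "\<xi> \<ge> 0" and lam: "l = Vp + complex_of_real (\<xi>\<^sup>2)"
      using right by (auto simp: \<xi>_def half_line_def complex_eq_iff)
    show ?thesis
    proof (rule quasimode_limit)
      fix \<delta> :: real assume \<delta>: "0 < \<delta>" "\<delta> \<le> 1"
      \<comment> \<open>A wave of frequency \<open>\<xi>\<close> with \<open>l = V + \<xi>\<^sup>2\<close>.\<close>
      define p where "p = Complex \<delta> (- \<xi>)"
      have p: "Re p = \<delta>" "Re p > 0" using \<delta> by (simp_all add: p_def)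
      note s = quasimode_shift[OF \<delta>(1) \<xi>, folded p_def]
      define u where "u = 1 *\<^sub>C abs_l2 (exp_right p) + 0 *\<^sub>C abs_l2 (exp_right 1)
          + (2 + p) *\<^sub>C abs_l2 (exp_left 1) + (- p - 1) *\<^sub>C abs_l2 (exp_left 2)"
      have u: "u \<in> sobolev 2" "snd ?L u - z *\<^sub>C u = ((Vp - z - p\<^sup>2) * 1) *\<^sub>C abs_l2 (exp_right p)
          + ((Vp - z - 1\<^sup>2) * 0) *\<^sub>C abs_l2 (exp_right 1)
          + ((Vm - z - 1\<^sup>2) * (2 + p)) *\<^sub>C abs_l2 (exp_left 1) + ((Vm - z - 2\<^sup>2) * (- p - 1)) *\<^sub>C abs_l2 (exp_left 2)"
        unfolding u_def by (rule two_exponential_state; use p in \<open>simp add: algebra_simps\<close>)+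
      show "1 / sqrt (2 * \<delta>) - ((3 + \<xi>) * norm (abs_l2 (exp_left 1)) + (2 + \<xi>) * norm (abs_l2 (exp_left 2)))
          \<le> N * ((cmod (l - z) + \<delta>\<^sup>2 + 2 * \<delta> * \<xi>) * (1 / sqrt (2 * \<delta>))
          + (cmod (Vm - z - 1\<^sup>2) * ((3 + \<xi>) * norm (abs_l2 (exp_left 1)))
            + cmod (Vm - z - 2\<^sup>2) * ((2 + \<xi>) * norm (abs_l2 (exp_left 2)))))"
        unfolding p(1)[symmetric] norm_exp_right[OF p(2), symmetric]
      proof (rule matched_quasimode_estimate[OF _ _ s(2)[OF \<delta>(2)] _ le[OF u(1)] N])
        show "u = abs_l2 (exp_right p) + (2 + p) *\<^sub>C abs_l2 (exp_left 1) + (- p - 1) *\<^sub>C abs_l2 (exp_left 2)"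
          by (simp add: u_def scaleC_one scaleC_zero)
        show "snd ?L u - z *\<^sub>C u = (Vp - z - p\<^sup>2) *\<^sub>C abs_l2 (exp_right p)
            + ((Vm - z - 1\<^sup>2) * (2 + p)) *\<^sub>C abs_l2 (exp_left 1) + ((Vm - z - 2\<^sup>2) * (- p - 1)) *\<^sub>C abs_l2 (exp_left 2)"
          unfolding u(2) by (simp add: scaleC_zero)
        show "cmod (Vp - z - p\<^sup>2) \<le> cmod (l - z) + (Re p)\<^sup>2 + 2 * Re p * \<xi>"
          using s(1)[of Vp z] by (simp add: lam p(1))
      qed
    qed
  next
    case left
    define \<xi> where "\<xi> = sqrt (Re l - Re Vm)"
    have \<xi>: "\<xi> \<ge> 0" and lam: "l = Vm + complex_of_real (\<xi>\<^sup>2)"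
      using left by (auto simp: \<xi>_def half_line_def complex_eq_iff)
    show ?thesis
    proof (rule quasimode_limit)
      fix \<delta> :: real assume \<delta>: "0 < \<delta>" "\<delta> \<le> 1"
      define p where "p = Complex \<delta> (- \<xi>)"
      have p: "Re p = \<delta>" "Re p > 0" using \<delta> by (simp_all add: p_def)
      note s = quasimode_shift[OF \<delta>(1) \<xi>, folded p_def]
      define u where "u = (2 + p) *\<^sub>C abs_l2 (exp_right 1) + (- p - 1) *\<^sub>C abs_l2 (exp_right 2)
          + 1 *\<^sub>C abs_l2 (exp_left p) + 0 *\<^sub>C abs_l2 (exp_left 1)"
      have u: "u \<in> sobolev 2" "snd ?L u - z *\<^sub>C u = ((Vp - z - 1\<^sup>2) * (2 + p)) *\<^sub>C abs_l2 (exp_right 1)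
          + ((Vp - z - 2\<^sup>2) * (- p - 1)) *\<^sub>C abs_l2 (exp_right 2)
          + ((Vm - z - p\<^sup>2) * 1) *\<^sub>C abs_l2 (exp_left p) + ((Vm - z - 1\<^sup>2) * 0) *\<^sub>C abs_l2 (exp_left 1)"
        unfolding u_def by (rule two_exponential_state; use p in \<open>simp add: algebra_simps\<close>)+
      show "1 / sqrt (2 * \<delta>) - ((3 + \<xi>) * norm (abs_l2 (exp_right 1)) + (2 + \<xi>) * norm (abs_l2 (exp_right 2)))
          \<le> N * ((cmod (l - z) + \<delta>\<^sup>2 + 2 * \<delta> * \<xi>) * (1 / sqrt (2 * \<delta>))
          + (cmod (Vp - z - 1\<^sup>2) * ((3 + \<xi>) * norm (abs_l2 (exp_right 1)))
            + cmod (Vp - z - 2\<^sup>2) * ((2 + \<xi>) * norm (abs_l2 (exp_right 2)))))"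
        unfolding p(1)[symmetric] norm_exp_left[OF p(2), symmetric]
      proof (rule matched_quasimode_estimate[OF _ _ s(2)[OF \<delta>(2)] _ le[OF u(1)] N])
        show "u = abs_l2 (exp_left p) + (2 + p) *\<^sub>C abs_l2 (exp_right 1) + (- p - 1) *\<^sub>C abs_l2 (exp_right 2)"
          by (simp add: u_def scaleC_one scaleC_zero)
        show "snd ?L u - z *\<^sub>C u = (Vm - z - p\<^sup>2) *\<^sub>C abs_l2 (exp_left p)
            + ((Vp - z - 1\<^sup>2) * (2 + p)) *\<^sub>C abs_l2 (exp_right 1) + ((Vp - z - 2\<^sup>2) * (- p - 1)) *\<^sub>C abs_l2 (exp_right 2)"
          unfolding u(2) by (simp add: scaleC_zero)
        show "cmod (Vm - z - p\<^sup>2) \<le> cmod (l - z) + (Re p)\<^sup>2 + 2 * Re p * \<xi>"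
          using s(1)[of Vm z] by (simp add: lam p(1))
      qed
    qed
  qed
  then show ?thesis by (simp add: N_def)
qed

text \<open>On a half-line the inequality \<open>1 \<le> onorm R * \<bar>l - z\<bar>\<close> with \<open>l = z\<close> is absurd; off the half-lines the
resolvent exists.\<close>

lemma spectrum_schroedinger_step:
  "spectrum (schroedinger_step Vp Vm) = half_line Vp \<union> half_line Vm"
proof (intro equalityI subsetI)
  fix z assume "z \<in> spectrum (schroedinger_step Vp Vm)"
  then show "z \<in> half_line Vp \<union> half_line Vm"
    using resolvent_set_schroedinger_step[of z Vp Vm] by (auto simp: spectrum_def)
next
  fix z assume z: "z \<in> half_line Vp \<union> half_line Vm"
  show "z \<in> spectrum (schroedinger_step Vp Vm)"
  proof (rule ccontr)
    assume "z \<notin> spectrum (schroedinger_step Vp Vm)"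
    then have "z \<in> resolvent_set (schroedinger_step Vp Vm)" by (simp add: spectrum_def)
    from onorm_resolvent_ge_inverse_distance[OF this z] show False by simp
  qed
qed

section \<open>Growth of the resolvent in the strip\<close>

text \<open>The two halves have disjoint supports, so their squared norms add.\<close>

lemma norm_exp_pair:
  assumes "Re p > 0" "Re q > 0"
  shows "(norm (abs_l2 (exp_right p) + abs_l2 (exp_left q)))\<^sup>2 = 1 / (2 * Re p) + 1 / (2 * Re q)"
proof -
  have "inner (exp_right p x) (exp_left q x) = 0" for x
    by (simp add: exp_right_def exp_left_def)
  then have "inner (abs_l2 (exp_right p)) (abs_l2 (exp_left q)) = 0"
    by (simp add: abs_l2_inner exp_right_norm exp_left_norm assms)
  then show ?thesis
    using exp_right_norm(2)[OF assms(1)] exp_left_norm(2)[OF assms(2)]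
    by (simp add: power2_norm_eq_inner inner_add_left inner_add_right inner_commute)
qed

lemma conjugate_root_identities:
  fixes k :: complex
  assumes k: "Re k > 0" and im: "Im (k\<^sup>2) \<noteq> 0"
  shows "(k\<^sup>2 - (cnj k)\<^sup>2) * (1 / (2 * \<i> * complex_of_real (Im (k\<^sup>2)))) = 1"
    "(k - cnj k) * (1 / (2 * \<i> * complex_of_real (Im (k\<^sup>2)))) = complex_of_real (1 / (2 * Re k))"
proof -
  have im2: "Im (k\<^sup>2) = 2 * Re k * Im k" by (simp add: power2_eq_square)
  have d: "k - cnj k = 2 * \<i> * complex_of_real (Im k)" by (simp add: complex_eq_iff)
  have "k\<^sup>2 - (cnj k)\<^sup>2 = 2 * \<i> * complex_of_real (Im (k\<^sup>2))"
    by (simp add: complex_eq_iff power2_eq_square)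
  then show "(k\<^sup>2 - (cnj k)\<^sup>2) * (1 / (2 * \<i> * complex_of_real (Im (k\<^sup>2)))) = 1"
    using im by simp
  have "Im k \<noteq> 0" using im unfolding im2 by simp
  then show "(k - cnj k) * (1 / (2 * \<i> * complex_of_real (Im (k\<^sup>2)))) = complex_of_real (1 / (2 * Re k))"
    unfolding d im2 using k by (simp add: field_simps)
qed

text \<open>The resolvent kernel is dominated by the rank-one part \<open>\<phi> \<otimes> \<phi> / (kp + km)\<close>, with \<open>\<phi> = exp (- kp x)\<close>
on the right and \<open>exp (km x)\<close> on the left, whose norm is \<open>\<parallel>\<phi>\<parallel>\<^sup>2 / \<bar>kp + km\<bar>\<close>. To see this on one
vector, apply the resolvent to \<open>cnj \<phi>\<close>. The preimage \<open>u\<close> is \<open>\<nu> \<phi>\<close> with \<open>\<nu> = \<parallel>\<phi>\<parallel>\<^sup>2 / (kp + km)\<close>, plus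
the multiple \<open>1 / (2 \<i> Im (V - z))\<close> of \<open>cnj \<phi> - \<phi>\<close> on each half-line, whose norm accounts for the
subtracted term.\<close>

lemma onorm_resolvent_ge_rank_one:
  assumes z: "z \<in> resolvent_set (schroedinger_step Vp Vm)"
    and kp: "Re kp > 0" "kp\<^sup>2 = Vp - z" "Im (Vp - z) \<noteq> 0"
    and km: "Re km > 0" "km\<^sup>2 = Vm - z" "Im (Vm - z) \<noteq> 0"
  shows "(1 / (2 * Re kp) + 1 / (2 * Re km)) / cmod (kp + km) - (1 / \<bar>Im (Vp - z)\<bar> + 1 / \<bar>Im (Vm - z)\<bar>)
    \<le> onorm (resolvent (schroedinger_step Vp Vm) z)"
proof -
  define dp where "dp = Im (Vp - z)"
  define dm where "dm = Im (Vm - z)"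
  define N where "N = 1 / (2 * Re kp) + 1 / (2 * Re km)"
  have N: "N > 0" unfolding N_def using kp km by (intro add_pos_pos) auto
  have sum: "kp + km \<noteq> 0" using kp(1) km(1) by (metis add_pos_pos less_irrefl plus_complex.sel(1) zero_complex.sel(1))
  define \<nu> where "\<nu> = complex_of_real N / (kp + km)"
  define a where "a = 1 / (2 * \<i> * complex_of_real dp)"
  define b where "b = 1 / (2 * \<i> * complex_of_real dm)"
  have ap: "(kp\<^sup>2 - (cnj kp)\<^sup>2) * a = 1" "(kp - cnj kp) * a = complex_of_real (1 / (2 * Re kp))"
    unfolding a_def dp_def kp(2)[symmetric] using kp by (intro conjugate_root_identities; simp)+
  have bm: "(km\<^sup>2 - (cnj km)\<^sup>2) * b = 1" "(km - cnj km) * b = complex_of_real (1 / (2 * Re km))"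
    unfolding b_def dm_def km(2)[symmetric] using km by (intro conjugate_root_identities; simp)+
  have na: "cmod a = 1 / (2 * \<bar>dp\<bar>)" "cmod b = 1 / (2 * \<bar>dm\<bar>)"
    by (simp_all add: a_def b_def norm_divide norm_mult)
  let ?R = "\<lambda>p. abs_l2 (exp_right p)" and ?E = "\<lambda>q. abs_l2 (exp_left q)"
  define u where "u = a *\<^sub>C ?R (cnj kp) + (\<nu> - a) *\<^sub>C ?R kp + b *\<^sub>C ?E (cnj km) + (\<nu> - b) *\<^sub>C ?E km"
  have match: "a + (\<nu> - a) = b + (\<nu> - b)"
    "- (cnj kp * a + kp * (\<nu> - a)) = cnj km * b + km * (\<nu> - b)"
  proof -
    \<comment> \<open>The choice of \<open>\<nu>\<close> is dictated by the matching of slopes.\<close>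
    have "(kp + km) * \<nu> = complex_of_real N" using sum by (simp add: \<nu>_def)
    also have "\<dots> = (kp - cnj kp) * a + (km - cnj km) * b" unfolding ap(2) bm(2) by (simp add: N_def)
    finally show "- (cnj kp * a + kp * (\<nu> - a)) = cnj km * b + km * (\<nu> - b)"
      by (simp add: algebra_simps eq_neg_iff_add_eq_0 neg_eq_iff_add_eq_0)
  qed simp
  have st: "u \<in> sobolev 2" "snd (schroedinger_step Vp Vm) u - z *\<^sub>C u =
      ((Vp - z - (cnj kp)\<^sup>2) * a) *\<^sub>C ?R (cnj kp) + ((Vp - z - kp\<^sup>2) * (\<nu> - a)) *\<^sub>C ?R kp
      + ((Vm - z - (cnj km)\<^sup>2) * b) *\<^sub>C ?E (cnj km) + ((Vm - z - km\<^sup>2) * (\<nu> - b)) *\<^sub>C ?E km"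
    unfolding u_def by (rule two_exponential_state[OF _ _ _ _ match]; use kp km in simp)+
  have F: "snd (schroedinger_step Vp Vm) u - z *\<^sub>C u = ?R (cnj kp) + ?E (cnj km)"
    unfolding st(2) kp(2)[symmetric] km(2)[symmetric] ap(1) bm(1) by (simp add: scaleC_one scaleC_zero)
  define G where "G = ?R kp + ?E km"
  have nG2: "(norm G)\<^sup>2 = N" unfolding G_def N_def by (rule norm_exp_pair[OF kp(1) km(1)])
  have nG: "norm G > 0" using nG2 N by (metis norm_ge_zero less_eq_real_def power_zero_numeral less_irrefl)
  have "(norm (?R (cnj kp) + ?E (cnj km)))\<^sup>2 = N"
    unfolding N_def using norm_exp_pair[of "cnj kp" "cnj km"] kp(1) km(1) by simp
  then have nF: "norm (?R (cnj kp) + ?E (cnj km)) = norm G"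
    using nG2 by (metis norm_ge_zero power2_eq_iff_nonneg)
  have part: "norm (?R kp) \<le> norm G" "norm (?E km) \<le> norm G"
  proof -
    have "(norm (?R kp))\<^sup>2 \<le> (norm G)\<^sup>2" "(norm (?E km))\<^sup>2 \<le> (norm G)\<^sup>2"
      unfolding nG2 exp_right_norm(2)[OF kp(1)] exp_left_norm(2)[OF km(1)] N_def using kp(1) km(1) by simp_all
    then show "norm (?R kp) \<le> norm G" "norm (?E km) \<le> norm G"
      by (auto intro: power2_le_imp_le)
  qed
  have cn: "norm (?R (cnj kp)) = norm (?R kp)" "norm (?E (cnj km)) = norm (?E km)"
    using kp(1) km(1) by (simp_all add: norm_exp_right norm_exp_left)
  have "\<nu> *\<^sub>C G = u - (a *\<^sub>C (?R (cnj kp)) - a *\<^sub>C ?R kp) - (b *\<^sub>C ?E (cnj km) - b *\<^sub>C ?E km)"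
  proof -
    have diff: "(c - d) *\<^sub>C x = c *\<^sub>C x - d *\<^sub>C x" for c d and x :: l2
      using scaleC_add_left[of "c - d" d x] by (simp add: algebra_simps)
    show ?thesis unfolding u_def G_def diff scaleC_add_right by simp
  qed
  then have "norm (\<nu> *\<^sub>C G) \<le> norm u + norm (a *\<^sub>C (?R (cnj kp)) - a *\<^sub>C ?R kp) + norm (b *\<^sub>C ?E (cnj km) - b *\<^sub>C ?E km)"
    by (simp only: norm_diff_diff_le)
  also have "norm (a *\<^sub>C (?R (cnj kp)) - a *\<^sub>C ?R kp) \<le> 1 / \<bar>dp\<bar> * norm G"
  proof -
    have "norm (a *\<^sub>C (?R (cnj kp)) - a *\<^sub>C ?R kp) \<le> 2 * (cmod a * norm (?R kp))"
      using norm_triangle_ineq4[of "a *\<^sub>C (?R (cnj kp))" "a *\<^sub>C ?R kp"] by (simp add: norm_scaleC cn)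
    also have "\<dots> \<le> 2 * (cmod a * norm G)" by (intro mult_left_mono part) auto
    finally show ?thesis by (simp add: na)
  qed
  also have "norm (b *\<^sub>C (?E (cnj km)) - b *\<^sub>C ?E km) \<le> 1 / \<bar>dm\<bar> * norm G"
  proof -
    have "norm (b *\<^sub>C (?E (cnj km)) - b *\<^sub>C ?E km) \<le> 2 * (cmod b * norm (?E km))"
      using norm_triangle_ineq4[of "b *\<^sub>C (?E (cnj km))" "b *\<^sub>C ?E km"] by (simp add: norm_scaleC cn)
    also have "\<dots> \<le> 2 * (cmod b * norm G)" by (intro mult_left_mono part) auto
    finally show ?thesis by (simp add: na)
  qed
  finally have 1: "cmod \<nu> * norm G \<le> norm u + 1 / \<bar>dp\<bar> * norm G + 1 / \<bar>dm\<bar> * norm G"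
    by (simp add: norm_scaleC)
  have "norm u \<le> onorm (resolvent (schroedinger_step Vp Vm) z) * norm G"
    using norm_le_onorm_resolvent[OF z, of u] st(1) unfolding F nF by simp
  then have "(cmod \<nu> - (1 / \<bar>dp\<bar> + 1 / \<bar>dm\<bar>)) * norm G \<le> onorm (resolvent (schroedinger_step Vp Vm) z) * norm G"
    using 1 by (simp add: algebra_simps)
  then have "cmod \<nu> - (1 / \<bar>dp\<bar> + 1 / \<bar>dm\<bar>) \<le> onorm (resolvent (schroedinger_step Vp Vm) z)"
    using nG by simp
  moreover have "cmod \<nu> = N / cmod (kp + km)" using N by (simp add: \<nu>_def norm_divide)
  ultimately show ?thesis by (simp add: N_def dp_def dm_def)
qed

text \<open>The identities \<open>Re (V - z) = (Re k)\<^sup>2 - (Im k)\<^sup>2\<close> and \<open>Im (V - z) = 2 Re k Im k\<close> show that far to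
the right the root is almost imaginary: its imaginary part grows like \<open>sqrt (Re z)\<close>, with the sign
of \<open>Im (V - z)\<close>, while its real part decays accordingly.\<close>

lemma root_lower_bounds:
  fixes k :: complex
  assumes k: "Re k > 0" "k\<^sup>2 = V - z" and im: "Im (V - z) \<noteq> 0" and m: "Re V \<le> m" "m \<le> Re z"
  shows "sqrt (Re z - m) / \<bar>Im (V - z)\<bar> \<le> 1 / (2 * Re k)"
    "sqrt (Re z - m) \<le> sgn (Im (V - z)) * Im k"
proof -
  have im2: "Im (V - z) = 2 * Re k * Im k" and re2: "Re (V - z) = (Re k)\<^sup>2 - (Im k)\<^sup>2"
    unfolding k(2)[symmetric] by (simp_all add: power2_eq_square)
  have nz: "Im k \<noteq> 0" using im unfolding im2 by simp
  have "Re z - m \<le> (Im k)\<^sup>2"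
  proof -
    have "(Im k)\<^sup>2 = (Re k)\<^sup>2 + (Re z - Re V)" using re2 by simp
    then show ?thesis using m zero_le_power2[of "Re k"] by linarith
  qed
  then have s: "sqrt (Re z - m) \<le> \<bar>Im k\<bar>" using real_sqrt_le_mono by fastforce
  have "sgn (Im (V - z)) * Im k = \<bar>Im k\<bar>"
    unfolding im2 using k(1) by (simp add: sgn_mult abs_sgn mult.commute)
  then show "sqrt (Re z - m) \<le> sgn (Im (V - z)) * Im k" using s by simp
  have "\<bar>Im (V - z)\<bar> = 2 * Re k * \<bar>Im k\<bar>" unfolding im2 using k(1) by (simp add: abs_mult)
  then have "1 / (2 * Re k) = \<bar>Im k\<bar> / \<bar>Im (V - z)\<bar>" using nz k(1) by (simp add: field_simps)
  then show "sqrt (Re z - m) / \<bar>Im (V - z)\<bar> \<le> 1 / (2 * Re k)"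
    using s by (simp add: divide_right_mono)
qed

text \<open>Inside the strip \<open>Im kp\<close> and \<open>Im km\<close> have opposite signs, so \<open>kp - km\<close> is large and
\<open>kp + km = (Vp - Vm) / (kp - km)\<close> is small. Inserting the bounds on the roots into the rank-one
estimate gives linear growth in \<open>Re z\<close>.\<close>

lemma strip_resolvent_lower_bound:
  assumes z: "z \<in> resolvent_set (schroedinger_step Vp Vm)"
    and strip: "Im z \<in> {min (Im Vp) (Im Vm)<..<max (Im Vp) (Im Vm)}"
    and m: "Re Vp \<le> m" "Re Vm \<le> m" "m \<le> Re z"
  shows "\<bar>Im Vp - Im Vm\<bar> / (cmod (Vp - Vm) * (\<bar>Im Vp - Im z\<bar> * \<bar>Im Vm - Im z\<bar>)) * (2 * (Re z - m) - cmod (Vp - Vm))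
    \<le> onorm (resolvent (schroedinger_step Vp Vm) z)"
proof -
  define dp where "dp = Im (Vp - z)"
  define dm where "dm = Im (Vm - z)"
  have d: "dp * dm < 0" "dp \<noteq> 0" "dm \<noteq> 0"
    using strip by (auto simp: dp_def dm_def min_def max_def mult_less_0_iff split: if_splits)
  have nl: "z \<notin> half_line Vp" "z \<notin> half_line Vm"
    using d by (auto simp: half_line_def dp_def dm_def)
  obtain kp km where k: "Re kp > 0" "kp\<^sup>2 = Vp - z" "Re km > 0" "km\<^sup>2 = Vm - z"
    using decaying_root_exists[OF nl(1)] decaying_root_exists[OF nl(2)] by blast
  define s where "s = sqrt (Re z - m)"
  have s: "s \<ge> 0" "s * s = Re z - m" using m by (simp_all add: s_def)
  define D where "D = \<bar>Im Vp - Im Vm\<bar>"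
  define E where "E = \<bar>dp\<bar> * \<bar>dm\<bar>"
  define W where "W = cmod (Vp - Vm)"
  have DE: "D = \<bar>dp\<bar> + \<bar>dm\<bar>" "E > 0" "1 / \<bar>dp\<bar> + 1 / \<bar>dm\<bar> = D / E"
  proof -
    show "D = \<bar>dp\<bar> + \<bar>dm\<bar>"
      using d(1) by (auto simp: D_def dp_def dm_def mult_less_0_iff)
    then show "1 / \<bar>dp\<bar> + 1 / \<bar>dm\<bar> = D / E" using d by (simp add: E_def field_simps)
    show "E > 0" using d by (simp add: E_def)
  qed
  have W: "W > 0"
  proof -
    have "D > 0" using DE(1) d by simp
    then have "Vp \<noteq> Vm" by (auto simp: D_def)
    then show ?thesis by (simp add: W_def)
  qed
  note rp = root_lower_bounds[OF k(1,2) d(2)[unfolded dp_def] m(1,3), folded s_def dp_def]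
  note rm = root_lower_bounds[OF k(3,4) d(3)[unfolded dm_def] m(2,3), folded s_def dm_def]
  define N where "N = 1 / (2 * Re kp) + 1 / (2 * Re km)"
  have N: "s * (D / E) \<le> N"
    using rp(1) rm(1) unfolding N_def DE(3)[symmetric] by (simp add: distrib_left)
  \<comment> \<open>Opposite signs make the two imaginary parts add up.\<close>
  have "2 * s \<le> \<bar>Im kp - Im km\<bar>"
    using rp(2) rm(2) d(1) by (auto simp: mult_less_0_iff sgn_if split: if_splits)
  also have "\<dots> \<le> cmod (kp - km)" using abs_Im_le_cmod[of "kp - km"] by simp
  finally have gap: "2 * s \<le> cmod (kp - km)" .
  have "(kp + km) * (kp - km) = kp\<^sup>2 - km\<^sup>2" by (simp add: power2_eq_square algebra_simps)
  also have "\<dots> = Vp - Vm" unfolding k(2,4) by simp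
  finally have "(kp + km) * (kp - km) = Vp - Vm" .
  then have prod: "cmod (kp + km) * cmod (kp - km) = W" unfolding W_def by (metis norm_mult)
  then have nz: "cmod (kp + km) > 0" using W by (metis mult_zero_left less_irrefl zero_less_norm_iff norm_zero)
  have inv: "1 / cmod (kp + km) = cmod (kp - km) / W" using prod nz W by (simp add: field_simps)
  have "D / (W * E) * (2 * (Re z - m)) = (s * (D / E)) * ((2 * s) / W)"
    unfolding s(2)[symmetric] using W DE(2) by (simp add: field_simps)
  also have "\<dots> \<le> N * (cmod (kp - km) / W)"
    using s(1) DE W by (intro mult_mono N divide_right_mono gap) (auto intro!: mult_nonneg_nonneg divide_nonneg_nonneg order_trans[OF _ N])
  also have "\<dots> = N / cmod (kp + km)" unfolding inv[symmetric] by simp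
  finally have "D / (W * E) * (2 * (Re z - m)) - D / E \<le> N / cmod (kp + km) - (1 / \<bar>dp\<bar> + 1 / \<bar>dm\<bar>)"
    unfolding DE(3) by simp
  also have "\<dots> \<le> onorm (resolvent (schroedinger_step Vp Vm) z)"
    unfolding N_def dp_def dm_def using k d
    by (intro onorm_resolvent_ge_rank_one[OF z]) (auto simp: dp_def dm_def)
  also have "D / (W * E) * (2 * (Re z - m)) - D / E = D / (W * E) * (2 * (Re z - m) - W)"
    using W DE(2) by (simp add: field_simps)
  finally show ?thesis by (simp add: D_def W_def E_def dp_def dm_def)
qed

section \<open>The pseudospectrum\<close>

text \<open>Immediate from the inverse-distance bound, taken at a spectral point closer to \<open>z\<close> than \<open>\<epsilon>\<close>.\<close>

lemma open_nbhd_spectrum_subset_pseudospectrum: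
  assumes "\<epsilon> > 0"
  shows "open_nbhd (spectrum (schroedinger_step Vp Vm)) \<epsilon> \<subseteq> pseudospectrum \<epsilon> (schroedinger_step Vp Vm)"
proof
  let ?L = "schroedinger_step Vp Vm"
  fix z assume "z \<in> open_nbhd (spectrum ?L) \<epsilon>"
  then have ne: "spectrum ?L \<noteq> {}" and "infdist z (spectrum ?L) < \<epsilon>" by (auto simp: open_nbhd_def)
  then obtain l where l: "l \<in> spectrum ?L" "dist z l < \<epsilon>"
    using infdist_notempty[OF ne] cINF_less_iff[of "spectrum ?L" "dist z" \<epsilon>] by (auto intro!: bdd_belowI2[of _ 0])
  show "z \<in> pseudospectrum \<epsilon> ?L"
  proof (cases "z \<in> spectrum ?L")
    case False
    then have z: "z \<in> resolvent_set ?L" by (simp add: spectrum_def)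
    have 1: "1 \<le> onorm (resolvent ?L z) * cmod (l - z)"
      by (rule onorm_resolvent_ge_inverse_distance[OF z]) (use l in \<open>simp add: spectrum_schroedinger_step\<close>)
    have "0 \<le> onorm (resolvent ?L z)" using z by (intro onorm_pos_le) (simp add: resolvent_set_def)
    then have pos: "0 < onorm (resolvent ?L z)" using 1 by (cases "onorm (resolvent ?L z) = 0") simp_all
    have "cmod (l - z) < \<epsilon>" using l(2) by (simp add: dist_norm norm_minus_commute)
    then have "1 < onorm (resolvent ?L z) * \<epsilon>"
      using 1 mult_strict_left_mono[OF _ pos, of "cmod (l - z)" \<epsilon>] by linarith
    then have "inverse \<epsilon> < onorm (resolvent ?L z)" using assms by (simp add: field_simps)
    then show ?thesis using False by (simp add: pseudospectrum_def)
  qed (simp add: pseudospectrum_def)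
qed

text \<open>When the imaginary parts agree, the spectrum is a single half-line, hence convex, and the numerical
range lies in it. A point \<open>z\<close> off the spectrum is separated from it by a line at the full distance,
and the unit normal \<open>c\<close> of that line turns the numerical range estimate into the bound by the
inverse distance.\<close>

lemma pseudospectrum_subset_open_nbhd:
  assumes im: "Im Vp = Im Vm" and \<epsilon>: "\<epsilon> > 0"
  shows "pseudospectrum \<epsilon> (schroedinger_step Vp Vm) \<subseteq> open_nbhd (spectrum (schroedinger_step Vp Vm)) \<epsilon>"
proof
  let ?L = "schroedinger_step Vp Vm"
  have ne: "spectrum ?L \<noteq> {}" by (auto simp: spectrum_schroedinger_step half_line_def)
  fix z assume z: "z \<in> pseudospectrum \<epsilon> ?L"
  have near: "z \<in> open_nbhd (spectrum ?L) \<epsilon>" if "l \<in> spectrum ?L" "dist z l < \<epsilon>" for l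
    using infdist_le[OF that(1), of z] that(2) ne by (simp add: open_nbhd_def)
  show "z \<in> open_nbhd (spectrum ?L) \<epsilon>"
  proof (cases "z \<in> spectrum ?L")
    case True
    then show ?thesis using near[of z] \<epsilon> by simp
  next
    case False
    then have r: "z \<in> resolvent_set ?L" and big: "inverse \<epsilon> < onorm (resolvent ?L z)"
      using z by (auto simp: spectrum_def pseudospectrum_def)
    have off: "z \<notin> half_line Vp" "z \<notin> half_line Vm" using False by (auto simp: spectrum_schroedinger_step)
    define m where "m = min (Re Vp) (Re Vm)"
    have "\<exists>l\<in>spectrum ?L. \<exists>c. Re c \<ge> 0 \<and> cmod c \<le> 1 \<and> dist z l > 0 \<and>
        dist z l \<le> Re (c * (Vp - z)) \<and> dist z l \<le> Re (c * (Vm - z))"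
    proof (cases "m \<le> Re z")
      case True
      \<comment> \<open>The nearest spectral point lies straight above or below \<open>z\<close>, and the separating line is
        horizontal.\<close>
      define l where "l = Complex (Re z) (Im Vp)"
      define c where "c = - \<i> * complex_of_real (sgn (Im Vp - Im z))"
      have nz: "Im Vp - Im z \<noteq> 0" using True off im by (auto simp: m_def half_line_def min_def split: if_splits)
      have l: "l \<in> spectrum ?L" using True im
        by (auto simp: l_def spectrum_schroedinger_step half_line_def m_def min_def split: if_splits)
      have "z - l = \<i> * complex_of_real (Im z - Im Vp)" by (simp add: l_def complex_eq_iff)
      then have dist: "dist z l = \<bar>Im Vp - Im z\<bar>" unfolding dist_norm
        by (simp add: norm_mult del: of_real_diff)
      have "Re (c * (V - z)) = \<bar>Im Vp - Im z\<bar>" if "Im V = Im Vp" for V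
        using that by (simp add: c_def abs_sgn mult.commute)
      moreover have "Re c = 0" "cmod c \<le> 1" by (simp_all add: c_def norm_mult sgn_if)
      ultimately show ?thesis using l dist nz im by (intro bexI[of _ l] exI[of _ c]) auto
    next
      case False
      \<comment> \<open>The nearest spectral point is the end point of the half-line.\<close>
      define l where "l = Complex m (Im Vp)"
      define c where "c = cnj (l - z) / complex_of_real (cmod (l - z))"
      have l: "l \<in> spectrum ?L" using im
        by (auto simp: l_def spectrum_schroedinger_step half_line_def m_def min_def)
      have rl: "Re (l - z) > 0" using False by (simp add: l_def)
      then have pos: "cmod (l - z) > 0" by auto
      have dist: "dist z l = cmod (l - z)" by (simp add: dist_norm norm_minus_commute)
      have rc: "Re c > 0" using rl pos by (simp add: c_def)
      have nc: "cmod c \<le> 1" using pos by (simp add: c_def norm_divide del: complex_cnj_diff)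
      have main: "c * (l - z) = complex_of_real (cmod (l - z))"
      proof -
        have g: "cnj w / complex_of_real (cmod w) * w = complex_of_real (cmod w)" if "w \<noteq> 0" for w
          using that complex_norm_square[of w] by (simp add: field_simps power2_eq_square)
        show ?thesis unfolding c_def by (rule g) (use pos in auto)
      qed
      have "cmod (l - z) \<le> Re (c * (V - z))" if "Im V = Im Vp" "m \<le> Re V" for V
      proof -
        have "V - z = (l - z) + complex_of_real (Re V - m)" using that by (simp add: l_def complex_eq_iff)
        then have "c * (V - z) = complex_of_real (cmod (l - z)) + c * complex_of_real (Re V - m)"
          by (simp only: distrib_left main)
        then have "Re (c * (V - z)) = cmod (l - z) + Re c * (Re V - m)" by simp
        then show ?thesis using rc that by simp
      qed
      then show ?thesis using l rc nc pos dist im unfolding m_def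
        by (intro bexI[of _ l] exI[of _ c]) auto
    qed
    then obtain l c where lc: "l \<in> spectrum ?L" "Re c \<ge> 0" "cmod c \<le> 1" "dist z l > 0"
      "dist z l \<le> Re (c * (Vp - z))" "dist z l \<le> Re (c * (Vm - z))" by blast
    have "onorm (resolvent ?L z) \<le> inverse (dist z l)"
    proof (rule onorm_resolvent_le[OF r lc(4)])
      fix u assume "u \<in> fst ?L"
      then have "u \<in> sobolev 2" by simp
      then obtain U U1 U2 where U: "h2_representative U U1 U2" "u = abs_l2 U"
        by (rule sobolev_imp_h2_representative)
      show "dist z l * norm u \<le> norm (snd ?L u - z *\<^sub>C u)"
        unfolding U(2) schroedinger_step_h2[OF U(1)] by (rule numerical_range_bound[OF U(1) lc(2,3,5,6)])
    qed
    then have "inverse \<epsilon> < inverse (dist z l)" using big by simp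
    then have "dist z l < \<epsilon>" using \<epsilon> lc(4) by (simp add: inverse_less_iff_less)
    then show ?thesis by (rule near[OF lc(1)])
  qed
qed

lemma strip_subset_pseudospectrum:
  assumes "0 < \<epsilon>'" "\<epsilon>' < 1"
  shows "\<exists>M>0. \<forall>\<epsilon>>0. {z. Re z > M \<and> Im z \<in> {min (Im Vp) (Im Vm)<..<max (Im Vp) (Im Vm)} \<and>
      Re z > 1 / (\<epsilon> * (1 - \<epsilon>')) *
        (cmod (Vp - Vm) * \<bar>Im Vp - Im z\<bar> * \<bar>Im Vm - Im z\<bar> / (2 * \<bar>Im Vp - Im Vm\<bar>))}
    \<subseteq> pseudospectrum \<epsilon> (schroedinger_step Vp Vm)"
proof -
  let ?L = "schroedinger_step Vp Vm"
  define m where "m = max (Re Vp) (Re Vm)"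
  define W where "W = cmod (Vp - Vm)"
  \<comment> \<open>Beyond \<open>M\<close> the loss \<open>2 m + W\<close> in the lower bound is at most the fraction \<open>\<epsilon>'\<close> of \<open>2 Re z\<close>,
    uniformly over the strip.\<close>
  define M where "M = 1 + (\<bar>m\<bar> + W) / \<epsilon>'"
  have W0: "W \<ge> 0" by (simp add: W_def)
  have M: "M > 0" unfolding M_def using assms W0 by (intro add_pos_nonneg divide_nonneg_nonneg) auto
  have "z \<in> pseudospectrum \<epsilon> ?L"
    if \<epsilon>: "\<epsilon> > 0" and z: "Re z > M" "Im z \<in> {min (Im Vp) (Im Vm)<..<max (Im Vp) (Im Vm)}"
      "Re z > 1 / (\<epsilon> * (1 - \<epsilon>')) * (W * \<bar>Im Vp - Im z\<bar> * \<bar>Im Vm - Im z\<bar> / (2 * \<bar>Im Vp - Im Vm\<bar>))" for z \<epsilon>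
  proof (cases "z \<in> spectrum ?L")
    case False
    then have r: "z \<in> resolvent_set ?L" by (simp add: spectrum_def)
    define D where "D = \<bar>Im Vp - Im Vm\<bar>"
    define E where "E = \<bar>Im Vp - Im z\<bar> * \<bar>Im Vm - Im z\<bar>"
    have DE: "D > 0" "E > 0" using z(2) by (auto simp: D_def E_def min_def max_def split: if_splits)
    have Wpos: "W > 0" using DE by (auto simp: W_def D_def)
    have "(\<bar>m\<bar> + W) / \<epsilon>' < Re z" using z(1) by (simp add: M_def)
    then have e1: "\<bar>m\<bar> + W \<le> \<epsilon>' * Re z" using assms by (simp add: field_simps)
    have zpos: "Re z > 0" using z(1) M by simp
    have "\<epsilon>' * Re z \<le> Re z" using assms zpos by simp
    then have mz: "m \<le> Re z" using e1 Wpos by linarith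
    have "1 / (\<epsilon> * (1 - \<epsilon>')) * (W * E / (2 * D)) < Re z" using z(3) by (simp add: D_def E_def mult.assoc)
    then have "inverse \<epsilon> < D / (W * E) * (2 * ((1 - \<epsilon>') * Re z))"
      using \<epsilon> assms DE Wpos by (simp add: field_simps)
    also have "\<dots> \<le> D / (W * E) * (2 * (Re z - m) - W)"
    proof (rule mult_left_mono)
      show "2 * ((1 - \<epsilon>') * Re z) \<le> 2 * (Re z - m) - W"
        using e1 Wpos by (simp add: left_diff_distrib)
    qed (use DE Wpos in simp)
    also have "\<dots> \<le> onorm (resolvent ?L z)"
      unfolding D_def W_def E_def by (rule strip_resolvent_lower_bound[OF r z(2) _ _ mz]) (simp_all add: m_def)
    finally show ?thesis using False by (simp add: pseudospectrum_def)
  qed (simp add: pseudospectrum_def)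
  then show ?thesis using M unfolding W_def by blast
qed

text \<open>On the middle line of the strip the distance to the spectrum is constant, yet every such point far
enough to the right belongs to the \<open>\<epsilon>\<close>-pseudospectrum, however small \<open>\<epsilon>\<close> is.\<close>

lemma not_trivial_pseudospectrum:
  assumes ne: "Im Vp \<noteq> Im Vm"
  shows "\<not> trivial_pseudospectrum (schroedinger_step Vp Vm)"
proof
  let ?L = "schroedinger_step Vp Vm"
  assume "trivial_pseudospectrum ?L"
  then obtain C where C: "C > 0" "\<And>\<epsilon>. \<epsilon> > 0 \<Longrightarrow> pseudospectrum \<epsilon> ?L \<subseteq> open_nbhd (spectrum ?L) (C * \<epsilon>)"
    unfolding trivial_pseudospectrum_def by blast
  obtain M where M: "M > 0" "\<And>\<epsilon>. \<epsilon> > 0 \<Longrightarrow> {z. Re z > M \<and> Im z \<in> {min (Im Vp) (Im Vm)<..<max (Im Vp) (Im Vm)} \<and>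
      Re z > 1 / (\<epsilon> * (1 - 1 / 2)) *
        (cmod (Vp - Vm) * \<bar>Im Vp - Im z\<bar> * \<bar>Im Vm - Im z\<bar> / (2 * \<bar>Im Vp - Im Vm\<bar>))}
    \<subseteq> pseudospectrum \<epsilon> ?L"
    using strip_subset_pseudospectrum[of "1 / 2" Vp Vm] by auto
  define h where "h = \<bar>Im Vp - Im Vm\<bar> / 2"
  have h: "h > 0" using ne by (simp add: h_def)
  \<comment> \<open>Chosen so that \<open>C * \<epsilon>\<close> is the distance \<open>h\<close> from the middle line to the spectrum.\<close>
  define \<epsilon> where "\<epsilon> = h / C"
  have \<epsilon>: "\<epsilon> > 0" using h C by (simp add: \<epsilon>_def)
  define y where "y = (Im Vp + Im Vm) / 2"
  define B where "B = 1 / (\<epsilon> * (1 - 1 / 2)) * (cmod (Vp - Vm) * \<bar>Im Vp - y\<bar> * \<bar>Im Vm - y\<bar> / (2 * \<bar>Im Vp - Im Vm\<bar>))"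
  define z where "z = Complex (max M B + 1) y"
  have "z \<in> pseudospectrum \<epsilon> ?L"
  proof (rule subsetD[OF M(2)[OF \<epsilon>]], rule CollectI, intro conjI)
    show "M < Re z" by (simp add: z_def)
    show "Im z \<in> {min (Im Vp) (Im Vm)<..<max (Im Vp) (Im Vm)}"
      using ne by (auto simp: z_def y_def min_def max_def)
    have "B < Re z" by (simp add: z_def)
    then show "1 / (\<epsilon> * (1 - 1 / 2)) * (cmod (Vp - Vm) * \<bar>Im Vp - Im z\<bar> * \<bar>Im Vm - Im z\<bar> / (2 * \<bar>Im Vp - Im Vm\<bar>)) < Re z"
      by (simp add: z_def B_def)
  qed
  then have "z \<in> open_nbhd (spectrum ?L) (C * \<epsilon>)" using C(2)[OF \<epsilon>] by blast
  then have n: "spectrum ?L \<noteq> {}" and "infdist z (spectrum ?L) < h"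
    using C(1) by (auto simp: open_nbhd_def \<epsilon>_def)
  then obtain l where l: "l \<in> spectrum ?L" "dist z l < h"
    using infdist_notempty[OF n] cINF_less_iff[of "spectrum ?L" "dist z" h] by (auto intro!: bdd_belowI2[of _ 0])
  have "h \<le> \<bar>Im z - Im l\<bar>"
    using l(1) by (auto simp: spectrum_schroedinger_step half_line_def z_def y_def h_def field_simps abs_if)
  also have "\<dots> \<le> dist z l" using abs_Im_le_cmod[of "z - l"] by (simp add: dist_norm)
  finally show False using l(2) by simp
qed

theorem corollary2p8:
  fixes Vp Vm :: complex
  defines "L \<equiv> schroedinger_step Vp Vm"
  shows
    "(Im Vp = Im Vm \<longrightarrow>
        (\<forall>\<epsilon>>0. pseudospectrum \<epsilon> L = open_nbhd (spectrum L) \<epsilon>)) \<and>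
     (Im Vp \<noteq> Im Vm \<longrightarrow>
        (\<forall>\<epsilon>'. 0 < \<epsilon>' \<and> \<epsilon>' < 1 \<longrightarrow>
          (\<exists>M>0. \<forall>\<epsilon>>0.
             open_nbhd (spectrum L) \<epsilon> \<subseteq> pseudospectrum \<epsilon> L \<and>
             {z. Re z > M \<and> Im z \<in> {min (Im Vp) (Im Vm)<..<max (Im Vp) (Im Vm)} \<and>
                 Re z > 1 / (\<epsilon> * (1 - \<epsilon>')) *
                   (cmod (Vp - Vm) * \<bar>Im Vp - Im z\<bar> * \<bar>Im Vm - Im z\<bar> /
                    (2 * \<bar>Im Vp - Im Vm\<bar>))}
               \<subseteq> pseudospectrum \<epsilon> L))) \<and>
     (trivial_pseudospectrum L \<longleftrightarrow> Im Vp = Im Vm)"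
proof (intro conjI impI allI)
  have eq: "pseudospectrum \<epsilon> L = open_nbhd (spectrum L) \<epsilon>" if "Im Vp = Im Vm" "\<epsilon> > 0" for \<epsilon>
    unfolding L_def using pseudospectrum_subset_open_nbhd[OF that]
      open_nbhd_spectrum_subset_pseudospectrum[OF that(2)] by (rule equalityI)
  then show "pseudospectrum \<epsilon> L = open_nbhd (spectrum L) \<epsilon>" if "Im Vp = Im Vm" "\<epsilon> > 0" for \<epsilon>
    using that .
  show "\<exists>M>0. \<forall>\<epsilon>>0. open_nbhd (spectrum L) \<epsilon> \<subseteq> pseudospectrum \<epsilon> L \<and>
      {z. Re z > M \<and> Im z \<in> {min (Im Vp) (Im Vm)<..<max (Im Vp) (Im Vm)} \<and>
          Re z > 1 / (\<epsilon> * (1 - \<epsilon>')) *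
            (cmod (Vp - Vm) * \<bar>Im Vp - Im z\<bar> * \<bar>Im Vm - Im z\<bar> / (2 * \<bar>Im Vp - Im Vm\<bar>))}
        \<subseteq> pseudospectrum \<epsilon> L" if "0 < \<epsilon>' \<and> \<epsilon>' < 1" for \<epsilon>'
    unfolding L_def using strip_subset_pseudospectrum[of \<epsilon>' Vp Vm] that
      open_nbhd_spectrum_subset_pseudospectrum[of _ Vp Vm] by blast
  show "trivial_pseudospectrum L \<longleftrightarrow> Im Vp = Im Vm"
  proof
    assume "trivial_pseudospectrum L"
    then show "Im Vp = Im Vm" using not_trivial_pseudospectrum unfolding L_def by blast
  next
    assume "Im Vp = Im Vm"
    from eq[OF this] show "trivial_pseudospectrum L"
      unfolding trivial_pseudospectrum_def by (intro exI[of _ 1]) simp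
  qed
qed

end
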